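(* Let $m\ge3$ be an integer and let $A=\langle\alpha,\beta\mid w(\alpha,\beta:m)=w(\beta,\alpha:m)\rangle$. (i) Let $m$ be odd. Then $\mathrm{Aut}(A)$ is generated by the inner automorphisms and the automorphism $\epsilon$. Thus $$\mathrm{Aut}(A)=\mathrm{Inn}(A)\rtimes\langle\epsilon\rangle\cong(A/Z(A))\rtimes C_2,$$ and, in particular, $\mathrm{Out}(A)\cong C_2$. (ii) Let $m$ be even. Then $\mathrm{Aut}(A)$ is generated by the inner automorphisms and the automorphisms $\epsilon,\tau,\eta$. Thus $$\mathrm{Aut}(A)=\mathrm{Inn}(A)\rtimes\langle\epsilon,\tau,\eta\rangle\cong(A/Z(A))\rtimes((\mathbb{Z}\rtimes C_2)\times C_2),$$ and, in particular, $\mathrm{Out}(A)\cong(\mathbb{Z}\rtimes C_2)\times C_2$.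
   Context: $w(\alpha,\beta:m)$ denotes the word $\alpha\beta\alpha\cdots$ of length $m$ (alternating, starting with $\alpha$). $Z(A)$ is the centre of $A$ and $C_2$ is the group of order 2. Automorphisms of $A$: $\epsilon(\alpha)=\alpha^{-1}$, $\epsilon(\beta)=\beta^{-1}$; $\tau(\alpha)=\beta$, $\tau(\beta)=\alpha$; and, for $m$ even, $\eta(\alpha)=\beta^{-1}$, $\eta(\beta)=\beta\alpha\beta$, which is of infinite order. The automorphism $\epsilon$ commutes with $\tau$ and $\eta$, and $\tau\eta\tau=\eta^{-1}$; in $\mathbb{Z}\rtimes C_2$ the generator of $C_2$ acts on $\mathbb{Z}$ by inversion ($\eta$ generating $\mathbb{Z}$ and $\tau$ generating this $C_2$). *)

theory Defs
  imports "HOL-Algebra.Bij" "HOL-Algebra.Generated_Groups" "HOL-Algebra.Elementary_Groups"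
begin

section \<open>Groups given by a presentation\<close>

text \<open>
  A letter \<open>(x, True)\<close> stands for the generator \<open>x\<close> and \<open>(x, False)\<close> for its formal inverse.
  All elements of the type of generators are generators; a pair \<open>(r, s) \<in> R\<close> is the relation
  \<open>r = s\<close>. The presented group is the quotient of the monoid of words by the congruence
  generated by \<open>R\<close> and free cancellation.
\<close>

type_synonym 'g word = "('g \<times> bool) list"

inductive word_eq :: "('g word \<times> 'g word) set \<Rightarrow> 'g word \<Rightarrow> 'g word \<Rightarrow> bool"
  for R where
  refl: "word_eq R u u"
| sym: "word_eq R u v \<Longrightarrow> word_eq R v u"
| trans: "word_eq R u v \<Longrightarrow> word_eq R v w \<Longrightarrow> word_eq R u w"
| cancel: "word_eq R (u @ [(x, b), (x, \<not> b)] @ v) (u @ v)"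
| relator: "(r, s) \<in> R \<Longrightarrow> word_eq R (u @ r @ v) (u @ s @ v)"

definition word_class :: "('g word \<times> 'g word) set \<Rightarrow> 'g word \<Rightarrow> 'g word set" where
  "word_class R u = {v. word_eq R u v}"

definition presented_group :: "('g word \<times> 'g word) set \<Rightarrow> 'g word set monoid" where
  "presented_group R =
     \<lparr>carrier = range (word_class R),
      mult = (\<lambda>X Y. \<Union>x\<in>X. \<Union>y\<in>Y. word_class R (x @ y)),
      one = word_class R []\<rparr>"

definition pres_gen :: "('g word \<times> 'g word) set \<Rightarrow> 'g \<Rightarrow> 'g word set" where
  "pres_gen R x = word_class R [(x, True)]"

fun eval_word :: "('a, 'b) monoid_scheme \<Rightarrow> ('g \<Rightarrow> 'a) \<Rightarrow> 'g word \<Rightarrow> 'a" where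
  "eval_word G f [] = \<one>\<^bsub>G\<^esub>"
| "eval_word G f ((x, b) # w) = (if b then f x else inv\<^bsub>G\<^esub> f x) \<otimes>\<^bsub>G\<^esub> eval_word G f w"

text \<open>
  The homomorphism out of a presented group with prescribed images of the generators;
  meaningful when these images satisfy the relations (see \<open>pres_lift_hom\<close>,
  \<open>pres_lift_gen\<close> and \<open>pres_hom_unique\<close> below).
\<close>

definition pres_lift ::
  "('g word \<times> 'g word) set \<Rightarrow> ('a, 'b) monoid_scheme \<Rightarrow> ('g \<Rightarrow> 'a) \<Rightarrow> 'g word set \<Rightarrow> 'a" where
  "pres_lift R G f = (\<lambda>X \<in> carrier (presented_group R). the_elem (eval_word G f ` X))"

lemma word_eq_append:
  assumes "word_eq R u u'" "word_eq R v v'"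
  shows "word_eq R (u @ v) (u' @ v')"
proof -
  have 1: "word_eq R (w @ u) (w @ v)" if "word_eq R u v" for w u v
    using that
  proof induction
    case (cancel u x b v) then show ?case using word_eq.cancel[of R "w @ u"] by simp
  next
    case (relator r s u v) then show ?case using word_eq.relator[of r s R "w @ u"] by simp
  qed (blast intro: word_eq.intros)+
  have 2: "word_eq R (u @ w) (v @ w)" if "word_eq R u v" for w u v
    using that
  proof induction
    case (cancel u x b v) then show ?case using word_eq.cancel[of R u x b "v @ w"] by simp
  next
    case (relator r s u v) then show ?case using word_eq.relator[of r s R u "v @ w"] by simp
  qed (blast intro: word_eq.intros)+
  show ?thesis using 1[OF assms(2)] 2[OF assms(1)] word_eq.trans by blast
qed

lemma word_class_eq_iff: "word_class R u = word_class R v \<longleftrightarrow> word_eq R u v"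
  unfolding word_class_def by (auto intro: word_eq.intros)

lemma carrier_presented_group: "carrier (presented_group R) = range (word_class R)"
  by (simp add: presented_group_def)

lemma one_presented_group: "\<one>\<^bsub>presented_group R\<^esub> = word_class R []"
  by (simp add: presented_group_def)

lemma mult_presented_group:
  "word_class R u \<otimes>\<^bsub>presented_group R\<^esub> word_class R v = word_class R (u @ v)"
proof -
  have 1: "word_class R (x @ y) = word_class R (u @ v)"
    if "x \<in> word_class R u" "y \<in> word_class R v" for x y
    using that word_eq_append word_class_eq_iff
    by (metis mem_Collect_eq word_class_def)
  have 2: "u \<in> word_class R u" "v \<in> word_class R v"
    by (auto simp: word_class_def intro: word_eq.refl)
  have "(\<Union>x\<in>word_class R u. \<Union>y\<in>word_class R v. word_class R (x @ y)) =
        (\<Union>x\<in>word_class R u. \<Union>y\<in>word_class R v. word_class R (u @ v))"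
    by (intro SUP_cong 1) simp_all
  also have "\<dots> = word_class R (u @ v)"
    using 2 by (auto simp only: UN_constant split: if_splits)
  finally have "(\<Union>x\<in>word_class R u. \<Union>y\<in>word_class R v. word_class R (x @ y)) = word_class R (u @ v)" .
  then show ?thesis by (simp add: presented_group_def)
qed

definition inv_word :: "'g word \<Rightarrow> 'g word" where
  "inv_word w = rev (map (\<lambda>(x, b). (x, \<not> b)) w)"

lemma inv_word_cancel: "word_eq R (inv_word w @ w) []"
proof (induction w)
  case Nil show ?case by (simp add: inv_word_def word_eq.refl)
next
  case (Cons l w)
  obtain x b where l: "l = (x, b)" by force
  have "word_eq R (inv_word w @ [(x, \<not> b), (x, \<not> \<not> b)] @ w) (inv_word w @ w)"
    by (rule word_eq.cancel)
  with Cons show ?case by (auto simp: l inv_word_def intro: word_eq.trans)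
qed

theorem group_presented_group: "group (presented_group R)"
proof (rule groupI)
  fix X assume "X \<in> carrier (presented_group R)"
  then obtain w where "X = word_class R w" by (auto simp: carrier_presented_group)
  then show "\<exists>Y \<in> carrier (presented_group R). Y \<otimes>\<^bsub>presented_group R\<^esub> X = \<one>\<^bsub>presented_group R\<^esub>"
    using inv_word_cancel[of R w]
    by (intro bexI[of _ "word_class R (inv_word w)"])
       (auto simp: carrier_presented_group mult_presented_group one_presented_group word_class_eq_iff)
qed (auto simp: carrier_presented_group mult_presented_group one_presented_group)

lemma pres_gen_closed [simp]: "pres_gen R x \<in> carrier (presented_group R)"
  by (simp add: pres_gen_def carrier_presented_group)

lemma inv_pres_gen: "inv\<^bsub>presented_group R\<^esub> pres_gen R x = word_class R [(x, False)]"
proof (rule group.inv_equality[OF group_presented_group])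
  show "word_class R [(x, False)] \<otimes>\<^bsub>presented_group R\<^esub> pres_gen R x = \<one>\<^bsub>presented_group R\<^esub>"
    using word_eq.cancel[of R "[]" x False "[]"]
    by (simp add: pres_gen_def mult_presented_group one_presented_group word_class_eq_iff)
qed (simp add: pres_gen_closed, simp add: carrier_presented_group)

lemma eval_word_pres_gen: "eval_word (presented_group R) (pres_gen R) w = word_class R w"
proof (induction w)
  case (Cons l w)
  obtain x b where "l = (x, b)" by force
  with Cons show ?case
    by (cases b) (simp_all add: inv_pres_gen, simp_all add: pres_gen_def mult_presented_group)
qed (simp add: one_presented_group)

lemma pres_relation:
  assumes "(r, s) \<in> R"
  shows "eval_word (presented_group R) (pres_gen R) r = eval_word (presented_group R) (pres_gen R) s"
  using word_eq.relator[OF assms, of "[]" "[]"] by (simp add: eval_word_pres_gen word_class_eq_iff)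

context group
begin

lemma eval_word_closed: "range f \<subseteq> carrier G \<Longrightarrow> eval_word G f w \<in> carrier G"
proof (induction w)
  case (Cons l w) then show ?case by (cases l) auto
qed simp

lemma eval_word_append:
  "range f \<subseteq> carrier G \<Longrightarrow> eval_word G f (u @ v) = eval_word G f u \<otimes> eval_word G f v"
proof (induction u)
  case (Cons l w)
  then have "f x \<in> carrier G" for x by auto
  with Cons show ?case by (cases l) (auto simp: eval_word_closed m_assoc)
qed (simp add: eval_word_closed)

lemma eval_word_cong:
  assumes f: "range f \<subseteq> carrier G"
    and rel: "\<And>r s. (r, s) \<in> R \<Longrightarrow> eval_word G f r = eval_word G f s"
    and "word_eq R u v"
  shows "eval_word G f u = eval_word G f v"
  using assms(3)
proof induction
  case (cancel u x b v)
  have "f x \<in> carrier G" using f by auto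
  then have "eval_word G f [(x, b), (x, \<not> b)] = \<one>" by (cases b) simp_all
  then show ?case using eval_word_closed[OF f] by (simp only: eval_word_append[OF f] l_one)
next
  case (relator r s u v)
  then show ?case by (simp add: eval_word_append[OF f] rel)
qed auto

lemma pres_lift_class:
  assumes "range f \<subseteq> carrier G" "\<And>r s. (r, s) \<in> R \<Longrightarrow> eval_word G f r = eval_word G f s"
  shows "pres_lift R G f (word_class R w) = eval_word G f w"
proof -
  have "eval_word G f ` word_class R w = {eval_word G f w}"
    using eval_word_cong[OF assms, of R] by (force simp: word_class_def intro: word_eq.refl)
  then show ?thesis by (simp add: pres_lift_def carrier_presented_group)
qed

theorem pres_lift_hom:
  assumes "range f \<subseteq> carrier G" "\<And>r s. (r, s) \<in> R \<Longrightarrow> eval_word G f r = eval_word G f s"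
  shows "pres_lift R G f \<in> hom (presented_group R) G"
  using assms(1) pres_lift_class[OF assms, of R]
  by (auto simp: hom_def carrier_presented_group mult_presented_group eval_word_append eval_word_closed)

theorem pres_lift_gen:
  assumes "range f \<subseteq> carrier G" "\<And>r s. (r, s) \<in> R \<Longrightarrow> eval_word G f r = eval_word G f s"
  shows "pres_lift R G f (pres_gen R x) = f x"
proof -
  have "f x \<in> carrier G" using assms(1) by auto
  then show ?thesis by (simp add: pres_gen_def pres_lift_class[OF assms, of R])
qed

theorem pres_hom_unique:
  assumes h: "h \<in> hom (presented_group R) G" and k: "k \<in> hom (presented_group R) G"
    and gen: "\<And>x. h (pres_gen R x) = k (pres_gen R x)"
    and X: "X \<in> carrier (presented_group R)"
  shows "h X = k X"
proof -
  interpret P: group "presented_group R" by (rule group_presented_group)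
  interpret h: group_hom "presented_group R" G h by unfold_locales (rule h)
  interpret k: group_hom "presented_group R" G k by unfold_locales (rule k)
  have "h (eval_word (presented_group R) (pres_gen R) w)
      = k (eval_word (presented_group R) (pres_gen R) w)" for w
  proof (induction w)
    case (Cons l w)
    have "range (pres_gen R) \<subseteq> carrier (presented_group R)" by auto
    note c = P.eval_word_closed[OF this]
    obtain x b where "l = (x, b)" by force
    with Cons c show ?case by (cases b) (simp_all add: gen)
  qed simp
  then show ?thesis using X by (auto simp: carrier_presented_group eval_word_pres_gen)
qed

end

section \<open>Centre, inner and outer automorphisms\<close>

definition center :: "('a, 'b) monoid_scheme \<Rightarrow> 'a set" where
  "center G = {z \<in> carrier G. \<forall>g \<in> carrier G. z \<otimes>\<^bsub>G\<^esub> g = g \<otimes>\<^bsub>G\<^esub> z}"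

definition Inn :: "('a, 'b) monoid_scheme \<Rightarrow> ('a \<Rightarrow> 'a) set" where
  "Inn G = (\<lambda>g. \<lambda>x \<in> carrier G. g \<otimes>\<^bsub>G\<^esub> x \<otimes>\<^bsub>G\<^esub> inv\<^bsub>G\<^esub> g) ` carrier G"

definition Out :: "('a, 'b) monoid_scheme \<Rightarrow> ('a \<Rightarrow> 'a) set monoid" where
  "Out G = AutoGroup G Mod Inn G"

section \<open>Semidirect products\<close>

definition internal_semidirect :: "('a, 'b) monoid_scheme \<Rightarrow> 'a set \<Rightarrow> 'a set \<Rightarrow> bool" where
  "internal_semidirect G N H \<longleftrightarrow>
     N \<lhd> G \<and> subgroup H G \<and> N \<inter> H = {\<one>\<^bsub>G\<^esub>} \<and> N <#>\<^bsub>G\<^esub> H = carrier G"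

definition semidirect ::
  "('a, 'c) monoid_scheme \<Rightarrow> ('b, 'd) monoid_scheme \<Rightarrow> ('b \<Rightarrow> 'a \<Rightarrow> 'a) \<Rightarrow> ('a \<times> 'b) monoid" where
  "semidirect N H \<phi> =
     \<lparr>carrier = carrier N \<times> carrier H,
      mult = (\<lambda>(n, h) (n', h'). (n \<otimes>\<^bsub>N\<^esub> \<phi> h n', h \<otimes>\<^bsub>H\<^esub> h')),
      one = (\<one>\<^bsub>N\<^esub>, \<one>\<^bsub>H\<^esub>)\<rparr>"

lemma group_semidirect:
  assumes N: "group N" and H: "group H" and phi: "\<phi> \<in> hom H (AutoGroup N)"
  shows "group (semidirect N H \<phi>)"
proof -
  interpret N: group N by fact
  interpret H: group H by fact
  have A: "group (AutoGroup N)" by (rule N.AutoGroup)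
  have car: "carrier (AutoGroup N) = auto N" and
    oneA: "\<one>\<^bsub>AutoGroup N\<^esub> = (\<lambda>x \<in> carrier N. x)"
    by (simp_all add: AutoGroup_def BijGroup_def)
  have multA: "f \<otimes>\<^bsub>AutoGroup N\<^esub> g = compose (carrier N) f g" if "f \<in> auto N" "g \<in> auto N" for f g
    using that by (simp add: AutoGroup_def BijGroup_def auto_def)
  have in_auto: "\<phi> h \<in> auto N" if "h \<in> carrier H" for h
    using hom_in_carrier[OF phi that] by (simp add: car)
  then have homN: "\<phi> h \<in> hom N N" if "h \<in> carrier H" for h
    using that by (simp add: auto_def)
  note closed = hom_in_carrier[OF homN] and mult = hom_mult[OF homN]
  have comp: "\<phi> (h \<otimes>\<^bsub>H\<^esub> k) n = \<phi> h (\<phi> k n)"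
    if "h \<in> carrier H" "k \<in> carrier H" "n \<in> carrier N" for h k n
    using that by (simp add: hom_mult[OF phi] multA in_auto compose_eq)
  have one: "\<phi> \<one>\<^bsub>H\<^esub> n = n" if "n \<in> carrier N" for n
    using that by (simp add: hom_one[OF phi H A] oneA)
  show ?thesis
  proof (rule groupI)
    fix X assume "X \<in> carrier (semidirect N H \<phi>)"
    then obtain n h where X: "X = (n, h)" "n \<in> carrier N" "h \<in> carrier H"
      by (auto simp: semidirect_def)
    let ?k = "inv\<^bsub>H\<^esub> h"
    have "\<phi> ?k (inv\<^bsub>N\<^esub> n) \<otimes>\<^bsub>N\<^esub> \<phi> ?k n = \<phi> ?k (inv\<^bsub>N\<^esub> n \<otimes>\<^bsub>N\<^esub> n)"
      using X by (intro mult[symmetric]) simp_all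
    also have "\<dots> = \<one>\<^bsub>N\<^esub>"
      using X hom_one[OF homN N N, of ?k] by simp
    finally show "\<exists>Y \<in> carrier (semidirect N H \<phi>). Y \<otimes>\<^bsub>semidirect N H \<phi>\<^esub> X = \<one>\<^bsub>semidirect N H \<phi>\<^esub>"
      using X
      by (intro bexI[of _ "(\<phi> ?k (inv\<^bsub>N\<^esub> n), ?k)"]) (simp_all add: semidirect_def closed)
  next
    fix X Y Z
    assume "X \<in> carrier (semidirect N H \<phi>)" "Y \<in> carrier (semidirect N H \<phi>)"
      "Z \<in> carrier (semidirect N H \<phi>)"
    then show "X \<otimes>\<^bsub>semidirect N H \<phi>\<^esub> Y \<otimes>\<^bsub>semidirect N H \<phi>\<^esub> Z =
               X \<otimes>\<^bsub>semidirect N H \<phi>\<^esub> (Y \<otimes>\<^bsub>semidirect N H \<phi>\<^esub> Z)"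
      by (cases X; cases Y; cases Z)
         (simp add: semidirect_def closed mult comp N.m_assoc H.m_assoc)
  qed (auto simp: semidirect_def closed one)
qed

text \<open>The automorphism of \<open>G/N\<close> induced by \<open>f\<close>, for \<open>f\<close> an automorphism of \<open>G\<close> preserving \<open>N\<close>.\<close>

definition induced_auto :: "('a, 'b) monoid_scheme \<Rightarrow> 'a set \<Rightarrow> ('a \<Rightarrow> 'a) \<Rightarrow> 'a set \<Rightarrow> 'a set" where
  "induced_auto G N f = (\<lambda>X \<in> carrier (G Mod N). f ` X)"

abbreviation C2 :: "int monoid" where
  "C2 \<equiv> integer_mod_group 2"

definition Z_semi_C2 :: "(int \<times> int) monoid" where
  "Z_semi_C2 = semidirect integer_group C2 (\<lambda>a n. if a = 0 then n else - n)"

lemma group_Z_semi_C2: "group Z_semi_C2"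
  unfolding Z_semi_C2_def
proof (rule group_semidirect)
  have inj: "(\<lambda>n::int. if a = (0::int) then n else - n) \<in> auto integer_group" for a
    by (auto simp: auto_def hom_def Bij_def intro!: bij_betw_byWitness[where f' = "\<lambda>n. if a = 0 then n else - n"])
  have car: "carrier C2 = {0, 1}" by (auto simp: carrier_integer_mod_group)
  have mult: "f \<otimes>\<^bsub>AutoGroup integer_group\<^esub> g = f \<circ> g"
    if "f \<in> auto integer_group" "g \<in> auto integer_group" for f g
    using that by (simp add: AutoGroup_def BijGroup_def auto_def compose_def fun_eq_iff)
  show "(\<lambda>a n. if a = 0 then n else - n) \<in> hom C2 (AutoGroup integer_group)"
  proof (rule homI)
    fix a b assume "a \<in> carrier C2" "b \<in> carrier C2"
    then show "(\<lambda>n::int. if a \<otimes>\<^bsub>C2\<^esub> b = 0 then n else - n) =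
      (\<lambda>n. if a = 0 then n else - n) \<otimes>\<^bsub>AutoGroup integer_group\<^esub> (\<lambda>n. if b = 0 then n else - n)"
      unfolding mult[OF inj inj] by (auto simp: car fun_eq_iff)
  qed (use inj in \<open>simp add: AutoGroup_def\<close>)
qed auto

section \<open>The two-generator Artin group\<close>

datatype gen = Alpha | Beta

fun alt_word :: "'g \<Rightarrow> 'g \<Rightarrow> nat \<Rightarrow> 'g word" where
  "alt_word a b 0 = []"
| "alt_word a b (Suc m) = (a, True) # alt_word b a m"

definition artin_rel :: "nat \<Rightarrow> (gen word \<times> gen word) set" where
  "artin_rel m = {(alt_word Alpha Beta m, alt_word Beta Alpha m)}"

definition Artin :: "nat \<Rightarrow> gen word set monoid" where
  "Artin m = presented_group (artin_rel m)"

definition artin_alpha :: "nat \<Rightarrow> gen word set" where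
  "artin_alpha m = pres_gen (artin_rel m) Alpha"

definition artin_beta :: "nat \<Rightarrow> gen word set" where
  "artin_beta m = pres_gen (artin_rel m) Beta"

definition artin_endo :: "nat \<Rightarrow> gen word set \<Rightarrow> gen word set \<Rightarrow> gen word set \<Rightarrow> gen word set" where
  "artin_endo m x y = pres_lift (artin_rel m) (Artin m) (case_gen x y)"

definition artin_eps :: "nat \<Rightarrow> gen word set \<Rightarrow> gen word set" where
  "artin_eps m = artin_endo m (inv\<^bsub>Artin m\<^esub> artin_alpha m) (inv\<^bsub>Artin m\<^esub> artin_beta m)"

definition artin_tau :: "nat \<Rightarrow> gen word set \<Rightarrow> gen word set" where
  "artin_tau m = artin_endo m (artin_beta m) (artin_alpha m)"

definition artin_eta :: "nat \<Rightarrow> gen word set \<Rightarrow> gen word set" where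
  "artin_eta m = artin_endo m (inv\<^bsub>Artin m\<^esub> artin_beta m)
     (artin_beta m \<otimes>\<^bsub>Artin m\<^esub> artin_alpha m \<otimes>\<^bsub>Artin m\<^esub> artin_beta m)"

text \<open>
  The identifications of \<open>C\<^sub>2\<close> with \<open>\<langle>\<epsilon>\<rangle>\<close>, and of \<open>(\<int> \<rtimes> C\<^sub>2) \<times> C\<^sub>2\<close> with \<open>\<langle>\<epsilon>, \<tau>, \<eta>\<rangle>\<close>, where \<open>\<eta>\<close>
  generates \<open>\<int>\<close>, \<open>\<tau>\<close> generates the first and \<open>\<epsilon>\<close> the second \<open>C\<^sub>2\<close>.
\<close>

definition artin_odd_map :: "nat \<Rightarrow> int \<Rightarrow> gen word set \<Rightarrow> gen word set" where
  "artin_odd_map m c = artin_eps m [^]\<^bsub>AutoGroup (Artin m)\<^esub> c"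

definition artin_even_map :: "nat \<Rightarrow> (int \<times> int) \<times> int \<Rightarrow> gen word set \<Rightarrow> gen word set" where
  "artin_even_map m = (\<lambda>((n, a), c).
     artin_eta m [^]\<^bsub>AutoGroup (Artin m)\<^esub> n \<otimes>\<^bsub>AutoGroup (Artin m)\<^esub>
     artin_tau m [^]\<^bsub>AutoGroup (Artin m)\<^esub> a \<otimes>\<^bsub>AutoGroup (Artin m)\<^esub>
     artin_eps m [^]\<^bsub>AutoGroup (Artin m)\<^esub> c)"

lemma group_Artin: "group (Artin m)"
  by (simp add: Artin_def group_presented_group)

lemma artin_gen_closed [simp]:
  "artin_alpha m \<in> carrier (Artin m)" "artin_beta m \<in> carrier (Artin m)"
  by (simp_all add: artin_alpha_def artin_beta_def Artin_def)

lemma artin_pres_gen: "pres_gen (artin_rel m) = case_gen (artin_alpha m) (artin_beta m)"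
  by (auto simp: artin_alpha_def artin_beta_def fun_eq_iff split: gen.split)

lemma artin_relation:
  "eval_word (Artin m) (case_gen (artin_alpha m) (artin_beta m)) (alt_word Alpha Beta m) =
   eval_word (Artin m) (case_gen (artin_alpha m) (artin_beta m)) (alt_word Beta Alpha m)"
proof -
  have "(alt_word Alpha Beta m, alt_word Beta Alpha m) \<in> artin_rel m" by (simp add: artin_rel_def)
  from pres_relation[OF this] show ?thesis by (simp only: artin_pres_gen Artin_def)
qed

lemma artin_endo:
  assumes "x \<in> carrier (Artin m)" "y \<in> carrier (Artin m)"
    and "eval_word (Artin m) (case_gen x y) (alt_word Alpha Beta m) =
         eval_word (Artin m) (case_gen x y) (alt_word Beta Alpha m)"
  shows "artin_endo m x y \<in> hom (Artin m) (Artin m)"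
    and "artin_endo m x y (artin_alpha m) = x" "artin_endo m x y (artin_beta m) = y"
proof -
  interpret group "Artin m" by (rule group_Artin)
  have r: "range (case_gen x y) \<subseteq> carrier (Artin m)"
    using assms(1,2) by (auto split: gen.splits)
  have e: "eval_word (Artin m) (case_gen x y) r = eval_word (Artin m) (case_gen x y) s"
    if "(r, s) \<in> artin_rel m" for r s
    using that assms(3) by (simp add: artin_rel_def)
  show "artin_endo m x y \<in> hom (Artin m) (Artin m)"
    using pres_lift_hom[OF r e, of "artin_rel m"] by (simp add: artin_endo_def) (simp add: Artin_def)
  show "artin_endo m x y (artin_alpha m) = x" "artin_endo m x y (artin_beta m) = y"
    using pres_lift_gen[OF r e, of "artin_rel m"] by (simp_all add: artin_endo_def artin_alpha_def artin_beta_def)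
qed

lemma alt_word_snoc: "alt_word a b (Suc m) = alt_word a b m @ [(if even m then a else b, True)]"
  by (induction m arbitrary: a b) auto

lemma eval_alt_word_cong:
  "f a = g c \<Longrightarrow> f b = g d \<Longrightarrow> eval_word G f (alt_word a b m) = eval_word G g (alt_word c d m)"
  by (induction m arbitrary: a b c d) auto

context group
begin

lemma eval_alt_word_inv:
  assumes "range f \<subseteq> carrier G"
  shows "eval_word G (\<lambda>x. inv (f x)) (alt_word a b m) =
         inv (eval_word G f (if odd m then alt_word a b m else alt_word b a m))"
proof (induction m arbitrary: a b)
  case (Suc m)
  let ?u = "if odd m then alt_word b a m else alt_word a b m"
  have c: "f a \<in> carrier G" using assms by auto
  have w: "(if odd (Suc m) then alt_word a b (Suc m) else alt_word b a (Suc m)) = ?u @ [(a, True)]"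
    by (simp only: alt_word_snoc) simp
  have "eval_word G (\<lambda>x. inv (f x)) (alt_word a b (Suc m)) = inv (f a) \<otimes> inv (eval_word G f ?u)"
    by (simp only: alt_word.simps eval_word.simps Suc if_True)
  also have "\<dots> = inv (eval_word G f ?u \<otimes> f a)"
    by (rule inv_mult_group[symmetric, OF eval_word_closed[OF assms] c])
  also have "eval_word G f ?u \<otimes> f a = eval_word G f (?u @ [(a, True)])"
    using c by (simp only: eval_word_append[OF assms] eval_word.simps r_one if_True)
  finally show ?case unfolding w .
qed simp

lemma eval_alt_word_even:
  assumes "f a \<in> carrier G" "f b \<in> carrier G"
  shows "eval_word G f (alt_word a b (2 * k)) = (f a \<otimes> f b) [^] k"
proof (induction k)
  case (Suc k)
  have "eval_word G f (alt_word a b (2 * Suc k)) = f a \<otimes> (f b \<otimes> (f a \<otimes> f b) [^] k)"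
    by (simp add: Suc)
  also have "\<dots> = (f a \<otimes> f b) [^] Suc k"
    using assms nat_pow_Suc2[of "f a \<otimes> f b" k] by (simp add: m_assoc)
  finally show ?case .
qed simp

end

lemma artin_eps:
  shows "artin_eps m \<in> hom (Artin m) (Artin m)"
    and "artin_eps m (artin_alpha m) = inv\<^bsub>Artin m\<^esub> artin_alpha m"
    and "artin_eps m (artin_beta m) = inv\<^bsub>Artin m\<^esub> artin_beta m"
proof -
  interpret group "Artin m" by (rule group_Artin)
  let ?f = "case_gen (artin_alpha m) (artin_beta m)"
  have r: "range ?f \<subseteq> carrier (Artin m)" by (auto split: gen.splits)
  have "case_gen (inv\<^bsub>Artin m\<^esub> artin_alpha m) (inv\<^bsub>Artin m\<^esub> artin_beta m) = (\<lambda>x. inv\<^bsub>Artin m\<^esub> ?f x)"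
    by (auto simp: fun_eq_iff split: gen.split)
  then have e: "eval_word (Artin m) (case_gen (inv\<^bsub>Artin m\<^esub> artin_alpha m) (inv\<^bsub>Artin m\<^esub> artin_beta m)) (alt_word Alpha Beta m) =
     eval_word (Artin m) (case_gen (inv\<^bsub>Artin m\<^esub> artin_alpha m) (inv\<^bsub>Artin m\<^esub> artin_beta m)) (alt_word Beta Alpha m)"
    using artin_relation[of m] by (simp add: eval_alt_word_inv[OF r])
  show "artin_eps m \<in> hom (Artin m) (Artin m)"
    and "artin_eps m (artin_alpha m) = inv\<^bsub>Artin m\<^esub> artin_alpha m"
    and "artin_eps m (artin_beta m) = inv\<^bsub>Artin m\<^esub> artin_beta m"
    unfolding artin_eps_def using artin_endo[OF _ _ e] by auto
qed

lemma artin_tau: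
  shows "artin_tau m \<in> hom (Artin m) (Artin m)"
    and "artin_tau m (artin_alpha m) = artin_beta m"
    and "artin_tau m (artin_beta m) = artin_alpha m"
proof -
  let ?f = "case_gen (artin_alpha m) (artin_beta m)" and ?g = "case_gen (artin_beta m) (artin_alpha m)"
  have "eval_word (Artin m) ?g (alt_word Alpha Beta m) = eval_word (Artin m) ?f (alt_word Beta Alpha m)"
    "eval_word (Artin m) ?g (alt_word Beta Alpha m) = eval_word (Artin m) ?f (alt_word Alpha Beta m)"
    by (rule eval_alt_word_cong; simp)+
  then have e: "eval_word (Artin m) ?g (alt_word Alpha Beta m) = eval_word (Artin m) ?g (alt_word Beta Alpha m)"
    using artin_relation[of m] by simp
  show "artin_tau m \<in> hom (Artin m) (Artin m)"
    and "artin_tau m (artin_alpha m) = artin_beta m"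
    and "artin_tau m (artin_beta m) = artin_alpha m"
    unfolding artin_tau_def using artin_endo[OF _ _ e] by auto
qed

lemma artin_eta:
  assumes "even m"
  shows "artin_eta m \<in> hom (Artin m) (Artin m)"
    and "artin_eta m (artin_alpha m) = inv\<^bsub>Artin m\<^esub> artin_beta m"
    and "artin_eta m (artin_beta m) =
         artin_beta m \<otimes>\<^bsub>Artin m\<^esub> artin_alpha m \<otimes>\<^bsub>Artin m\<^esub> artin_beta m"
proof -
  interpret group "Artin m" by (rule group_Artin)
  obtain k where k: "m = 2 * k" using assms by blast
  define a b where ab: "a = artin_alpha m" "b = artin_beta m"
  have c: "a \<in> carrier (Artin m)" "b \<in> carrier (Artin m)" by (simp_all add: ab)
  define x y where xy: "x = inv\<^bsub>Artin m\<^esub> b" "y = b \<otimes>\<^bsub>Artin m\<^esub> a \<otimes>\<^bsub>Artin m\<^esub> b"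
  have c': "x \<in> carrier (Artin m)" "y \<in> carrier (Artin m)" using c by (simp_all add: xy)
  have p: "x \<otimes>\<^bsub>Artin m\<^esub> y = a \<otimes>\<^bsub>Artin m\<^esub> b" "y \<otimes>\<^bsub>Artin m\<^esub> x = b \<otimes>\<^bsub>Artin m\<^esub> a"
    using c by (simp_all add: xy m_assoc) (simp add: m_assoc[symmetric])
  have ev: "eval_word (Artin m) (case_gen u v) (alt_word Alpha Beta m) = (u \<otimes>\<^bsub>Artin m\<^esub> v) [^]\<^bsub>Artin m\<^esub> k"
    "eval_word (Artin m) (case_gen u v) (alt_word Beta Alpha m) = (v \<otimes>\<^bsub>Artin m\<^esub> u) [^]\<^bsub>Artin m\<^esub> k"
    if "u \<in> carrier (Artin m)" "v \<in> carrier (Artin m)" for u v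
    using that eval_alt_word_even[of "case_gen u v" Alpha Beta k]
      eval_alt_word_even[of "case_gen u v" Beta Alpha k]
    by (simp_all flip: k)
  have e: "eval_word (Artin m) (case_gen x y) (alt_word Alpha Beta m) =
           eval_word (Artin m) (case_gen x y) (alt_word Beta Alpha m)"
    using artin_relation[of m] by (simp add: ev c c' p flip: ab)
  show "artin_eta m \<in> hom (Artin m) (Artin m)"
    and "artin_eta m (artin_alpha m) = inv\<^bsub>Artin m\<^esub> artin_beta m"
    and "artin_eta m (artin_beta m) =
         artin_beta m \<otimes>\<^bsub>Artin m\<^esub> artin_alpha m \<otimes>\<^bsub>Artin m\<^esub> artin_beta m"
    unfolding artin_eta_def using artin_endo[OF c' e] by (simp_all add: xy ab)
qed

end

theory Submission
  imports Defs "HOL-Algebra.Zassenhaus"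
begin

text \<open>
  Put \<open>c = \<alpha>\<beta>\<close>. For \<open>m = 2k\<close> the group \<open>A\<close> is generated by \<open>\<alpha>\<close> and \<open>c\<close> subject only to
  \<open>[\<alpha>, c\<^sup>k] = 1\<close>; for odd \<open>m\<close> it is generated by \<open>\<Delta> = w(\<alpha>,\<beta>:m)\<close> and \<open>c\<close> subject only to
  \<open>\<Delta>\<^sup>2 = c\<^sup>m\<close>. Hence with \<open>n = k\<close>, respectively \<open>n = m\<close>, the power \<open>c\<^sup>n\<close> is central and \<open>A/\<langle>c\<^sup>n\<rangle>\<close> is the
  free product of a cyclic group of order \<open>n\<close> and an infinite cyclic group (\<open>m\<close> even) or a group of
  order 2 (\<open>m\<close> odd). Normal forms in this free product show that \<open>c\<^sup>n\<close> generates the centre and that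
  elements of finite order modulo the centre are conjugate to a power of \<open>c\<close> or to \<open>\<Delta>c\<^sup>n\<^sup>j\<close>.
  So an automorphism can be composed with an inner one such that \<open>c\<close> is mapped to a power of \<open>c\<close>,
  which must be \<open>c\<close> or the inverse of \<open>c\<close> since the centre is mapped onto itself; \<open>\<epsilon>\<close> removes the second
  possibility. If \<open>c\<close> is fixed, the second generator is mapped to some \<open>c\<^sup>axc\<^sup>b\<close>, where the normal
  form of \<open>x\<close> begins and ends with a letter. By surjectivity \<open>c\<close> and \<open>x\<close> generate \<open>A\<close>, and comparing
  lengths the second generator is then a power of \<open>x\<close> modulo the centre; this leaves only the
  automorphisms listed.
  That \<open>\<langle>\<epsilon>\<rangle>\<close> and \<open>\<langle>\<epsilon>,\<tau>,\<eta>\<rangle>\<close> meet the inner automorphisms trivially is visible on the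
  abelianization of \<open>A\<close>.
\<close>

section \<open>Inner automorphisms and splittings\<close>

text \<open>The free product is never constructed. Following van der Waerden, the group acts by
  permutations on the set of would-be normal forms, and \<open>N g\<close> is the image of the empty
  form under \<open>g\<close>; cancellation arguments become computations with lists. One locale
  serves both parities: for even \<open>m\<close> the letters are \<alpha> and its inverse with
  \<open>bar = Not\<close>, for odd \<open>m\<close> the only letter is \<Delta> with
  \<open>bar\<close> the identity. An infinite cyclic factor is thus spelled letter by letter, and
  \<open>bar e = e\<close> marks a letter of order 2 modulo the centre. The parities differ in why
  \<open>c\<close> cannot go to a conjugate of a letter of order 2. For odd \<open>m\<close> the
  order \<open>m\<close> of \<open>c\<close> modulo the centre is at least 3; for even
  \<open>m\<close>, where this order is 2 if \<open>m = 4\<close>, no letter is its own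
  \<open>bar\<close>. They differ again once \<open>c\<close> is fixed. For even \<open>m\<close>
  some homomorphism to the integers kills \<open>c\<close> and sends \<alpha> to 1, so \<alpha> can
  only be \<open>x\<close> or its inverse modulo the centre. For odd \<open>m\<close> no such map
  exists, and the equation \<Delta>^2 = c^m takes its place.\<close>

lemma carrier_AutoGroup [simp]: "carrier (AutoGroup G) = auto G"
  by (simp add: AutoGroup_def)

lemma one_AutoGroup: "\<one>\<^bsub>AutoGroup G\<^esub> = (\<lambda>x \<in> carrier G. x)"
  by (simp add: AutoGroup_def BijGroup_def)

lemma mult_AutoGroup:
  "f \<in> auto G \<Longrightarrow> g \<in> auto G \<Longrightarrow> f \<otimes>\<^bsub>AutoGroup G\<^esub> g = compose (carrier G) f g"
  by (simp add: AutoGroup_def BijGroup_def auto_def)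

lemma mult_AutoGroup_apply:
  "f \<in> auto G \<Longrightarrow> g \<in> auto G \<Longrightarrow> x \<in> carrier G \<Longrightarrow> (f \<otimes>\<^bsub>AutoGroup G\<^esub> g) x = f (g x)"
  by (simp add: mult_AutoGroup compose_eq)

lemma auto_hom: "f \<in> auto G \<Longrightarrow> f \<in> hom G G"
  by (simp add: auto_def)

lemma auto_closed: "f \<in> auto G \<Longrightarrow> x \<in> carrier G \<Longrightarrow> f x \<in> carrier G"
  by (auto simp: auto_def hom_def)

lemma auto_mult:
  "f \<in> auto G \<Longrightarrow> x \<in> carrier G \<Longrightarrow> y \<in> carrier G \<Longrightarrow> f (x \<otimes>\<^bsub>G\<^esub> y) = f x \<otimes>\<^bsub>G\<^esub> f y"
  by (auto simp: auto_def hom_def)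

lemma auto_image: "f \<in> auto G \<Longrightarrow> f ` carrier G = carrier G"
  by (simp add: auto_def Bij_def bij_betw_def)

lemma auto_inj: "f \<in> auto G \<Longrightarrow> inj_on f (carrier G)"
  by (simp add: auto_def Bij_def bij_betw_def)

lemma auto_extensional: "f \<in> auto G \<Longrightarrow> f \<in> extensional (carrier G)"
  by (simp add: auto_def Bij_def)

lemma auto_eqI:
  assumes "f \<in> auto G" "g \<in> auto G" "\<And>x. x \<in> carrier G \<Longrightarrow> f x = g x"
  shows "f = g"
  using assms by (intro extensionalityI[of f "carrier G" g]) (auto simp: auto_extensional)

lemma image_prod_set_mult:
  "(\<lambda>(x, y). f x \<otimes>\<^bsub>G\<^esub> g y) ` (A \<times> B) = f ` A <#>\<^bsub>G\<^esub> g ` B"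
  by (auto simp: set_mult_def)

definition conj_auto :: "('a, 'b) monoid_scheme \<Rightarrow> 'a \<Rightarrow> 'a \<Rightarrow> 'a" where
  "conj_auto G g = (\<lambda>x \<in> carrier G. g \<otimes>\<^bsub>G\<^esub> x \<otimes>\<^bsub>G\<^esub> inv\<^bsub>G\<^esub> g)"

lemma Inn_eq: "Inn G = conj_auto G ` carrier G"
  by (simp add: Inn_def conj_auto_def)

context group
begin

lemma inv_mult_cancel [simp]:
  assumes "x \<in> carrier G" "y \<in> carrier G"
  shows "inv x \<otimes> (x \<otimes> y) = y" "x \<otimes> (inv x \<otimes> y) = y"
  using assms by (simp_all add: m_assoc[symmetric])

lemma auto_group_hom: "f \<in> auto G \<Longrightarrow> group_hom G G f"
  by unfold_locales (simp add: auto_hom)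

text \<open>Only \<open>f\<close> is asked to be extensional, so that a plain composition of
  homomorphisms can serve as its inverse, as it does for \<eta>.\<close>

lemma autoI:
  assumes f: "f \<in> hom G G" "f \<in> extensional (carrier G)" and g: "g \<in> hom G G"
    and inv: "\<And>x. x \<in> carrier G \<Longrightarrow> g (f x) = x" "\<And>x. x \<in> carrier G \<Longrightarrow> f (g x) = x"
  shows "f \<in> auto G"
proof -
  have "bij_betw f (carrier G) (carrier G)"
    using f g inv by (intro bij_betw_byWitness[where f' = g]) (auto simp: hom_def)
  with f show ?thesis by (simp add: auto_def Bij_def)
qed

lemma conj_auto_apply: "x \<in> carrier G \<Longrightarrow> conj_auto G g x = g \<otimes> x \<otimes> inv g"
  by (simp add: conj_auto_def)

lemma conj_auto_auto:
  assumes g: "g \<in> carrier G"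
  shows "conj_auto G g \<in> auto G"
proof (rule autoI[where g = "conj_auto G (inv g)"])
  have *: "conj_auto G h \<in> hom G G" if "h \<in> carrier G" for h
  proof (rule homI)
    fix x y assume "x \<in> carrier G" "y \<in> carrier G"
    with that show "conj_auto G h (x \<otimes> y) = conj_auto G h x \<otimes> conj_auto G h y"
      by (simp add: conj_auto_def m_assoc inv_solve_left)
  qed (use that in \<open>simp add: conj_auto_def\<close>)
  show "conj_auto G g \<in> hom G G" "conj_auto G (inv g) \<in> hom G G" using g by (auto intro: *)
  show "conj_auto G g \<in> extensional (carrier G)" by (simp add: conj_auto_def)
qed (use g in \<open>simp_all add: conj_auto_def m_assoc\<close>)

lemma conj_auto_hom: "conj_auto G \<in> hom G (AutoGroup G)"
proof (rule homI)
  fix x y assume xy: "x \<in> carrier G" "y \<in> carrier G"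
  interpret AG: group "AutoGroup G" by (rule AutoGroup)
  show "conj_auto G (x \<otimes> y) = conj_auto G x \<otimes>\<^bsub>AutoGroup G\<^esub> conj_auto G y"
  proof (rule auto_eqI[where G = G])
    show "conj_auto G x \<otimes>\<^bsub>AutoGroup G\<^esub> conj_auto G y \<in> auto G"
      using AG.m_closed[of "conj_auto G x" "conj_auto G y"] xy by (simp add: conj_auto_auto)
  qed (use xy in \<open>simp_all add: conj_auto_auto mult_AutoGroup_apply conj_auto_apply m_assoc inv_mult_group\<close>)
qed (simp add: conj_auto_auto)

text \<open>With \<open>conj_auto_hom\<close>, this identifies the central quotient with
  \<open>Inn G\<close> by the first isomorphism theorem.\<close>

lemma kernel_conj_auto: "kernel G (AutoGroup G) (conj_auto G) = center G"
proof -
  have "conj_auto G g = \<one>\<^bsub>AutoGroup G\<^esub> \<longleftrightarrow> (\<forall>x\<in>carrier G. g \<otimes> x = x \<otimes> g)"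
    if g: "g \<in> carrier G" for g
  proof -
    have "conj_auto G g = \<one>\<^bsub>AutoGroup G\<^esub> \<longleftrightarrow> (\<forall>x\<in>carrier G. g \<otimes> x \<otimes> inv g = x)"
      by (auto simp: one_AutoGroup conj_auto_def fun_eq_iff restrict_def)
    also have "\<dots> \<longleftrightarrow> (\<forall>x\<in>carrier G. g \<otimes> x = x \<otimes> g)"
      using g by (auto simp: inv_solve_right')
    finally show ?thesis .
  qed
  then show ?thesis by (auto simp: kernel_def center_def)
qed

lemma conj_auto_group_hom: "group_hom G (AutoGroup G) (conj_auto G)"
  using conj_auto_hom AutoGroup by (simp add: group_hom_def group_hom_axioms_def)

lemma center_normal: "center G \<lhd> G"
  using group_hom.normal_kernel[OF conj_auto_group_hom] by (simp add: kernel_conj_auto)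

text \<open>This relation gives the normality of \<open>Inn G\<close> and later the multiplication
  rule of the semidirect product.\<close>

lemma auto_conj_auto:
  assumes f: "f \<in> auto G" and g: "g \<in> carrier G"
  shows "f \<otimes>\<^bsub>AutoGroup G\<^esub> conj_auto G g = conj_auto G (f g) \<otimes>\<^bsub>AutoGroup G\<^esub> f"
proof -
  interpret AG: group "AutoGroup G" by (rule AutoGroup)
  interpret f: group_hom G G f by (rule auto_group_hom[OF f])
  note c = conj_auto_auto[OF g] conj_auto_auto[of "f g"]
  have fg: "f g \<in> carrier G" using g by simp
  show ?thesis
  proof (rule auto_eqI[where G = G])
    show "f \<otimes>\<^bsub>AutoGroup G\<^esub> conj_auto G g \<in> auto G"
      using AG.m_closed[of f "conj_auto G g"] f c by simp
    show "conj_auto G (f g) \<otimes>\<^bsub>AutoGroup G\<^esub> f \<in> auto G"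
      using AG.m_closed[of "conj_auto G (f g)" f] f c fg by simp
  qed (use f c g fg in \<open>simp_all add: mult_AutoGroup_apply conj_auto_apply\<close>)
qed

lemma Inn_normal: "Inn G \<lhd> AutoGroup G"
proof -
  interpret AG: group "AutoGroup G" by (rule AutoGroup)
  interpret c: group_hom G "AutoGroup G" "conj_auto G" by (rule conj_auto_group_hom)
  show ?thesis
  proof (rule AG.normal_invI)
    show "subgroup (Inn G) (AutoGroup G)"
      using c.img_is_subgroup by (simp add: Inn_eq)
    fix f k assume f: "f \<in> carrier (AutoGroup G)" and k: "k \<in> Inn G"
    then obtain g where g: "g \<in> carrier G" "k = conj_auto G g" by (auto simp: Inn_eq)
    have fg: "f g \<in> carrier G" using f g by (simp add: auto_closed)
    have "f \<otimes>\<^bsub>AutoGroup G\<^esub> k \<otimes>\<^bsub>AutoGroup G\<^esub> inv\<^bsub>AutoGroup G\<^esub> f = conj_auto G (f g)"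
    proof (rule AG.inv_solve_right'[THEN iffD2])
      show "f \<otimes>\<^bsub>AutoGroup G\<^esub> k = conj_auto G (f g) \<otimes>\<^bsub>AutoGroup G\<^esub> f"
        using f g by (simp add: auto_conj_auto)
    qed (use f k fg c.img_is_subgroup in \<open>simp_all add: conj_auto_auto g AG.m_closed[simplified]\<close>)
    with fg show "f \<otimes>\<^bsub>AutoGroup G\<^esub> k \<otimes>\<^bsub>AutoGroup G\<^esub> inv\<^bsub>AutoGroup G\<^esub> f \<in> Inn G"
      by (simp add: Inn_eq)
  qed
qed

text \<open>As \<open>f\<close> is onto, \<open>f z\<close> need only be tested against images
  \<open>f x\<close>, and injectivity pulls the commutation back to \<open>z\<close>.\<close>

lemma auto_center_image:
  assumes f: "f \<in> auto G"
  shows "f ` center G = center G"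
proof -
  interpret f: group_hom G G f by (rule auto_group_hom[OF f])
  have "f z \<in> center G \<longleftrightarrow> z \<in> center G" if z: "z \<in> carrier G" for z
  proof -
    have "f z \<in> center G \<longleftrightarrow> (\<forall>x\<in>f ` carrier G. f z \<otimes> x = x \<otimes> f z)"
      using z by (simp add: center_def auto_image[OF f])
    also have "\<dots> \<longleftrightarrow> (\<forall>x\<in>carrier G. f (z \<otimes> x) = f (x \<otimes> z))"
      using z by simp
    also have "\<dots> \<longleftrightarrow> z \<in> center G"
      using z by (simp add: center_def inj_on_eq_iff[OF auto_inj[OF f]] del: f.hom_mult)
    finally show ?thesis .
  qed
  then have "f ` {z \<in> carrier G. z \<in> center G} = {w \<in> f ` carrier G. w \<in> center G}" by blast
  moreover have "{z \<in> carrier G. z \<in> center G} = center G" by (auto simp: center_def)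
  ultimately show ?thesis by (simp add: auto_image[OF f])
qed

lemma auto_center_coset:
  assumes f: "f \<in> auto G" and g: "g \<in> carrier G"
  shows "f ` (center G #> g) = center G #> f g"
proof -
  interpret f: group_hom G G f by (rule auto_group_hom[OF f])
  have "f ` (center G #> g) = (\<lambda>z. f (z \<otimes> g)) ` center G"
    by (auto simp: r_coset_def)
  also have "\<dots> = (\<lambda>z. f z \<otimes> f g) ` center G"
  proof (rule image_cong[OF HOL.refl])
    fix z assume "z \<in> center G"
    then have "z \<in> carrier G" by (simp add: center_def)
    then show "f (z \<otimes> g) = f z \<otimes> f g" using g by (rule f.hom_mult)
  qed
  also have "\<dots> = center G #> f g"
    by (subst (2) auto_center_image[OF f, symmetric]) (auto simp: r_coset_def)
  finally show ?thesis .
qed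

lemma induced_auto_coset:
  assumes "f \<in> auto G" "g \<in> carrier G"
  shows "induced_auto G (center G) f (center G #> g) = center G #> f g"
  using assms by (auto simp: induced_auto_def carrier_FactGroup auto_center_coset)

lemma induced_auto_auto:
  assumes f: "f \<in> auto G"
  shows "induced_auto G (center G) f \<in> auto (G Mod center G)"
proof -
  interpret AG: group "AutoGroup G" by (rule AutoGroup)
  interpret Z: normal "center G" G by (rule center_normal)
  interpret Q: group "G Mod center G" by (rule Z.factorgroup_is_group)
  have hom: "induced_auto G (center G) h \<in> hom (G Mod center G) (G Mod center G)"
    if h: "h \<in> auto G" for h
    by (rule homI)
       (auto simp: carrier_FactGroup induced_auto_coset h auto_closed Z.rcos_sum auto_mult)
  define k where "k = inv\<^bsub>AutoGroup G\<^esub> f"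
  have k: "k \<in> auto G" using AG.inv_closed[of f] f by (simp add: k_def)
  have kf: "k (f x) = x" "f (k x) = x" if x: "x \<in> carrier G" for x
  proof -
    have "k \<otimes>\<^bsub>AutoGroup G\<^esub> f = \<one>\<^bsub>AutoGroup G\<^esub>" "f \<otimes>\<^bsub>AutoGroup G\<^esub> k = \<one>\<^bsub>AutoGroup G\<^esub>"
      using f by (simp_all add: k_def)
    from this[THEN fun_cong, of x] show "k (f x) = x" "f (k x) = x"
      using x f k by (simp_all add: mult_AutoGroup_apply one_AutoGroup)
  qed
  show ?thesis
  proof (rule Q.autoI[OF hom[OF f] _ hom[OF k]])
    show "induced_auto G (center G) f \<in> extensional (carrier (G Mod center G))"
      by (simp add: induced_auto_def)
  qed (auto simp: carrier_FactGroup induced_auto_coset f k auto_closed kf)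
qed

lemma induced_auto_hom:
  "induced_auto G (center G) \<in> hom (AutoGroup G) (AutoGroup (G Mod center G))"
proof (rule homI)
  interpret AG: group "AutoGroup G" by (rule AutoGroup)
  interpret Z: normal "center G" G by (rule center_normal)
  interpret Q: group "G Mod center G" by (rule Z.factorgroup_is_group)
  interpret AQ: group "AutoGroup (G Mod center G)" by (rule Q.AutoGroup)
  fix f g assume fg: "f \<in> carrier (AutoGroup G)" "g \<in> carrier (AutoGroup G)"
  note m = AG.m_closed[OF fg]
  let ?i = "induced_auto G (center G)"
  show "?i (f \<otimes>\<^bsub>AutoGroup G\<^esub> g) = ?i f \<otimes>\<^bsub>AutoGroup (G Mod center G)\<^esub> ?i g"
  proof (rule auto_eqI)
    show "?i f \<otimes>\<^bsub>AutoGroup (G Mod center G)\<^esub> ?i g \<in> auto (G Mod center G)"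
      using AQ.m_closed[of "?i f" "?i g"] fg by (simp add: induced_auto_auto)
  next
    fix X assume "X \<in> carrier (G Mod center G)"
    then obtain x where x: "x \<in> carrier G" "X = center G #> x" by (auto simp: carrier_FactGroup)
    then show "?i (f \<otimes>\<^bsub>AutoGroup G\<^esub> g) X = (?i f \<otimes>\<^bsub>AutoGroup (G Mod center G)\<^esub> ?i g) X"
      using fg m by (simp add: mult_AutoGroup_apply carrier_FactGroup induced_auto_auto
          induced_auto_coset auto_closed)
  qed (use m in \<open>simp add: induced_auto_auto\<close>)
qed (simp add: induced_auto_auto)

end

text \<open>Once the automorphisms are determined, all structural claims follow from here: the image
  of \<open>f\<close> is a complement of \<open>Inn G\<close>. The hypothesis \<open>triv\<close>
  also gives injectivity of \<open>f\<close>, since the identity is inner.\<close>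

lemma (in group) aut_splitting:
  assumes H: "group H" and f: "f \<in> hom H (AutoGroup G)"
    and triv: "\<And>h. h \<in> carrier H \<Longrightarrow> f h \<in> Inn G \<Longrightarrow> h = \<one>\<^bsub>H\<^esub>"
    and S: "S \<subseteq> auto G" and gen: "generate (AutoGroup G) S = f ` carrier H"
    and all: "auto G \<subseteq> generate (AutoGroup G) (Inn G \<union> S)"
  shows "generate (AutoGroup G) (Inn G \<union> S) = carrier (AutoGroup G)"
    and "internal_semidirect (AutoGroup G) (Inn G) (generate (AutoGroup G) S)"
    and "f \<in> iso H (subgroup_generated (AutoGroup G) S)"
    and "(\<lambda>h. induced_auto G (center G) (f h)) \<in> hom H (AutoGroup (G Mod center G))"
    and "AutoGroup G \<cong> semidirect (G Mod center G) H (\<lambda>h. induced_auto G (center G) (f h))"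
    and "Out G \<cong> H"
proof -
  note carrier_AutoGroup [simp del]
  interpret AG: group "AutoGroup G" by (rule AutoGroup)
  interpret Z: normal "center G" G by (rule center_normal)
  interpret Q: group "G Mod center G" by (rule Z.factorgroup_is_group)
  interpret I: normal "Inn G" "AutoGroup G" by (rule Inn_normal)
  interpret H: group H by (rule H)
  interpret f: group_hom H "AutoGroup G" f by unfold_locales (rule f)
  interpret c: group_hom G "AutoGroup G" "conj_auto G" by (rule conj_auto_group_hom)
  have inj: "inj_on f (carrier H)"
    unfolding f.inj_on_one_iff using triv I.one_closed by metis
  have sub: "Inn G \<union> S \<subseteq> carrier (AutoGroup G)" using S I.subset by (auto simp: carrier_AutoGroup)
  show 1: "generate (AutoGroup G) (Inn G \<union> S) = carrier (AutoGroup G)"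
    using all AG.generate_incl[OF sub] by (auto simp: carrier_AutoGroup)
  have sg: "subgroup (f ` carrier H) (AutoGroup G)" by (rule f.img_is_subgroup)
  have "Inn G \<union> S \<subseteq> Inn G <#>\<^bsub>AutoGroup G\<^esub> f ` carrier H"
  proof -
    have "S \<subseteq> f ` carrier H" using generate.incl[of _ S "AutoGroup G"] gen by auto
    have mem: "a \<otimes>\<^bsub>AutoGroup G\<^esub> b \<in> Inn G <#>\<^bsub>AutoGroup G\<^esub> f ` carrier H"
      if "a \<in> Inn G" "b \<in> f ` carrier H" for a b
      using that unfolding set_mult_def by blast
    have "x \<in> Inn G <#>\<^bsub>AutoGroup G\<^esub> f ` carrier H" if "x \<in> S" for x
    proof -
      have "x \<in> f ` carrier H" "x \<in> carrier (AutoGroup G)" using that sub \<open>S \<subseteq> f ` carrier H\<close> by auto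
      then show ?thesis using mem[OF I.one_closed, of x] AG.l_one[of x] by simp
    qed
    moreover have "x \<in> Inn G <#>\<^bsub>AutoGroup G\<^esub> f ` carrier H" if "x \<in> Inn G" for x
    proof -
      have "\<one>\<^bsub>AutoGroup G\<^esub> \<in> f ` carrier H" by (rule subgroup.one_closed[OF sg])
      from mem[OF that this] show ?thesis using I.mem_carrier[OF that] AG.r_one[of x] by simp
    qed
    ultimately show ?thesis by auto
  qed
  \<comment> \<open>Because \<open>Inn G\<close> is normal, its product with the image of
    \<open>H\<close> is already a subgroup.\<close>
  then have "generate (AutoGroup G) (Inn G \<union> S) \<subseteq> Inn G <#>\<^bsub>AutoGroup G\<^esub> f ` carrier H"
    by (rule AG.generate_subgroup_incl) (rule AG.mult_norm_subgroup[OF Inn_normal sg])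
  then have prod: "Inn G <#>\<^bsub>AutoGroup G\<^esub> f ` carrier H = carrier (AutoGroup G)"
    using 1 I.subset subgroup.subset[OF sg] AG.set_mult_closed by blast
  have int: "Inn G \<inter> f ` carrier H = {\<one>\<^bsub>AutoGroup G\<^esub>}"
  proof -
    have "y = \<one>\<^bsub>AutoGroup G\<^esub>" if "y \<in> Inn G" "y \<in> f ` carrier H" for y
      using that(2)
    proof (rule imageE)
      fix h assume h: "y = f h" "h \<in> carrier H"
      have "h = \<one>\<^bsub>H\<^esub>" using triv[OF h(2)] that(1) h(1) by simp
      with h show ?thesis by simp
    qed
    then show ?thesis using I.one_closed subgroup.one_closed[OF sg] by (intro equalityI subsetI) auto
  qed
  show "internal_semidirect (AutoGroup G) (Inn G) (generate (AutoGroup G) S)"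
    unfolding internal_semidirect_def gen using Inn_normal sg prod int by blast
  show "f \<in> iso H (subgroup_generated (AutoGroup G) S)"
  proof -
    have "carrier (subgroup_generated (AutoGroup G) S) = f ` carrier H"
      using S gen by (simp add: carrier_subgroup_generated Int_absorb1 carrier_AutoGroup)
    then show ?thesis using inj f by (simp add: iso_def hom_def bij_betw_def Pi_iff)
  qed
  define \<phi> where "\<phi> = (\<lambda>h. induced_auto G (center G) (f h))"
  have phi: "\<phi> \<in> hom H (AutoGroup (G Mod center G))"
    using Group.hom_compose[OF f induced_auto_hom] by (simp add: \<phi>_def comp_def)
  then show "(\<lambda>h. induced_auto G (center G) (f h)) \<in> hom H (AutoGroup (G Mod center G))"
    by (simp add: \<phi>_def)
  \<comment> \<open>\<open>K\<close> is the isomorphism from the central quotient onto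
    \<open>Inn G\<close> induced by conjugation.\<close>
  define K where "K X = the_elem (conj_auto G ` X)" for X
  have K: "K \<in> hom (G Mod center G) (AutoGroup G)" "inj_on K (carrier (G Mod center G))"
    using c.FactGroup_hom c.FactGroup_inj_on by (simp_all add: K_def[abs_def] kernel_conj_auto)
  have K_coset: "K (center G #> g) = conj_auto G g" if g: "g \<in> carrier G" for g
  proof -
    have "conj_auto G ` (center G #> g) = {conj_auto G g}"
    proof -
      have "conj_auto G (z \<otimes> g) = conj_auto G g" if z: "z \<in> center G" for z
      proof -
        have "z \<in> kernel G (AutoGroup G) (conj_auto G)" using z by (simp add: kernel_conj_auto)
        then show ?thesis using g conj_auto_auto[of g] by (simp add: kernel_def)
      qed
      then have "conj_auto G ` (center G #> g) = (\<lambda>_. conj_auto G g) ` center G"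
        unfolding r_coset_def UNION_singleton_eq_range image_image by (intro image_cong) simp_all
      then show ?thesis using Z.one_closed by (simp add: image_constant)
    qed
    then show ?thesis by (simp add: K_def)
  qed
  have K_range: "K ` carrier (G Mod center G) = Inn G"
    by (simp add: Inn_eq carrier_FactGroup image_image K_coset cong: image_cong_simp)
  define F where "F = (\<lambda>(X, h). K X \<otimes>\<^bsub>AutoGroup G\<^esub> f h)"
  interpret SD: group "semidirect (G Mod center G) H \<phi>"
    by (rule group_semidirect[OF Q.is_group H phi])
  have F_hom: "F \<in> hom (semidirect (G Mod center G) H \<phi>) (AutoGroup G)"
  proof (rule homI)
    fix p assume "p \<in> carrier (semidirect (G Mod center G) H \<phi>)"
    then show "F p \<in> carrier (AutoGroup G)"
      using hom_in_carrier[OF K(1)] by (cases p) (simp add: semidirect_def F_def)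
  next
    fix p q assume "p \<in> carrier (semidirect (G Mod center G) H \<phi>)" "q \<in> carrier (semidirect (G Mod center G) H \<phi>)"
    then obtain x h y k where pq: "p = (center G #> x, h)" "q = (center G #> y, k)"
      "x \<in> carrier G" "y \<in> carrier G" "h \<in> carrier H" "k \<in> carrier H"
      by (auto simp: semidirect_def carrier_FactGroup)
    have fh: "f h \<in> auto G" "f k \<in> auto G" using pq f.hom_closed by (auto simp: carrier_AutoGroup)
    have hy: "f h y \<in> carrier G" using fh pq by (simp add: auto_closed)
    have C: "conj_auto G x \<in> carrier (AutoGroup G)" "conj_auto G y \<in> carrier (AutoGroup G)"
      "conj_auto G (f h y) \<in> carrier (AutoGroup G)" "f h \<in> carrier (AutoGroup G)" "f k \<in> carrier (AutoGroup G)"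
      using pq hy fh by (simp_all add: conj_auto_auto carrier_AutoGroup)
    have "F (p \<otimes>\<^bsub>semidirect (G Mod center G) H \<phi>\<^esub> q) = K (center G #> (x \<otimes> f h y)) \<otimes>\<^bsub>AutoGroup G\<^esub> f (h \<otimes>\<^bsub>H\<^esub> k)"
      using pq fh hy by (simp add: F_def semidirect_def \<phi>_def induced_auto_coset Z.rcos_sum)
    also have "\<dots> = conj_auto G x \<otimes>\<^bsub>AutoGroup G\<^esub> (conj_auto G (f h y) \<otimes>\<^bsub>AutoGroup G\<^esub> f h) \<otimes>\<^bsub>AutoGroup G\<^esub> f k"
      using pq hy C by (simp add: K_coset AG.m_assoc)
    \<comment> \<open>This exchange is what the twisted multiplication of the semidirect product
      encodes.\<close>
    also have "conj_auto G (f h y) \<otimes>\<^bsub>AutoGroup G\<^esub> f h = f h \<otimes>\<^bsub>AutoGroup G\<^esub> conj_auto G y"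
      using pq fh by (simp add: auto_conj_auto)
    also have "conj_auto G x \<otimes>\<^bsub>AutoGroup G\<^esub> (f h \<otimes>\<^bsub>AutoGroup G\<^esub> conj_auto G y) \<otimes>\<^bsub>AutoGroup G\<^esub> f k = F p \<otimes>\<^bsub>AutoGroup G\<^esub> F q"
      using pq C by (simp add: F_def K_coset AG.m_assoc)
    finally show "F (p \<otimes>\<^bsub>semidirect (G Mod center G) H \<phi>\<^esub> q) = F p \<otimes>\<^bsub>AutoGroup G\<^esub> F q" .
  qed
  have "F ` carrier (semidirect (G Mod center G) H \<phi>) = Inn G <#>\<^bsub>AutoGroup G\<^esub> f ` carrier H"
    unfolding K_range[symmetric] image_prod_set_mult[symmetric] F_def by (simp add: semidirect_def)
  then have surj: "F ` carrier (semidirect (G Mod center G) H \<phi>) = carrier (AutoGroup G)" by (simp add: prod)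
  interpret F: group_hom "semidirect (G Mod center G) H \<phi>" "AutoGroup G" F
    by unfold_locales (rule F_hom)
  have "inj_on F (carrier (semidirect (G Mod center G) H \<phi>))"
    unfolding F.inj_on_one_iff
  proof clarify
    fix X h assume p: "(X, h) \<in> carrier (semidirect (G Mod center G) H \<phi>)" and one: "F (X, h) = \<one>\<^bsub>AutoGroup G\<^esub>"
    then have X: "X \<in> carrier (G Mod center G)" and h: "h \<in> carrier H" by (auto simp: semidirect_def)
    have KX: "K X \<in> Inn G" unfolding K_range[symmetric] by (rule imageI[OF X])
    have e: "K X \<otimes>\<^bsub>AutoGroup G\<^esub> f h = \<one>\<^bsub>AutoGroup G\<^esub>" using one by (simp add: F_def)
    then have "f h = inv\<^bsub>AutoGroup G\<^esub> K X"
      using AG.inv_unique'[OF I.mem_carrier[OF KX] f.hom_closed[OF h] e]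
        AG.inv_comm[OF e I.mem_carrier[OF KX] f.hom_closed[OF h]] by simp
    then have "h = \<one>\<^bsub>H\<^esub>" using triv[OF h] KX I.m_inv_closed by simp
    moreover have "K X = \<one>\<^bsub>AutoGroup G\<^esub>"
      using e \<open>h = \<one>\<^bsub>H\<^esub>\<close> KX I.mem_carrier[OF KX] by simp
    moreover have "K \<one>\<^bsub>G Mod center G\<^esub> = \<one>\<^bsub>AutoGroup G\<^esub>" by (rule hom_one[OF K(1) Q.is_group AG.is_group])
    ultimately show "(X, h) = \<one>\<^bsub>semidirect (G Mod center G) H \<phi>\<^esub>"
      using inj_onD[OF K(2), of X "\<one>\<^bsub>G Mod center G\<^esub>"] X Q.one_closed by (simp add: semidirect_def)
  qed
  with surj have "F \<in> iso (semidirect (G Mod center G) H \<phi>) (AutoGroup G)"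
    using F_hom by (simp add: iso_def bij_betw_def)
  then show "AutoGroup G \<cong> semidirect (G Mod center G) H (\<lambda>h. induced_auto G (center G) (f h))"
    unfolding \<phi>_def by (intro group.iso_sym[OF SD.is_group[unfolded \<phi>_def]] is_isoI)
  interpret O: group "Out G" unfolding Out_def by (rule I.factorgroup_is_group)
  define E where "E h = Inn G #>\<^bsub>AutoGroup G\<^esub> f h" for h
  have Ehom: "E \<in> hom H (Out G)"
    using Group.hom_compose[OF f I.r_coset_hom_Mod] by (simp add: E_def[abs_def] Out_def comp_def)
  interpret E: group_hom H "Out G" E by unfold_locales (rule Ehom)
  have "inj_on E (carrier H)"
    unfolding E.inj_on_one_iff
  proof (intro allI impI)
    fix h assume h: "h \<in> carrier H" and "E h = \<one>\<^bsub>Out G\<^esub>"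
    then have "Inn G #>\<^bsub>AutoGroup G\<^esub> f h = Inn G" by (simp add: E_def Out_def)
    moreover have "f h \<in> Inn G #>\<^bsub>AutoGroup G\<^esub> f h"
      by (rule AG.rcos_self[OF f.hom_closed[OF h] I.subgroup_axioms])
    ultimately have "f h \<in> Inn G" by simp
    then show "h = \<one>\<^bsub>H\<^esub>" using triv h by blast
  qed
  moreover have "E ` carrier H = carrier (Out G)"
  proof -
    have "Inn G #>\<^bsub>AutoGroup G\<^esub> a \<in> E ` carrier H" if a: "a \<in> carrier (AutoGroup G)" for a
    proof -
      have "a \<in> Inn G <#>\<^bsub>AutoGroup G\<^esub> f ` carrier H" using a by (simp only: prod)
      then obtain i h where ih: "i \<in> Inn G" "h \<in> carrier H" "a = i \<otimes>\<^bsub>AutoGroup G\<^esub> f h"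
        by (auto simp: set_mult_def)
      have "Inn G #>\<^bsub>AutoGroup G\<^esub> a = Inn G #>\<^bsub>AutoGroup G\<^esub> i #>\<^bsub>AutoGroup G\<^esub> f h"
        unfolding ih(3) using ih I.subset I.mem_carrier[OF ih(1)]
        by (intro AG.coset_mult_assoc[symmetric]) simp_all
      also have "Inn G #>\<^bsub>AutoGroup G\<^esub> i = Inn G" by (rule I.rcos_const[OF AG.is_group ih(1)])
      finally show ?thesis using ih(2) by (simp add: E_def)
    qed
    then have "carrier (Out G) \<subseteq> E ` carrier H"
      unfolding Out_def carrier_FactGroup by (rule image_subsetI)
    then show ?thesis by (intro equalityI image_subsetI E.hom_closed)
  qed
  ultimately have "E \<in> iso H (Out G)" using Ehom by (simp add: iso_def bij_betw_def)
  then show "Out G \<cong> H" by (intro H.iso_sym is_isoI)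
qed

section \<open>Normal forms modulo a central subgroup\<close>

text \<open>
  A pair \<open>(i, [(e\<^sub>1, i\<^sub>1), \<dots>, (e\<^sub>d, i\<^sub>d)])\<close> stands for \<open>c\<^sup>i t(e\<^sub>1) c\<^sup>i\<^sup>1 \<cdots> t(e\<^sub>d) c\<^sup>i\<^sup>d\<close>, with
  exponents modulo \<open>n\<close>; the letter \<open>bar e\<close> is the inverse of the letter \<open>e\<close> modulo powers of \<open>c\<^sup>n\<close>.
\<close>

type_synonym 'e nf = "int \<times> ('e \<times> int) list"

text \<open>A zero exponent between two letters is allowed unless they are \<open>bar\<close> of
  each other: powers of a letter of infinite order are spelled by repetition. For
  \<open>bar e = e\<close> the same condition separates equal neighbours by a nonzero
  exponent.\<close>

fun reduced :: "int \<Rightarrow> ('e \<Rightarrow> 'e) \<Rightarrow> ('e \<times> int) list \<Rightarrow> bool" where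
  "reduced n bar [] = True"
| "reduced n bar ((e, i) # L) \<longleftrightarrow>
     0 \<le> i \<and> i < n \<and> (i = 0 \<and> L \<noteq> [] \<longrightarrow> fst (hd L) \<noteq> bar e) \<and> reduced n bar L"

definition nf_set :: "int \<Rightarrow> ('e \<Rightarrow> 'e) \<Rightarrow> 'e nf set" where
  "nf_set n bar = {(i, L). 0 \<le> i \<and> i < n \<and> reduced n bar L}"

definition shift :: "int \<Rightarrow> int \<Rightarrow> 'e nf \<Rightarrow> 'e nf" where
  "shift n a = (\<lambda>(i, L). ((i + a) mod n, L))"

text \<open>Left multiplication by the letter \<open>e\<close> modulo central powers of
  \<open>c\<close>, just as \<open>shift\<close> is left multiplication by a power of
  \<open>c\<close>.\<close>

definition attach :: "('e \<Rightarrow> 'e) \<Rightarrow> 'e \<Rightarrow> 'e nf \<Rightarrow> 'e nf" where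
  "attach bar e = (\<lambda>(i, L). if i = 0 \<and> L \<noteq> [] \<and> fst (hd L) = bar e then (snd (hd L), tl L) else (0, (e, i) # L))"

lemma shift_apply [simp]: "shift n a (i, L) = ((i + a) mod n, L)"
  by (simp add: shift_def)

lemma shift_nf_set: "n > 0 \<Longrightarrow> \<omega> \<in> nf_set n bar \<Longrightarrow> shift n a \<omega> \<in> nf_set n bar"
  by (auto simp: nf_set_def)

lemma shift_shift: "shift n a (shift n b \<omega>) = shift n (a + b) \<omega>"
  by (cases \<omega>) (simp add: mod_simps ac_simps)

lemma shift_multiple: "\<omega> \<in> nf_set n bar \<Longrightarrow> shift n (n * k) \<omega> = \<omega>"
  by (auto simp: nf_set_def)

lemma attach_nf_set: "n > 0 \<Longrightarrow> \<omega> \<in> nf_set n bar \<Longrightarrow> attach bar e \<omega> \<in> nf_set n bar"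
proof -
  assume "n > 0" "\<omega> \<in> nf_set n bar"
  moreover obtain i L where "\<omega> = (i, L)" by force
  ultimately show ?thesis by (cases L) (auto simp: nf_set_def attach_def)
qed

text \<open>Reducedness enters here: once \<open>bar e\<close> has removed a leading
  \<open>e\<close>, what follows cannot begin with \<open>bar e\<close> at exponent 0, so attaching
  \<open>e\<close> restores the letter instead of cancelling again.\<close>

lemma attach_bar:
  assumes "\<omega> \<in> nf_set n bar" "bar (bar e) = e"
  shows "attach bar e (attach bar (bar e) \<omega>) = \<omega>"
proof -
  obtain i L where o: "\<omega> = (i, L)" by force
  show ?thesis
  proof (cases "i = 0 \<and> L \<noteq> [] \<and> fst (hd L) = e")
    case True
    then obtain j M where L: "L = (e, j) # M" by (cases L) auto
    with True o assms show ?thesis by (auto simp: attach_def nf_set_def)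
  next
    case False
    with o assms(2) show ?thesis by (auto simp: attach_def)
  qed
qed

lemma length_attach: "length (snd (attach bar e \<omega>)) \<le> Suc (length (snd \<omega>))"
  by (cases \<omega>) (auto simp: attach_def)

lemma snd_shift [simp]: "snd (shift n a \<omega>) = snd \<omega>"
  by (cases \<omega>) simp

text \<open>The product rule of \<open>generate\<close> multiplies two arbitrary elements. The proof
  therefore shows that left multiplication by \<open>h\<close> preserves \<open>P\<close>, a
  property that is stable under products.\<close>

lemma (in group) generate_left_induct:
  assumes h: "h \<in> generate G S" and S: "S \<subseteq> carrier G" and one: "P \<one>"
    and step: "\<And>s g. s \<in> S \<Longrightarrow> g \<in> carrier G \<Longrightarrow> P g \<Longrightarrow> P (s \<otimes> g)"
    and step_inv: "\<And>s g. s \<in> S \<Longrightarrow> g \<in> carrier G \<Longrightarrow> P g \<Longrightarrow> P (inv s \<otimes> g)"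
  shows "P h"
proof -
  have "\<forall>g\<in>carrier G. P g \<longrightarrow> P (h \<otimes> g)"
    using h
  proof induction
    case (eng h1 h2)
    have "h1 \<in> carrier G" "h2 \<in> carrier G" using eng generate_in_carrier[OF S] by auto
    with eng show ?case by (simp add: m_assoc)
  qed (use step step_inv in auto)
  moreover have "h \<in> carrier G" using h generate_in_carrier[OF S] by auto
  ultimately show ?thesis using one by force
qed

text \<open>The action keeps distinct reduced words distinct, while \<open>pow_central\<close> and
  \<open>t_bar\<close> allow every element to be brought to reduced form. It is total on pairs, but
  prescribed only on \<open>nf_set n bar\<close>, where \<open>attach\<close> is invertible. The
  exponent \<open>j\<close> in \<open>t_bar\<close> is 0 for even \<open>m\<close> and 1 for odd
  \<open>m\<close>.\<close>

locale normal_form = group G for G (structure) +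
  fixes c :: 'a and n :: int and t :: "'e \<Rightarrow> 'a" and bar :: "'e \<Rightarrow> 'e"
    and act :: "'a \<Rightarrow> 'e nf \<Rightarrow> 'e nf"
  assumes c_closed [simp]: "c \<in> carrier G" and t_closed [simp]: "t e \<in> carrier G"
    and n_ge: "n \<ge> 2" and bar_bar [simp]: "bar (bar e) = e"
    and act_mult: "g \<in> carrier G \<Longrightarrow> h \<in> carrier G \<Longrightarrow> act (g \<otimes> h) \<omega> = act g (act h \<omega>)"
    and act_one: "act \<one> \<omega> = \<omega>"
    and act_c: "\<omega> \<in> nf_set n bar \<Longrightarrow> act c \<omega> = shift n 1 \<omega>"
    and act_t: "\<omega> \<in> nf_set n bar \<Longrightarrow> act (t e) \<omega> = attach bar e \<omega>"
    and pow_central: "c [^] n \<otimes> t e = t e \<otimes> c [^] n"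
    and t_bar: "\<exists>j::int. t e \<otimes> t (bar e) = c [^] (n * j)"
    and generated: "carrier G = generate G (insert c (range t))"
begin

text \<open>It acts trivially on normal forms and turns out to be the centre, see
  \<open>center_eq\<close>.\<close>

definition Zs :: "'a set" where
  "Zs = range (\<lambda>j::int. c [^] (n * j))"

lemma n_pos: "n > 0"
  using n_ge by simp

lemma gens_closed: "insert c (range t) \<subseteq> carrier G"
  by auto

lemma cpow_mult: "c [^] (i::int) \<otimes> c [^] (j::int) = c [^] (i + j)"
  by (simp add: int_pow_mult)

lemma cpow_mult_assoc: "g \<in> carrier G \<Longrightarrow> c [^] (i::int) \<otimes> (c [^] (j::int) \<otimes> g) = c [^] (i + j) \<otimes> g"
  by (simp add: m_assoc[symmetric] int_pow_mult)

lemma c_eq_cpow: "c = c [^] (1::int)"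
  by (simp add: int_pow_1)

lemma cpow_closed: "c [^] (i::int) \<in> carrier G"
  by simp

lemma central_pow:
  assumes "g \<in> carrier G"
  shows "c [^] n \<otimes> g = g \<otimes> c [^] n"
proof -
  let ?z = "c [^] n"
  have inv: "?z \<otimes> (inv s \<otimes> g) = inv s \<otimes> g \<otimes> ?z"
    if "s \<in> carrier G" "?z \<otimes> s = s \<otimes> ?z" "g \<in> carrier G" "?z \<otimes> g = g \<otimes> ?z" for s g
  proof -
    have "s \<otimes> (?z \<otimes> (inv s \<otimes> g)) = s \<otimes> ?z \<otimes> inv s \<otimes> g"
      using that by (simp add: m_assoc)
    also have "\<dots> = ?z \<otimes> g" using that by (simp add: that(2)[symmetric] m_assoc)
    finally show ?thesis using that by (simp add: m_assoc inv_solve_left)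
  qed
  have gen: "?z \<otimes> s = s \<otimes> ?z" if "s \<in> insert c (range t)" for s
    using that pow_central cpow_mult[of n 1] cpow_mult[of 1 n] by (auto simp: int_pow_1 add.commute)
  have "g \<in> generate G (insert c (range t))" using assms generated by simp
  then show ?thesis
  proof (rule generate_left_induct[OF _ gens_closed])
    fix s g assume s: "s \<in> insert c (range t)" and g: "g \<in> carrier G" "?z \<otimes> g = g \<otimes> ?z"
    have sc: "s \<in> carrier G" using s by auto
    show "?z \<otimes> (s \<otimes> g) = s \<otimes> g \<otimes> ?z"
      using g sc gen[OF s] by (metis cpow_closed m_assoc)
    show "?z \<otimes> (inv s \<otimes> g) = inv s \<otimes> g \<otimes> ?z" by (rule inv[OF sc gen[OF s] g])
  qed simp
qed

lemma Zs_central: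
  assumes z: "z \<in> Zs" and g: "g \<in> carrier G"
  shows "z \<otimes> g = g \<otimes> z"
proof -
  obtain j :: int where z: "z = (c [^] n) [^] j" using z by (auto simp: Zs_def int_pow_pow)
  have "g \<otimes> (c [^] n) \<otimes> inv g = c [^] n" using g by (simp add: central_pow[symmetric] m_assoc)
  interpret f: group_hom G G "\<lambda>x. g \<otimes> x \<otimes> inv g"
  proof
    show "(\<lambda>x. g \<otimes> x \<otimes> inv g) \<in> hom G G"
    proof (rule homI)
      fix x y assume "x \<in> carrier G" "y \<in> carrier G"
      with g have "inv g \<otimes> (g \<otimes> (y \<otimes> inv g)) = y \<otimes> inv g" by (simp add: m_assoc[symmetric])
      with g \<open>x \<in> carrier G\<close> \<open>y \<in> carrier G\<close>
      show "g \<otimes> (x \<otimes> y) \<otimes> inv g = g \<otimes> x \<otimes> inv g \<otimes> (g \<otimes> y \<otimes> inv g)" by (simp add: m_assoc)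
    qed (use g in simp)
  qed
  have "g \<otimes> z \<otimes> inv g = z"
    using f.hom_int_pow[of "c [^] n" j] \<open>g \<otimes> (c [^] n) \<otimes> inv g = c [^] n\<close> by (simp add: z)
  then show ?thesis using g by (simp add: z inv_solve_right')
qed

lemma Zs_closed: "z \<in> Zs \<Longrightarrow> z \<in> carrier G"
  by (auto simp: Zs_def)

lemma cpow_Zs: "i mod n = 0 \<Longrightarrow> c [^] (i::int) \<in> Zs"
  unfolding Zs_def by (metis mod_0_imp_dvd dvdE rangeI)

lemma inv_t: "\<exists>z\<in>Zs. inv (t e) = z \<otimes> t (bar e)"
proof -
  obtain j :: int where j: "t (bar e) \<otimes> t e = c [^] (n * j)" using t_bar[of "bar e"] by auto
  have "c [^] (n * (- j)) \<otimes> t (bar e) \<otimes> t e = \<one>"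
    using j by (simp add: m_assoc cpow_mult)
  then have "inv (t e) = c [^] (n * (- j)) \<otimes> t (bar e)" by (intro inv_equality) simp_all
  then show ?thesis unfolding Zs_def by blast
qed

lemma act_cpow:
  assumes \<omega>: "\<omega> \<in> nf_set n bar"
  shows "act (c [^] (a::int)) \<omega> = shift n a \<omega>"
proof -
  have nat: "act (c [^] int k) \<omega> = shift n (int k) \<omega>" if "\<omega> \<in> nf_set n bar" for k and \<omega> :: "'e nf"
    using that
  proof (induction k)
    case 0
    then show ?case using shift_multiple[OF 0, of 0] by (simp add: act_one)
  next
    case (Suc k)
    have "c [^] int (Suc k) = c \<otimes> c [^] int k" using cpow_mult[of 1 "int k"] by (simp add: int_pow_1)
    with Suc show ?case
      by (simp add: act_mult act_c shift_nf_set n_pos shift_shift)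
  qed
  show ?thesis
  proof (cases "a \<ge> 0")
    case True
    then show ?thesis using nat[OF \<omega>, of "nat a"] by simp
  next
    case False
    let ?k = "nat (- a)"
    \<comment> \<open>A negative power is determined by its inverse, which takes
      \<open>shift n a \<omega>\<close> back to \<open>\<omega>\<close>.\<close>
    have "act (c [^] int ?k) (shift n a \<omega>) = \<omega>"
      using nat[OF shift_nf_set[OF n_pos \<omega>], of ?k] shift_multiple[OF \<omega>, of 0] False by (simp add: shift_shift)
    then have "act (c [^] a) \<omega> = act (c [^] a \<otimes> c [^] int ?k) (shift n a \<omega>)"
      by (simp add: act_mult)
    also have "\<dots> = shift n a \<omega>" using False by (simp add: cpow_mult act_one)
    finally show ?thesis .
  qed
qed

lemma act_Zs: "z \<in> Zs \<Longrightarrow> \<omega> \<in> nf_set n bar \<Longrightarrow> act z \<omega> = \<omega>"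
  by (auto simp: Zs_def act_cpow shift_multiple)

lemma act_inv_t:
  assumes "\<omega> \<in> nf_set n bar"
  shows "act (inv (t e)) \<omega> = attach bar (bar e) \<omega>"
proof -
  obtain z where "z \<in> Zs" "inv (t e) = z \<otimes> t (bar e)" using inv_t by blast
  with assms show ?thesis by (simp add: act_mult Zs_closed act_t act_Zs attach_nf_set n_pos)
qed

lemma act_nf_set:
  assumes "g \<in> carrier G" "\<omega> \<in> nf_set n bar"
  shows "act g \<omega> \<in> nf_set n bar"
proof -
  have "g \<in> generate G (insert c (range t))" using assms generated by simp
  then show ?thesis
  proof (rule generate_left_induct[OF _ gens_closed])
    fix s g assume s: "s \<in> insert c (range t)" and g: "g \<in> carrier G" "act g \<omega> \<in> nf_set n bar"
    have inv_c: "inv c = c [^] (- 1 :: int)" by (simp add: int_pow_neg int_pow_1)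
    have "act s \<omega> \<in> nf_set n bar" "act (inv s) \<omega> \<in> nf_set n bar" if "\<omega> \<in> nf_set n bar" for \<omega>
      using s that by (auto simp: act_c act_t act_inv_t inv_c act_cpow shift_nf_set attach_nf_set n_pos)
    moreover have "s \<in> carrier G" using s by auto
    ultimately show "act (s \<otimes> g) \<omega> \<in> nf_set n bar" "act (inv s \<otimes> g) \<omega> \<in> nf_set n bar"
      using g by (simp_all add: act_mult)
  qed (simp add: act_one assms)
qed

section \<open>Reading normal forms off the action\<close>

fun wrd :: "('e \<times> int) list \<Rightarrow> 'a" where
  "wrd [] = \<one>"
| "wrd ((e, i) # L) = t e \<otimes> (c [^] i \<otimes> wrd L)"

lemma wrd_closed [simp]: "wrd L \<in> carrier G"
  by (induction L rule: wrd.induct) auto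

lemma wrd_append: "wrd (L @ M) = wrd L \<otimes> wrd M"
  by (induction L rule: wrd.induct) (auto simp: m_assoc)

text \<open>The pair \<open>(0, [])\<close> is the form of the identity, so the form of
  \<open>g\<close> is well defined by construction.\<close>

definition N :: "'a \<Rightarrow> 'e nf" where
  "N g = act g (0, [])"

definition len :: "'a \<Rightarrow> nat" where
  "len g = length (snd (N g))"

definition lead :: "'a \<Rightarrow> int" where
  "lead g = fst (N g)"

text \<open>Meaningful only when \<open>len g > 0\<close>.\<close>

definition first :: "'a \<Rightarrow> 'e" where
  "first g = fst (hd (snd (N g)))"

lemma empty_nf_set: "(0, []) \<in> nf_set n bar"
  using n_pos by (simp add: nf_set_def)

lemma N_nf_set: "g \<in> carrier G \<Longrightarrow> N g \<in> nf_set n bar"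
  unfolding N_def by (rule act_nf_set[OF _ empty_nf_set])

lemma N_mult: "g \<in> carrier G \<Longrightarrow> h \<in> carrier G \<Longrightarrow> N (g \<otimes> h) = act g (N h)"
  by (simp add: N_def act_mult)

lemma lead_bounds: "g \<in> carrier G \<Longrightarrow> 0 \<le> lead g \<and> lead g < n"
  using N_nf_set[of g] by (auto simp: nf_set_def lead_def)

lemma lead_mod: "g \<in> carrier G \<Longrightarrow> lead g mod n = lead g"
  using lead_bounds[of g] by simp

text \<open>The last hypothesis says that nothing cancels at the seam, so the words are joined there
  and the two meeting exponents add up. With an empty second word this gives \<open>N_wrd\<close>,
  in general \<open>no_cancel\<close>.\<close>

lemma act_wrd:
  assumes "reduced n bar L" "L \<noteq> []" "(j, M) \<in> nf_set n bar"
    and "(snd (last L) + j) mod n \<noteq> 0 \<or> M = [] \<or> fst (hd M) \<noteq> bar (fst (last L))"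
  shows "act (wrd L) (j, M) = (0, butlast L @ (fst (last L), (snd (last L) + j) mod n) # M)"
  using assms
proof (induction L rule: wrd.induct)
  case (2 e i L)
  note M = \<open>(j, M) \<in> nf_set n bar\<close>
  have L: "act (wrd L) (j, M) \<in> nf_set n bar" by (rule act_nf_set[OF wrd_closed M])
  show ?case
  proof (cases "L = []")
    case True
    have "((i + j) mod n, M) \<in> nf_set n bar"
      using shift_nf_set[OF n_pos M, of i] by (simp add: add.commute)
    with 2 True show ?thesis
      by (auto simp: act_mult act_one act_cpow act_t attach_def add.commute)
  next
    case False
    let ?K = "butlast L @ (fst (last L), (snd (last L) + j) mod n) # M"
    have IH: "act (wrd L) (j, M) = (0, ?K)" using 2 False by auto
    have hd: "fst (hd ?K) = fst (hd L)" using False by (cases L) auto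
    have i: "0 \<le> i" "i < n" using 2 by auto
    have K: "(i, ?K) \<in> nf_set n bar" using L i unfolding IH by (auto simp: nf_set_def)
    have "act (wrd ((e, i) # L)) (j, M) = attach bar e (i, ?K)"
      using i K L unfolding IH by (simp add: act_mult act_cpow act_t IH)
    also have "\<dots> = (0, (e, i) # ?K)"
      using 2 False hd by (auto simp: attach_def)
    finally show ?thesis using False by simp
  qed
qed simp

lemma N_wrd:
  assumes "reduced n bar L"
  shows "N (wrd L) = (0, L)"
proof (cases "L = []")
  case False
  obtain e i where l: "last L = (e, i)" by force
  have "reduced n bar M \<Longrightarrow> (e, i) \<in> set M \<Longrightarrow> 0 \<le> i \<and> i < n" for M
    by (induction M) auto
  then have i: "i mod n = i" using assms l False last_in_set by (metis mod_pos_pos_trivial)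
  have "butlast L @ [(e, i)] = L" using False l by (metis append_butlast_last_id)
  then show ?thesis using act_wrd[OF assms False empty_nf_set] l i by (simp add: N_def)
qed (simp add: N_def act_one)

lemma N_cpow_mult: "g \<in> carrier G \<Longrightarrow> N (c [^] (a::int) \<otimes> g) = shift n a (N g)"
  by (simp add: N_mult act_cpow N_nf_set)

lemma lead_cpow_mult: "g \<in> carrier G \<Longrightarrow> lead (c [^] (a::int) \<otimes> g) = (a + lead g) mod n"
  by (cases "N g") (simp add: lead_def N_cpow_mult add.commute)

lemma len_cpow_mult: "g \<in> carrier G \<Longrightarrow> len (c [^] (a::int) \<otimes> g) = len g"
  by (cases "N g") (simp add: len_def N_cpow_mult)

lemma first_cpow_mult: "g \<in> carrier G \<Longrightarrow> first (c [^] (a::int) \<otimes> g) = first g"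
  by (cases "N g") (simp add: first_def N_cpow_mult)

lemma N_cpow: "N (c [^] (a::int)) = (a mod n, [])"
  using act_cpow[OF empty_nf_set] by (simp add: N_def)

lemma lead_cpow: "lead (c [^] (a::int)) = a mod n" and len_cpow: "len (c [^] (a::int)) = 0"
  by (simp_all add: lead_def len_def N_cpow)

text \<open>Existence of normal forms. \<open>N\<close> knows elements only modulo
  \<open>Zs\<close>; the lost information sits in the integer \<open>k\<close>.\<close>

lemma decomp:
  assumes "g \<in> carrier G"
  obtains k :: int where "g = c [^] k \<otimes> wrd (snd (N g))" "k mod n = lead g"
proof -
  have "g \<in> generate G (insert c (range t))" using assms generated by simp
  then have "\<exists>k::int. \<exists>L. g = c [^] k \<otimes> wrd L \<and> reduced n bar L"
  proof (rule generate_left_induct[OF _ gens_closed])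
    show "\<exists>k::int. \<exists>L. \<one> = c [^] k \<otimes> wrd L \<and> reduced n bar L"
      by (intro exI[of _ "0::int"] exI[of _ "[]"]) simp
    have c: "\<exists>k::int. \<exists>L. c [^] (i::int) \<otimes> g = c [^] k \<otimes> wrd L \<and> reduced n bar L"
      if "\<exists>k::int. \<exists>L. g = c [^] k \<otimes> wrd L \<and> reduced n bar L" for i g
      using that by (metis cpow_mult_assoc wrd_closed)
    have t: "\<exists>k::int. \<exists>L. t e \<otimes> g = c [^] k \<otimes> wrd L \<and> reduced n bar L"
      if g: "\<exists>k::int. \<exists>L. g = c [^] k \<otimes> wrd L \<and> reduced n bar L" for e g
    proof -
      obtain k :: int and L where kL: "g = c [^] k \<otimes> wrd L" "reduced n bar L" using g by blast
      \<comment> \<open>Only the residue of \<open>k\<close> modulo \<open>n\<close> decides about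
        cancellation; the multiple of \<open>n\<close> is central and moves to the front.\<close>
      have "c [^] (n * (k div n)) \<in> Zs" by (auto simp: Zs_def)
      note z = Zs_central[OF this]
      have k: "c [^] k = c [^] (n * (k div n)) \<otimes> c [^] (k mod n)" by (simp add: cpow_mult)
      have tg: "t e \<otimes> g = c [^] (n * (k div n)) \<otimes> (t e \<otimes> (c [^] (k mod n) \<otimes> wrd L))"
        unfolding kL k by (simp add: m_assoc z)
      show ?thesis
      proof (cases "k mod n = 0 \<and> L \<noteq> [] \<and> fst (hd L) = bar e")
        case True
        then obtain i M where L: "L = (bar e, i) # M" by (cases L) auto
        obtain j :: int where j: "t e \<otimes> t (bar e) = c [^] (n * j)" using t_bar by blast
        have "t e \<otimes> g = c [^] (n * (k div n)) \<otimes> (t e \<otimes> t (bar e) \<otimes> (c [^] i \<otimes> wrd M))"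
          unfolding tg using True by (simp add: L m_assoc)
        also have "\<dots> = c [^] (n * (k div n) + n * j + i) \<otimes> wrd M"
          unfolding j by (simp add: cpow_mult_assoc cpow_mult add.assoc)
        finally show ?thesis using kL(2) by (auto simp: L)
      next
        case False
        then have "reduced n bar ((e, k mod n) # L)" using kL n_pos by auto
        moreover have "t e \<otimes> g = c [^] (n * (k div n)) \<otimes> wrd ((e, k mod n) # L)" using tg by simp
        ultimately show ?thesis by blast
      qed
    qed
    fix s g assume s: "s \<in> insert c (range t)" and g: "g \<in> carrier G"
      "\<exists>k::int. \<exists>L. g = c [^] k \<otimes> wrd L \<and> reduced n bar L"
    show "\<exists>k::int. \<exists>L. s \<otimes> g = c [^] k \<otimes> wrd L \<and> reduced n bar L"
      using s c[OF g(2), of 1] t[OF g(2)] by (auto simp: int_pow_1)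
    show "\<exists>k::int. \<exists>L. inv s \<otimes> g = c [^] k \<otimes> wrd L \<and> reduced n bar L"
    proof (cases "s = c")
      case True
      then show ?thesis using c[OF g(2), of "-1"] by (simp add: int_pow_neg int_pow_1)
    next
      case False
      then obtain e where e: "s = t e" using s by blast
      obtain z where z: "z \<in> Zs" "inv (t e) = z \<otimes> t (bar e)" using inv_t by blast
      then obtain j :: int where "z = c [^] (n * j)" by (auto simp: Zs_def)
      then have "inv s \<otimes> g = c [^] (n * j) \<otimes> (t (bar e) \<otimes> g)" using z e g by (simp add: m_assoc)
      then show ?thesis using c[OF t[OF g(2)], of "n * j" "bar e"] by simp
    qed
  qed
  then obtain k :: int and L where kL: "g = c [^] k \<otimes> wrd L" "reduced n bar L" by blast
  then have "N g = (k mod n, L)" by (simp add: N_cpow_mult N_wrd)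
  with kL that show ?thesis by (simp add: lead_def)
qed


lemma len_0_cpow:
  assumes "g \<in> carrier G" "len g = 0"
  obtains k :: int where "g = c [^] k" "k mod n = lead g"
  using decomp[OF assms(1)] assms(2) by (auto simp: len_def)

lemma len_0_lead_0_Zs: "g \<in> carrier G \<Longrightarrow> len g = 0 \<Longrightarrow> lead g = 0 \<Longrightarrow> g \<in> Zs"
  by (metis len_0_cpow cpow_Zs)

lemma len_Zs: "z \<in> Zs \<Longrightarrow> len z = 0"
  by (auto simp: Zs_def len_cpow)

lemma N_Zs_mult: "z \<in> Zs \<Longrightarrow> g \<in> carrier G \<Longrightarrow> N (z \<otimes> g) = N g"
  by (simp add: N_mult Zs_closed act_Zs N_nf_set)

lemma N_t: "N (t e) = (0, [(e, 0)])"
  using act_t[OF empty_nf_set] by (simp add: N_def attach_def)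

lemma len_t: "len (t e) = 1" and lead_t: "lead (t e) = 0" and first_t: "first (t e) = e"
  by (simp_all add: len_def lead_def first_def N_t)

lemma N_inv_t: "N (inv (t e)) = (0, [(bar e, 0)])"
proof -
  obtain z where "z \<in> Zs" "inv (t e) = z \<otimes> t (bar e)" using inv_t by blast
  then show ?thesis by (simp add: N_Zs_mult N_t)
qed

text \<open>Inversion reverses the word, so the induction carries its already inverted front part in
  \<open>(j, M)\<close>. As \<open>inv (t e)\<close> acts like \<open>bar e\<close>, it could only
  cancel a leading \<open>e\<close> of \<open>M\<close>, which the last hypothesis rules
  out.\<close>

lemma act_inv_wrd:
  assumes "reduced n bar L" "L \<noteq> []" "(j, M) \<in> nf_set n bar"
    and "j = 0 \<longrightarrow> M \<noteq> [] \<longrightarrow> fst (hd M) \<noteq> fst (hd L)"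
  shows "\<exists>k K. act (inv (wrd L)) (j, M) = (- snd (last L) mod n, (bar (fst (last L)), k) # K)
    \<and> length K + 1 = length L + length M"
  using assms
proof (induction L arbitrary: j M rule: wrd.induct)
  case (2 e i L)
  let ?M = "(bar e, j) # M"
  have inv: "inv (wrd ((e, i) # L)) = inv (wrd L) \<otimes> (c [^] (- i) \<otimes> inv (t e))"
    by (simp add: inv_mult_group int_pow_neg m_assoc)
  have t: "act (inv (t e)) (j, M) = (0, ?M)"
    using 2 by (auto simp: act_inv_t attach_def)
  have o: "(0, ?M) \<in> nf_set n bar"
    using act_nf_set[OF _ 2(4), of "inv (t e)"] t by simp
  have o': "(- i mod n, ?M) \<in> nf_set n bar" using shift_nf_set[OF n_pos o, of "- i"] by simp
  have a: "act (inv (wrd ((e, i) # L))) (j, M) = act (inv (wrd L)) (- i mod n, ?M)"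
    unfolding inv by (simp add: act_mult t act_cpow[OF o, of "- i"])
  show ?case
  proof (cases "L = []")
    case True
    then show ?thesis unfolding a by (simp add: act_one)
  next
    case False
    \<comment> \<open>Exponents are residues below \<open>n\<close>, so negation keeps them nonzero
      modulo \<open>n\<close>.\<close>
    have "- i mod n = 0 \<Longrightarrow> i = 0" using 2(2) by (auto simp: zmod_zminus1_eq_if split: if_splits)
    then have "- i mod n = 0 \<longrightarrow> ?M \<noteq> [] \<longrightarrow> fst (hd ?M) \<noteq> fst (hd L)" using 2(2) False by auto
    from 2(1)[OF _ False o' this] 2(2) show ?thesis unfolding a using False by auto
  qed
qed simp

text \<open>Thus \<open>lead\<close> and \<open>first\<close> of the inverse describe how
  \<open>g\<close> ends, and ends of elements are handled in this form from here on.\<close>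

lemma N_inv:
  assumes g: "g \<in> carrier G" and L: "snd (N g) \<noteq> []"
  shows "lead (inv g) = - snd (last (snd (N g))) mod n"
    and "first (inv g) = bar (fst (last (snd (N g))))"
    and "len (inv g) = len g"
proof -
  let ?L = "snd (N g)"
  obtain k :: int where k: "g = c [^] k \<otimes> wrd ?L" using decomp[OF g] by blast
  have red: "reduced n bar ?L" using N_nf_set[OF g] by (auto simp: nf_set_def)
  have inv: "inv g = inv (wrd ?L) \<otimes> c [^] (- k)"
    by (subst k) (simp add: inv_mult_group int_pow_neg)
  have o: "(- k mod n, []) \<in> nf_set n bar" using n_pos by (simp add: nf_set_def)
  have "N (inv g) = act (inv (wrd ?L)) (- k mod n, [])"
    unfolding inv by (subst N_mult) (simp_all only: N_cpow inv_closed wrd_closed cpow_closed)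
  with act_inv_wrd[OF red L o] show "lead (inv g) = - snd (last (snd (N g))) mod n"
    and "first (inv g) = bar (fst (last (snd (N g))))" "len (inv g) = len g"
    by (auto simp: lead_def first_def len_def)
qed

lemma len_inv: "g \<in> carrier G \<Longrightarrow> len (inv g) = len g"
proof (cases "len g = 0")
  case True
  assume "g \<in> carrier G"
  then obtain k :: int where k: "g = c [^] k" using True by (rule len_0_cpow)
  have "inv g = c [^] (- k)" by (simp add: k int_pow_neg)
  then show ?thesis using True by (simp add: len_cpow)
next
  case False
  assume "g \<in> carrier G"
  then show ?thesis using False N_inv(3)[of g] by (simp add: len_def)
qed

section \<open>Cancellation in products\<close>

text \<open>In the product of \<open>g\<close> and \<open>h\<close> letters cancel precisely when \<open>inv g\<close> and \<open>h\<close> agree up to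
  and including their first letters.\<close>

definition cancels :: "'a \<Rightarrow> 'a \<Rightarrow> bool" where
  "cancels g h \<longleftrightarrow> len g > 0 \<and> len h > 0 \<and> lead (inv g) = lead h \<and> first (inv g) = first h"

text \<open>With \<open>i\<close> the last exponent of \<open>g\<close> and \<open>j\<close> the
  leading one of \<open>h\<close>, a vanishing exponent at the seam becomes the condition
  \<open>lead (inv g) = lead h\<close> of \<open>cancels\<close>.\<close>

lemma mod_add_eq_0_iff:
  fixes i j :: int
  assumes "0 \<le> j" "j < n"
  shows "(i + j) mod n = 0 \<longleftrightarrow> - i mod n = j"
proof -
  have "(i + j) mod n = 0 \<longleftrightarrow> n dvd j - (- i)" by (simp add: dvd_eq_mod_eq_0 add.commute)
  also have "\<dots> \<longleftrightarrow> j mod n = - i mod n" by (simp only: mod_eq_dvd_iff)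
  finally show ?thesis using assms by auto
qed

text \<open>The condition \<open>len g > 0\<close> matters for \<open>lead\<close> and
  \<open>first\<close>: a mere power of \<open>c\<close> would be added to the leading exponent of
  \<open>h\<close>.\<close>

lemma no_cancel:
  assumes g: "g \<in> carrier G" and h: "h \<in> carrier G" and pos: "len g > 0" and nc: "\<not> cancels g h"
  shows "len (g \<otimes> h) = len g + len h" "lead (g \<otimes> h) = lead g" "first (g \<otimes> h) = first g"
proof -
  let ?L = "snd (N g)"
  have L: "?L \<noteq> []" using pos by (auto simp: len_def)
  obtain j M where M: "N h = (j, M)" by force
  obtain k :: int where k: "g = c [^] k \<otimes> wrd ?L" "k mod n = lead g" using decomp[OF g] by blast
  have red: "reduced n bar ?L" using N_nf_set[OF g] by (auto simp: nf_set_def)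
  have o: "(j, M) \<in> nf_set n bar" using N_nf_set[OF h] M by simp
  have j: "0 \<le> j" "j < n" "j = lead h" using lead_bounds[OF h] M by (auto simp: lead_def)
  have "(snd (last ?L) + j) mod n \<noteq> 0 \<or> M = [] \<or> fst (hd M) \<noteq> bar (fst (last ?L))"
  proof (rule ccontr)
    assume *: "\<not> ?thesis"
    then have "lead (inv g) = lead h" using N_inv(1)[OF g L] mod_add_eq_0_iff[OF j(1,2)] j(3) by simp
    moreover have "first (inv g) = first h" using N_inv(2)[OF g L] * M by (simp add: first_def)
    moreover have "len h > 0" using * M by (simp add: len_def)
    ultimately show False using pos nc by (simp add: cancels_def)
  qed
  from act_wrd[OF red L o this]
  have a: "N (wrd ?L \<otimes> h) = (0, butlast ?L @ (fst (last ?L), (snd (last ?L) + j) mod n) # M)"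
    using h by (simp add: N_mult M)
  have gh: "g \<otimes> h = c [^] k \<otimes> (wrd ?L \<otimes> h)" by (subst k(1)) (simp add: m_assoc h)
  have b: "N (g \<otimes> h) = (k mod n, butlast ?L @ (fst (last ?L), (snd (last ?L) + j) mod n) # M)"
    unfolding gh using h by (simp add: N_cpow_mult a)
  show "len (g \<otimes> h) = len g + len h" using L b by (simp add: len_def M)
  show "lead (g \<otimes> h) = lead g" using b k(2) by (simp add: lead_def)
  show "first (g \<otimes> h) = first g"
  proof (cases "butlast ?L")
    case Nil
    \<comment> \<open>A single letter of \<open>g\<close> is first and last at once, and its entry
      is the one changed at the seam.\<close>
    then have "?L = [last ?L]" using L by (metis append_Nil append_butlast_last_id)
    then have "hd ?L = last ?L" by (metis list.sel(1))
    then show ?thesis using b Nil by (simp add: first_def)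
  next
    case (Cons x K)
    then have "hd ?L = x" using L by (metis append_butlast_last_id append_Cons list.sel(1))
    then show ?thesis using b Cons by (simp add: first_def)
  qed
qed

lemma length_act_wrd:
  assumes "\<omega> \<in> nf_set n bar"
  shows "length (snd (act (wrd L) \<omega>)) \<le> length L + length (snd \<omega>)"
proof (induction L rule: wrd.induct)
  case (2 e i L)
  have o: "act (wrd L) \<omega> \<in> nf_set n bar" by (rule act_nf_set[OF wrd_closed assms])
  show ?case
    using 2 length_attach[of bar e "shift n i (act (wrd L) \<omega>)"] o
    by (simp add: act_mult act_t act_cpow shift_nf_set n_pos)
qed (simp add: act_one)

text \<open>Only an inequality, since the neighbours of the two vanishing letters may cancel in
  turn; \<open>length_act_wrd\<close> bounds what is left.\<close>

lemma cancel:
  assumes g: "g \<in> carrier G" and h: "h \<in> carrier G" and c: "cancels g h"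
  shows "len (g \<otimes> h) < len g + len h"
proof -
  let ?L = "snd (N g)"
  have L: "?L \<noteq> []" using c by (auto simp: len_def cancels_def)
  obtain f i where l: "last ?L = (f, i)" by force
  obtain k :: int where k: "g = c [^] k \<otimes> wrd ?L" using decomp[OF g] by blast
  have "snd (N h) \<noteq> []" using c by (auto simp: len_def cancels_def)
  then obtain j e j' M where M: "N h = (j, (e, j') # M)" by (metis list.exhaust surj_pair snd_conv)
  have j: "0 \<le> j" "j < n" "j = lead h" using lead_bounds[OF h] M by (auto simp: lead_def)
  have o: "N h \<in> nf_set n bar" by (rule N_nf_set[OF h])
  have e: "e = bar f" and "j = - i mod n"
    using c N_inv(1,2)[OF g L] l M by (simp_all add: cancels_def first_def lead_def)
  then have "(i + j) mod n = 0" by (simp add: mod_add_right_eq)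
  have "act (t f \<otimes> c [^] i) (N h) = attach bar f (shift n i (N h))"
    using o by (simp add: act_mult act_cpow act_t shift_nf_set n_pos)
  also have "\<dots> = (j', M)"
    using \<open>(i + j) mod n = 0\<close> by (simp add: M e attach_def add.commute)
  finally have a: "act (t f \<otimes> c [^] i) (N h) = (j', M)" .
  have o': "(j', M) \<in> nf_set n bar" using act_nf_set[OF _ o, of "t f \<otimes> c [^] i"] a by simp
  have "wrd ?L = wrd (butlast ?L @ [(f, i)])" using L l by (metis append_butlast_last_id)
  also have "\<dots> = wrd (butlast ?L) \<otimes> (t f \<otimes> c [^] i)" by (simp add: wrd_append)
  finally have w: "wrd ?L = wrd (butlast ?L) \<otimes> (t f \<otimes> c [^] i)" .
  have "len (g \<otimes> h) = length (snd (act (wrd ?L) (N h)))"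
    by (subst k) (simp add: m_assoc h len_cpow_mult, simp add: len_def N_mult h)
  also have "act (wrd ?L) (N h) = act (wrd (butlast ?L)) (j', M)"
    by (subst w) (simp add: act_mult[OF wrd_closed] a)
  also have "length (snd \<dots>) \<le> length (butlast ?L) + length M"
    using length_act_wrd[OF o', of "butlast ?L"] by simp
  also have "\<dots> < len g + len h" using L M by (simp add: len_def)
  finally show ?thesis .
qed

text \<open>Length is additive exactly when nothing cancels, so the absence of cancellation can be
  carried over to another factorization of the same element.\<close>

lemma len_mult_imp:
  assumes "g \<in> carrier G" "h \<in> carrier G" "len g > 0" "len (g \<otimes> h) = len g + len h"
  shows "lead (g \<otimes> h) = lead g" "first (g \<otimes> h) = first g"
  using cancel[of g h] no_cancel[of g h] assms by fastforce+

lemma split_first: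
  assumes g: "g \<in> carrier G" and pos: "len g > 0"
  obtains k :: int and h where "h \<in> carrier G" "g = c [^] k \<otimes> t (first g) \<otimes> h" "k mod n = lead g"
    "len h + 1 = len g"
proof -
  obtain k :: int where k: "g = c [^] k \<otimes> wrd (snd (N g))" "k mod n = lead g"
    using decomp[OF g] by blast
  obtain e i L where L: "snd (N g) = (e, i) # L" using pos by (cases "snd (N g)") (auto simp: len_def)
  have red: "reduced n bar L" using N_nf_set[OF g] L by (auto simp: nf_set_def)
  show thesis
  proof (rule that[of "c [^] i \<otimes> wrd L" k])
    show "g = c [^] k \<otimes> t (first g) \<otimes> (c [^] i \<otimes> wrd L)"
      by (subst k(1)) (simp add: L first_def m_assoc)
    show "len (c [^] i \<otimes> wrd L) + 1 = len g"
      using L by (simp add: len_cpow_mult) (simp add: len_def N_wrd red)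
  qed (use k in simp_all)
qed

lemma center_eq: "center G = Zs"
proof
  show "Zs \<subseteq> center G" by (auto simp: center_def Zs_closed intro: Zs_central)
  show "center G \<subseteq> Zs"
  proof
    fix g assume "g \<in> center G"
    then have g: "g \<in> carrier G" and comm: "\<And>h. h \<in> carrier G \<Longrightarrow> g \<otimes> h = h \<otimes> g"
      by (auto simp: center_def)
    have "len g = 0"
    proof (rule ccontr)
      assume "len g \<noteq> 0"
      \<comment> \<open>Right multiplication by \<open>c\<close> leaves the leading exponent of an
        element with letters alone, whereas left multiplication raises it by 1.\<close>
      have "\<not> cancels g c" using len_cpow[of 1] by (simp add: cancels_def)
      then have "lead (g \<otimes> c) = lead g" using no_cancel(2)[OF g c_closed] \<open>len g \<noteq> 0\<close> by simp
      also have "g \<otimes> c = c [^] (1::int) \<otimes> g" using comm[OF c_closed] by simp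
      also have "lead \<dots> = (1 + lead g) mod n" by (rule lead_cpow_mult[OF g])
      finally have "(1 + lead g) mod n = lead g" .
      then have "(1 + lead g) mod n = lead g mod n" by (simp add: lead_mod[OF g])
      then have "n dvd 1" by (simp add: mod_eq_dvd_iff)
      then show False using n_ge by (simp add: zdvd_not_zless)
    qed
    with g obtain k :: int where k: "g = c [^] k" "k mod n = lead g" by (rule len_0_cpow)
    \<comment> \<open>A letter put in front of a power of \<open>c\<close> hides the exponent;
      \<open>undefined\<close> merely names some letter.\<close>
    have "\<not> cancels (t undefined) g" using \<open>len g = 0\<close> by (simp add: cancels_def)
    then have "lead (t undefined \<otimes> g) = 0" using no_cancel(2)[of "t undefined" g] g by (simp add: len_t lead_t)
    moreover have "lead (g \<otimes> t undefined) = k mod n" unfolding k(1) by (simp add: lead_cpow_mult lead_t)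
    ultimately have "k mod n = 0" using comm[OF t_closed] by metis
    then show "g \<in> Zs" unfolding k(1) by (rule cpow_Zs)
  qed
qed

lemma conj_pow:
  assumes "g \<in> carrier G" "w \<in> carrier G"
  shows "(inv w \<otimes> g \<otimes> w) [^] (p::nat) = inv w \<otimes> g [^] p \<otimes> w"
proof (induction p)
  case (Suc p)
  have "w \<otimes> (inv w \<otimes> (g \<otimes> w)) = g \<otimes> w" using assms by (simp add: m_assoc[symmetric])
  with Suc assms show ?case by (simp add: m_assoc)
qed (use assms in simp)

text \<open>Conjugation shortens \<open>g\<close> until either no letters cancel in its powers or at most one letter is left.\<close>

lemma torsion:
  assumes "g \<in> carrier G" "g [^] (p::nat) \<in> Zs" "p > 0"
  obtains (c) h k where "h \<in> carrier G" "g = h \<otimes> c [^] (k::int) \<otimes> inv h"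
  | (t) h k e where "h \<in> carrier G" "bar e = e" "g = h \<otimes> (t e \<otimes> c [^] (n * k)) \<otimes> inv h"
proof -
  have "(\<exists>h k. h \<in> carrier G \<and> g = h \<otimes> c [^] (k::int) \<otimes> inv h) \<or>
    (\<exists>h k e. h \<in> carrier G \<and> bar e = e \<and> g = h \<otimes> (t e \<otimes> c [^] (n * k)) \<otimes> inv h)"
    using assms
  proof (induction "len g" arbitrary: g rule: less_induct)
    case less
    note g = \<open>g \<in> carrier G\<close>
    show ?case
    proof (cases "len g = 0")
      case True
      with g obtain k :: int where "g = c [^] k" by (rule len_0_cpow)
      then have "g = \<one> \<otimes> c [^] k \<otimes> inv \<one>" by simp
      then show ?thesis by blast
    next
      case False
      \<comment> \<open>Otherwise all positive powers of \<open>g\<close> contain letters, whereas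
        elements of \<open>Zs\<close> contain none.\<close>
      have st: "cancels g g"
      proof (rule ccontr)
        assume nc: "\<not> cancels g g"
        have "len (g [^] Suc q) = Suc q * len g \<and> lead (g [^] Suc q) = lead g \<and> first (g [^] Suc q) = first g" for q
        proof (induction q)
          case (Suc q)
          have "g [^] Suc (Suc q) = g \<otimes> g [^] Suc q" by (rule nat_pow_Suc2[OF g])
          moreover have "\<not> cancels g (g [^] Suc q)" using nc Suc False by (auto simp: cancels_def)
          ultimately show ?case using no_cancel[OF g nat_pow_closed[OF g], of "Suc q"] False Suc by simp
        qed (use g in simp)
        from this[of "p - 1"] less(3,4) False have "len (g [^] p) > 0" by simp
        with len_Zs[OF less(3)] show False by simp
      qed
      from False have pos: "len g > 0" by simp
      from g pos obtain k :: int and h where h: "h \<in> carrier G" "g = c [^] k \<otimes> t (first g) \<otimes> h" "k mod n = lead g"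
        "len h + 1 = len g" by (rule split_first)
      define e where "e = first g"
      \<comment> \<open>\<open>w\<close> is the beginning of \<open>g\<close> up to its first
        letter; conjugation by it turns \<open>w \<otimes> h\<close> into
        \<open>h \<otimes> w\<close>.\<close>
      define w where "w = c [^] k \<otimes> t e"
      have w: "w \<in> carrier G" by (simp add: w_def)
      have gw: "g = w \<otimes> h" unfolding w_def e_def by (rule h(2))
      have Nw: "len w = 1" "lead w = lead g" "first w = first g"
        using h(3) by (simp_all add: w_def len_cpow_mult lead_cpow_mult first_cpow_mult len_t lead_t first_t e_def)
      have conj: "inv w \<otimes> g \<otimes> w = h \<otimes> w" unfolding gw using w h(1) by (simp add: m_assoc[symmetric])
      have conj_back: "g = w \<otimes> y \<otimes> inv w" if "h \<otimes> w = y" "y \<in> carrier G" for y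
        using that w h(1) g unfolding gw by (simp add: m_assoc that(1)[symmetric])
      show ?thesis
      proof (cases "len h = 0")
        case True
        with h(1) obtain l :: int where l: "h = c [^] l" by (rule len_0_cpow)
        \<comment> \<open>Here \<open>g\<close> is one letter between \<open>c [^] k\<close> and
          \<open>c [^] l\<close>. It cancels with itself, so \<open>inv g\<close> begins like
          \<open>g\<close>: hence \<open>n\<close> divides \<open>l + k\<close> and the letter is
          its own \<open>bar\<close>.\<close>
        have inv: "inv g = c [^] (- l) \<otimes> (inv (t e) \<otimes> c [^] (- k))"
          unfolding gw w_def l by (simp add: inv_mult_group int_pow_neg m_assoc)
        have nc: "\<not> cancels (inv (t e)) (c [^] (- k))" by (simp add: cancels_def len_cpow)
        have pi: "0 < len (inv (t e))" by (simp add: len_def N_inv_t)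
        have "lead (inv g) = - l mod n" "first (inv g) = bar e"
          unfolding inv using no_cancel[OF _ _ pi nc]
          by (simp_all add: lead_cpow_mult first_cpow_mult) (simp_all add: lead_def first_def N_inv_t)
        with st h(3) have "- l mod n = k mod n" "bar e = e" by (auto simp: cancels_def e_def)
        then have "(l + k) mod n = 0" by (metis add.commute add.right_inverse mod_0 mod_add_right_eq)
        then obtain q where q: "l + k = n * q" by (metis mod_0_imp_dvd dvdE)
        have "g = c [^] k \<otimes> (t e \<otimes> (c [^] (l + k) \<otimes> c [^] (- k)))"
          unfolding gw w_def l by (simp add: m_assoc cpow_mult)
        also have "\<dots> = c [^] k \<otimes> (t e \<otimes> c [^] (n * q)) \<otimes> inv (c [^] k)"
          unfolding q by (simp add: m_assoc int_pow_neg)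
        finally show ?thesis using \<open>bar e = e\<close> cpow_closed by blast
      next
        case False
        \<comment> \<open>Lengths add in this factorization, so \<open>inv g\<close> begins like
          \<open>inv h\<close>, and the cancellation of \<open>g\<close> with itself becomes one of
          \<open>h\<close> with \<open>w\<close>.\<close>
        have "inv g = inv h \<otimes> inv w" using w h(1) by (simp add: gw inv_mult_group)
        then have "len (inv h \<otimes> inv w) = len g" using len_inv[OF g] by simp
        then have "lead (inv g) = lead (inv h)" "first (inv g) = first (inv h)"
          using len_mult_imp[of "inv h" "inv w"] \<open>inv g = inv h \<otimes> inv w\<close> w h(1,4) Nw(1) False
          by (simp_all add: len_inv)
        with st Nw False have "cancels h w" by (simp add: cancels_def)
        then have "len (h \<otimes> w) < len g" using cancel[OF h(1) w] h(4) Nw(1) by simp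
        moreover have "(h \<otimes> w) [^] p \<in> Zs"
          using conj_pow[OF g w, of p] less(3) Zs_central[OF less(3) w] w
          by (simp add: conj m_assoc Zs_closed)
        ultimately have "(\<exists>y k. y \<in> carrier G \<and> h \<otimes> w = y \<otimes> c [^] (k::int) \<otimes> inv y) \<or>
          (\<exists>y k e. y \<in> carrier G \<and> bar e = e \<and> h \<otimes> w = y \<otimes> (t e \<otimes> c [^] (n * k)) \<otimes> inv y)"
          using less(1)[of "h \<otimes> w"] less(4) h(1) w by simp
        moreover have "g = w \<otimes> y \<otimes> u \<otimes> inv (w \<otimes> y)"
          if "h \<otimes> w = y \<otimes> u \<otimes> inv y" "y \<in> carrier G" "u \<in> carrier G" for y u
          using conj_back[OF that(1)] that w by (simp add: m_assoc inv_mult_group)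
        ultimately show ?thesis using w by (metis m_closed cpow_closed t_closed)
      qed
    qed
  qed
  with c t show thesis by blast
qed

section \<open>Subgroups generated by \<open>c\<close> and one more element\<close>

text \<open>If \<open>u\<close> started with a nontrivial power of \<open>c\<close>, then no letters would cancel in \<open>x \<otimes> u\<close>; hence
  none would in \<open>u \<otimes> x\<close> either, and the two products would have different leading powers.\<close>

lemma commute_lead:
  assumes x: "x \<in> carrier G" "len x > 0" "lead x = 0" "lead (inv x) = 0"
    and u: "u \<in> carrier G" and comm: "x \<otimes> u = u \<otimes> x"
  shows "lead u = 0"
proof (rule ccontr)
  assume "lead u \<noteq> 0"
  then have "\<not> cancels x u" using x by (simp add: cancels_def)
  note xu = no_cancel[OF x(1) u x(2) this]
  show False
  proof (cases "len u = 0")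
    case True
    with u obtain k :: int where "u = c [^] k" "k mod n = lead u" by (rule len_0_cpow)
    then have "lead (u \<otimes> x) = lead u" using x by (simp add: lead_cpow_mult)
    with xu(2) comm x(3) \<open>lead u \<noteq> 0\<close> show False by simp
  next
    case False
    then have "lead (u \<otimes> x) = lead u" using len_mult_imp(1)[OF u x(1)] xu(1) comm by simp
    with xu(2) comm x(3) \<open>lead u \<noteq> 0\<close> show False by simp
  qed
qed

text \<open>Powers of \<open>x\<close> commute with \<open>x\<close>, so \<open>commute_lead\<close>
  settles both ends without computing their normal forms.\<close>

lemma pow_lead:
  assumes x: "x \<in> carrier G" "len x > 0" "lead x = 0" "lead (inv x) = 0" and nt: "x [^] (p::int) \<notin> Zs"
  shows "lead (x [^] p) = 0" "lead (inv (x [^] p)) = 0" "len (x [^] p) > 0"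
proof -
  have comm: "x \<otimes> x [^] (q::int) = x [^] q \<otimes> x" for q
    using int_pow_mult[OF x(1), of 1 q] int_pow_mult[OF x(1), of q 1] x(1) by (simp add: add.commute)
  show 1: "lead (x [^] p) = 0" using commute_lead[OF x _ comm] x(1) by simp
  show "lead (inv (x [^] p)) = 0"
    using commute_lead[OF x _ comm[of "- p"]] x(1) by (simp add: int_pow_neg)
  show "len (x [^] p) > 0" using len_0_lead_0_Zs[OF _ _ 1] nt x(1) by auto
qed

text \<open>\<open>r\<close> counts the powers of \<open>x\<close> in an alternating product of powers of \<open>c\<close> and of \<open>x\<close>.\<close>

inductive syl :: "'a \<Rightarrow> nat \<Rightarrow> 'a \<Rightarrow> bool" for x where
  zero: "syl x 0 (c [^] (a::int))"
| suc: "syl x r g \<Longrightarrow> x [^] (p::int) \<notin> Zs \<Longrightarrow> r = 0 \<or> lead g \<noteq> 0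
    \<Longrightarrow> syl x (Suc r) (c [^] (a::int) \<otimes> (x [^] p \<otimes> g))"

text \<open>By \<open>pow_lead\<close> each noncentral power of \<open>x\<close> has a letter and
  begins and ends with exponent 0. The nonzero exponents of \<open>c\<close> in between prevent
  cancellation, so each syllable contributes at least one letter.\<close>

lemma syl_len:
  assumes x: "x \<in> carrier G" "len x > 0" "lead x = 0" "lead (inv x) = 0" and "syl x r g"
  shows "g \<in> carrier G \<and> r \<le> len g \<and> (r = 0 \<longrightarrow> len g = 0)"
  using assms(5)
proof induction
  case (suc r g p a)
  note p = pow_lead[OF x suc(2)]
  have "\<not> cancels (x [^] p) g" using suc p by (auto simp: cancels_def)
  then have "len (x [^] p \<otimes> g) = len (x [^] p) + len g" using suc p x(1) by (intro no_cancel) simp_all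
  with suc p x(1) show ?case by (simp add: len_cpow_mult)
qed (simp add: len_cpow)

lemma syl_cpow_mult:
  assumes x: "x \<in> carrier G" and "syl x r g" "g \<in> carrier G"
  shows "syl x r (c [^] (b::int) \<otimes> g)"
  using assms(2)
proof cases
  case (zero a)
  then show ?thesis using syl.zero[of x "b + a"] by (simp add: cpow_mult)
next
  case (suc r' g' p a)
  have "g' \<in> carrier G" using suc(3)
    by (induction rule: syl.induct) (use x in auto)
  then show ?thesis using syl.suc[OF suc(3-5), of "b + a"] x suc by (simp add: cpow_mult_assoc)
qed

text \<open>The new power of \<open>x\<close> opens a syllable, is absorbed as central, or meets a
  central power of \<open>c\<close> and merges with the next power of \<open>x\<close>, which may
  then become central itself. The count can rise, stay or drop.\<close>

lemma syl_pow_mult: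
  assumes x: "x \<in> carrier G" "len x > 0" "lead x = 0" "lead (inv x) = 0" and s: "syl x r g"
  shows "\<exists>r. syl x r (x [^] (q::int) \<otimes> g)"
  using s
proof cases
  case (zero a)
  show ?thesis
  proof (cases "x [^] q \<in> Zs")
    case True
    then obtain j :: int where "x [^] q = c [^] (n * j)" by (auto simp: Zs_def)
    then show ?thesis using syl_cpow_mult[OF x(1) s, of "n * j"] syl_len[OF x s] by auto
  next
    case False
    from syl.suc[OF syl.zero[of x a] this, of 0] show ?thesis using zero x by auto
  qed
next
  case (suc r' g' p a)
  have g': "g' \<in> carrier G" using syl_len[OF x suc(3)] by simp
  have g: "g \<in> carrier G" using syl_len[OF x s] by simp
  show ?thesis
  proof (cases "x [^] q \<in> Zs")
    case True
    then obtain j :: int where "x [^] q = c [^] (n * j)" by (auto simp: Zs_def)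
    then show ?thesis using syl_cpow_mult[OF x(1) s g, of "n * j"] by auto
  next
    case q: False
    show ?thesis
    proof (cases "a mod n = 0")
      case False
      have "\<not> cancels (x [^] p) g'" using suc pow_lead[OF x suc(4)] syl_len[OF x suc(3)] by (auto simp: cancels_def)
      then have "lead g = a mod n"
        using no_cancel(2)[of "x [^] p" g'] pow_lead[OF x suc(4)] x(1) g' unfolding suc by (simp add: lead_cpow_mult)
      with syl.suc[OF s q, of 0] False x(1) g show ?thesis by auto
    next
      case True
      note z = Zs_central[OF cpow_Zs[OF True]]
      have e: "x [^] q \<otimes> g = c [^] a \<otimes> (x [^] (q + p) \<otimes> g')"
        unfolding suc using x(1) g' z[of "x [^] q"]
        by (simp add: int_pow_mult m_assoc[symmetric])
      show ?thesis
      proof (cases "x [^] (q + p) \<in> Zs")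
        case True
        then obtain j :: int where "x [^] (q + p) = c [^] (n * j)" by (auto simp: Zs_def)
        then show ?thesis
          unfolding e using syl_cpow_mult[OF x(1) suc(3) g', of "a + n * j"] g' by (auto simp: cpow_mult_assoc)
      next
        case False
        then show ?thesis unfolding e using syl.suc[OF suc(3) False suc(5), of a] by blast
      qed
    qed
  qed
qed

text \<open>A letter has length 1, so by \<open>syl_len\<close> its expression contains exactly one
  power of \<open>x\<close>. The powers of \<open>c\<close> around it are central because a letter
  and its inverse both have leading exponent 0.\<close>

lemma letter_generated_normalized:
  assumes x: "x \<in> carrier G" "len x > 0" "lead x = 0" "lead (inv x) = 0"
    and t: "t e \<in> generate G {c, x}"
  obtains p j :: int where "t e = x [^] p \<otimes> c [^] (n * j)"
proof -
  have "\<exists>r. syl x r (t e)"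
    using t
  proof (rule generate_left_induct)
    show "\<exists>r. syl x r \<one>" using syl.zero[of x 0] by auto
    fix s g assume s: "s \<in> {c, x}" and g: "g \<in> carrier G" "\<exists>r. syl x r g"
    have i: "inv c = c [^] (- 1::int)" "inv x = x [^] (- 1::int)" using x(1) by (simp_all add: int_pow_neg)
    from g(2) obtain r where r: "syl x r g" ..
    show "\<exists>r. syl x r (s \<otimes> g)" "\<exists>r. syl x r (inv s \<otimes> g)"
      using s syl_cpow_mult[OF x(1) r g(1), of 1] syl_cpow_mult[OF x(1) r g(1), of "- 1"]
        syl_pow_mult[OF x r, of 1] syl_pow_mult[OF x r, of "- 1"] x(1)
      by (auto simp: i simp del: int_pow_neg)
  qed (use x in simp)
  then obtain r where r: "syl x r (t e)" ..
  have "r \<le> 1" "r \<noteq> 0" using syl_len[OF x r] by (auto simp: len_t)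
  then have "syl x (Suc 0) (t e)" using r by (metis One_nat_def le_0_eq le_SucE)
  then obtain a p g where s: "t e = c [^] (a::int) \<otimes> (x [^] (p::int) \<otimes> g)" "syl x 0 g" "x [^] p \<notin> Zs"
    by cases auto
  from s(2) obtain b where b: "g = c [^] (b::int)" by cases auto
  note p = pow_lead[OF x s(3)]
  have nc: "\<not> cancels (x [^] p) (c [^] b)" "\<not> cancels (inv (x [^] p)) (c [^] (- a))"
    by (simp_all add: cancels_def len_cpow)
  have "lead (t e) = a mod n"
    using no_cancel(2)[OF _ _ _ nc(1)] p x(1) unfolding s(1) b by (simp add: lead_cpow_mult)
  then have a: "a mod n = 0" by (simp add: lead_t)
  have "inv (t e) = c [^] (- b) \<otimes> (inv (x [^] p) \<otimes> c [^] (- a))"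
    using x(1) unfolding s(1) b by (simp add: inv_mult_group int_pow_neg m_assoc)
  then have "lead (inv (t e)) = - b mod n"
    using no_cancel(2)[OF _ _ _ nc(2)] p x(1) by (simp add: lead_cpow_mult len_inv)
  then have "- b mod n = 0" by (simp add: lead_def N_inv_t)
  with a have "(a + b) mod n = 0" by (auto simp: dvd_eq_mod_eq_0[symmetric])
  then obtain j where j: "a + b = n * j" by (metis mod_0_imp_dvd dvdE)
  have "t e = x [^] p \<otimes> c [^] (a + b)"
    using x(1) Zs_central[OF cpow_Zs[OF a], of "x [^] p"] unfolding s(1) b
    by (simp add: m_assoc[symmetric] int_pow_mult)
  with j that show thesis by simp
qed

text \<open>Powers of \<open>c\<close> at the two ends of \<open>w\<close> can be stripped, as
  \<open>w\<close> stays in the subgroup generated by \<open>c\<close> and the rest; this reduces to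
  the normalized case.\<close>

lemma letter_generated:
  assumes w: "w \<in> carrier G" and t: "t e \<in> generate G {c, w}"
  obtains a b p j :: int and x where "w = c [^] a \<otimes> x \<otimes> c [^] b" "x \<in> carrier G"
    "len x > 0" "lead x = 0" "lead (inv x) = 0" "t e = x [^] p \<otimes> c [^] (n * j)"
proof -
  have pos: "len w > 0"
  proof (rule ccontr)
    assume "\<not> len w > 0"
    then obtain k :: int where k: "w = c [^] k" using len_0_cpow[OF w] by blast
    have "\<exists>i::int. t e = c [^] i"
      using t
    proof (rule generate_left_induct)
      show "\<exists>i::int. \<one> = c [^] i" by (rule exI[of _ 0]) simp
      fix s g assume s: "s \<in> {c, w}" and g: "\<exists>i::int. g = c [^] i"
      have "\<exists>j::int. s = c [^] j" using s k c_eq_cpow by blast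
      then obtain i j :: int where ij: "g = c [^] i" "s = c [^] j" using g by blast
      then have "s \<otimes> g = c [^] (j + i)" "inv s \<otimes> g = c [^] (- j + i)"
        by (simp_all only: cpow_mult) (simp add: int_pow_neg[symmetric] cpow_mult)
      then show "\<exists>i::int. s \<otimes> g = c [^] i" "\<exists>i::int. inv s \<otimes> g = c [^] i" by blast+
    qed (use w in simp)
    then show False using len_t[of e] len_cpow by auto
  qed
  define a where "a = lead w"
  \<comment> \<open>The leading exponent of \<open>inv w\<close> is minus the last exponent of
    \<open>w\<close> modulo \<open>n\<close>, whence the sign.\<close>
  define b where "b = - lead (inv w)"
  define x where "x = c [^] (- a) \<otimes> (w \<otimes> c [^] (- b))"
  have nc: "\<not> cancels w (c [^] (- b))" "\<not> cancels (inv w) (c [^] a)" by (simp_all add: cancels_def len_cpow)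
  have x: "x \<in> carrier G" using w by (simp add: x_def)
  have w_eq: "w = c [^] a \<otimes> x \<otimes> c [^] b"
    using w by (simp add: x_def m_assoc cpow_mult cpow_mult_assoc)
  have inv_x: "inv x = c [^] b \<otimes> (inv w \<otimes> c [^] a)"
    using w by (simp add: x_def inv_mult_group int_pow_neg m_assoc)
  have l: "lead x = 0" "lead (inv x) = 0" "len x > 0"
    using no_cancel[OF _ _ _ nc(1)] no_cancel[OF _ _ _ nc(2)] pos w
    by (simp_all add: x_def[symmetric] inv_x lead_cpow_mult len_inv)
       (simp_all add: x_def lead_cpow_mult len_cpow_mult a_def b_def)
  have "{c, w} \<subseteq> generate G {c, x}"
  proof -
    have sub: "subgroup (generate G {c, x}) G" by (rule generate_is_subgroup) (use x in simp)
    interpret gx: subgroup "generate G {c, x}" G by (rule sub)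
    have "c \<in> generate G {c, x}" "x \<in> generate G {c, x}" by (auto intro: generate.incl)
    moreover have "c [^] (i::int) \<in> generate G {c, x}" for i
      by (rule subgroup_int_pow_closed[OF sub]) fact
    ultimately show ?thesis by (simp add: w_eq)
  qed
  then have "generate G {c, w} \<subseteq> generate G {c, x}"
    by (rule generate_subgroup_incl) (rule generate_is_subgroup, use x in simp)
  with t have "t e \<in> generate G {c, x}" by blast
  then obtain p j :: int where "t e = x [^] p \<otimes> c [^] (n * j)"
    by (rule letter_generated_normalized[OF x l(3,1,2)])
  with that w_eq x l show thesis by blast
qed

text \<open>If \<open>k\<close> is nonzero modulo \<open>n\<close>, it keeps the two copies of
  \<open>x\<close> apart, because \<open>inv x\<close> begins with exponent 0. The square then
  retains its letters.\<close>

lemma square_Zs: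
  assumes x: "x \<in> carrier G" "len x > 0" "lead x = 0" "lead (inv x) = 0"
    and sq: "x \<otimes> c [^] (k::int) \<otimes> (x \<otimes> c [^] k) \<in> Zs"
  shows "k mod n = 0"
proof (rule ccontr)
  assume k: "k mod n \<noteq> 0"
  let ?y = "c [^] k \<otimes> (x \<otimes> c [^] k)"
  have xk: "len (x \<otimes> c [^] k) = len x" "lead (x \<otimes> c [^] k) = 0"
    using no_cancel[of x "c [^] k"] x by (simp_all add: cancels_def len_cpow)
  have y: "?y \<in> carrier G" using x(1) by simp
  have "lead ?y \<noteq> 0" using k x(1) xk by (simp add: lead_cpow_mult)
  then have "\<not> cancels x ?y" using x(4) by (simp add: cancels_def)
  then have "len (x \<otimes> ?y) > 0" using no_cancel(1)[OF x(1) y x(2)] x(2) by simp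
  moreover have "x \<otimes> ?y \<in> Zs" using sq x(1) by (simp add: m_assoc)
  ultimately show False using len_Zs by fastforce
qed

end

section \<open>Images of \<open>c\<close> and of a letter under an automorphism\<close>

context normal_form
begin

text \<open>The \<open>n\<close>-th power of \<open>f c\<close> is central, so
  \<open>torsion\<close> applies; \<open>not_t\<close> is left as a premise because the parities
  establish it differently. The exponent \<open>v\<close> is a unit since the generator
  \<open>c [^] n\<close> of the centre has a central preimage, which gives
  \<open>v * j = 1\<close>.\<close>

lemma aut_c:
  assumes f: "f \<in> auto G" and inf: "\<And>j::int. c [^] (n * j) = \<one> \<Longrightarrow> j = 0"
    and not_t: "\<And>h k e. h \<in> carrier G \<Longrightarrow> bar e = e \<Longrightarrow> f c \<noteq> h \<otimes> (t e \<otimes> c [^] (n * k)) \<otimes> inv h"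
  obtains h and v :: int where "h \<in> carrier G" "v = 1 \<or> v = - 1" "f c = h \<otimes> c [^] v \<otimes> inv h"
proof -
  interpret f: group_hom G G f by (rule auto_group_hom[OF f])
  have zc: "c [^] n \<in> center G" unfolding center_eq by (rule cpow_Zs) simp
  have "f (c [^] n) \<in> center G" using zc auto_center_image[OF f] by blast
  moreover have fn: "f (c [^] n) = f c [^] n" by (rule f.hom_int_pow) simp
  moreover have "f c [^] n = f c [^] nat n" using n_pos int_pow_int[of G "f c" "nat n"] by simp
  ultimately have "f c [^] nat n \<in> Zs" by (simp add: center_eq)
  moreover have "nat n > 0" using n_pos by simp
  moreover have "f c \<in> carrier G" by simp
  ultimately obtain h and v :: int where h: "h \<in> carrier G" "f c = h \<otimes> c [^] v \<otimes> inv h"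
    using torsion[of "f c" "nat n"] not_t by metis
  have "c [^] n \<in> f ` center G" using zc auto_center_image[OF f] by simp
  then obtain j where j: "c [^] n = f (c [^] (n * j))" by (auto simp: center_eq Zs_def)
  have "f (c [^] (n * j)) = (h \<otimes> c [^] v \<otimes> inv h) [^] (n * j)"
    using f.hom_int_pow[of c "n * j"] h by simp
  also have "\<dots> = conj_auto G h (c [^] v) [^] (n * j)" by (simp add: conj_auto_apply)
  also have "\<dots> = conj_auto G h ((c [^] v) [^] (n * j))"
    by (rule group_hom.hom_int_pow[OF auto_group_hom[OF conj_auto_auto[OF h(1)]], symmetric]) simp
  also have "\<dots> = h \<otimes> c [^] (n * (v * j)) \<otimes> inv h"
    by (simp add: conj_auto_apply int_pow_pow mult_ac)
  also have "\<dots> = c [^] (n * (v * j))"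
    using Zs_central[of "c [^] (n * (v * j))" h] h(1) by (simp add: Zs_def m_assoc[symmetric] inv_solve_right')
  finally have "c [^] (n * (v * j - 1)) = \<one>"
    using j by (simp add: right_diff_distrib int_pow_diff)
  with inf have "v * j = 1" by fastforce
  then have "v = 1 \<or> v = - 1" by (simp add: zmult_eq_1_iff) blast
  with h that show thesis by blast
qed

lemma aut_letter:
  assumes f: "f \<in> auto G" and fc: "f c = c" and gen: "carrier G = generate G {c, t e}"
  obtains a b p j :: int and x where "f (t e) = c [^] a \<otimes> x \<otimes> c [^] b" "x \<in> carrier G"
    "len x > 0" "lead x = 0" "lead (inv x) = 0" "t e = x [^] p \<otimes> c [^] (n * j)"
proof -
  interpret f: group_hom G G f by (rule auto_group_hom[OF f])
  have "generate G (f ` {c, t e}) = f ` generate G {c, t e}"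
    by (rule f.generate_img) simp
  then have "generate G {c, f (t e)} = carrier G" using fc gen auto_image[OF f] by simp
  then have "t e \<in> generate G {c, f (t e)}" by simp
  show thesis
    by (rule letter_generated[OF f.hom_closed[OF t_closed] \<open>t e \<in> generate G {c, f (t e)}\<close>]) (rule that)
qed

end

section \<open>Homomorphisms from the Artin group\<close>

lemma artin_lift:
  assumes "group H" "x \<in> carrier H" "y \<in> carrier H"
    and "eval_word H (case_gen x y) (alt_word Alpha Beta m) = eval_word H (case_gen x y) (alt_word Beta Alpha m)"
  obtains h where "h \<in> hom (Artin m) H" "h (artin_alpha m) = x" "h (artin_beta m) = y"
proof -
  interpret group H by fact
  have r: "range (case_gen x y) \<subseteq> carrier H" using assms by (auto split: gen.splits)
  have e: "eval_word H (case_gen x y) r = eval_word H (case_gen x y) s" if "(r, s) \<in> artin_rel m" for r s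
    using that assms by (simp add: artin_rel_def)
  show thesis
    using that[of "pres_lift (artin_rel m) H (case_gen x y)"] pres_lift_hom[OF r e, of "artin_rel m"]
      pres_lift_gen[OF r e, of "artin_rel m"]
    by (simp add: Artin_def artin_alpha_def artin_beta_def)
qed

lemma artin_hom_unique:
  assumes "group H" "h \<in> hom (Artin m) H" "k \<in> hom (Artin m) H"
    and "h (artin_alpha m) = k (artin_alpha m)" "h (artin_beta m) = k (artin_beta m)"
    and "x \<in> carrier (Artin m)"
  shows "h x = k x"
proof -
  interpret group H by fact
  have "h (pres_gen (artin_rel m) g) = k (pres_gen (artin_rel m) g)" for g
    using assms by (cases g) (simp_all add: artin_pres_gen)
  then show ?thesis using assms pres_hom_unique[of h "artin_rel m" k x] by (simp add: Artin_def)
qed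

lemma artin_carrier: "carrier (Artin m) = generate (Artin m) {artin_alpha m, artin_beta m}"
proof
  interpret group "Artin m" by (rule group_Artin)
  have sg: "subgroup (generate (Artin m) {artin_alpha m, artin_beta m}) (Artin m)"
    by (rule generate_is_subgroup) simp
  have gen: "pres_gen (artin_rel m) x \<in> generate (Artin m) {artin_alpha m, artin_beta m}" for x
    by (cases x) (auto simp: artin_pres_gen intro: generate.incl)
  have "eval_word (Artin m) (pres_gen (artin_rel m)) w \<in> generate (Artin m) {artin_alpha m, artin_beta m}" for w
  proof (induction w)
    case Nil
    then show ?case by (simp add: generate.one)
  next
    case (Cons l w)
    obtain x b where "l = (x, b)" by force
    with Cons gen[of x] show ?case
      by (simp add: subgroup.m_closed[OF sg] subgroup.m_inv_closed[OF sg])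
  qed
  then show "carrier (Artin m) \<subseteq> generate (Artin m) {artin_alpha m, artin_beta m}"
    by (auto simp: Artin_def carrier_presented_group eval_word_pres_gen)
  show "generate (Artin m) {artin_alpha m, artin_beta m} \<subseteq> carrier (Artin m)"
    by (rule generate_incl) simp
qed

section \<open>Presentations on \<open>artin_c m\<close> together with \<alpha> or \<Delta>\<close>

definition artin_c :: "nat \<Rightarrow> gen word set" where
  "artin_c m = artin_alpha m \<otimes>\<^bsub>Artin m\<^esub> artin_beta m"

text \<open>For odd \<open>m\<close>, the \<open>m div 2\<close> factors \<alpha>\<beta> followed by
  \<alpha> spell w(\<alpha>,\<beta>:m), the Garside element.\<close>

definition artin_Delta :: "nat \<Rightarrow> gen word set" where
  "artin_Delta m = artin_c m [^]\<^bsub>Artin m\<^esub> (m div 2) \<otimes>\<^bsub>Artin m\<^esub> artin_alpha m"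

lemma artin_c_closed [simp]: "artin_c m \<in> carrier (Artin m)"
proof -
  interpret group "Artin m" by (rule group_Artin)
  show ?thesis by (simp add: artin_c_def)
qed

lemma artin_Delta_closed [simp]: "artin_Delta m \<in> carrier (Artin m)"
proof -
  interpret group "Artin m" by (rule group_Artin)
  show ?thesis by (simp add: artin_Delta_def)
qed

lemma (in group) eval_alt_word_odd:
  assumes "range f \<subseteq> carrier G"
  shows "eval_word G f (alt_word a b (Suc (2 * k))) = (f a \<otimes> f b) [^] k \<otimes> f a"
proof -
  have c: "f a \<in> carrier G" "f b \<in> carrier G" using assms by auto
  have "alt_word a b (Suc (2 * k)) = alt_word a b (2 * k) @ [(a, True)]" by (simp only: alt_word_snoc) simp
  with c show ?thesis by (simp add: eval_word_append[OF assms] eval_alt_word_even del: alt_word.simps)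
qed

lemma (in group) pow_swap:
  assumes "a \<in> carrier G" "b \<in> carrier G"
  shows "a \<otimes> (b \<otimes> a) [^] (k::nat) = (a \<otimes> b) [^] k \<otimes> a"
proof (induction k)
  case (Suc k)
  have "a \<otimes> (b \<otimes> a) [^] Suc k = a \<otimes> (b \<otimes> a) [^] k \<otimes> (b \<otimes> a)"
    using assms by (simp add: m_assoc)
  with Suc show ?case using assms by (simp add: m_assoc)
qed (use assms in simp)

text \<open>For \<open>m = 2 * k\<close> the defining relation reads (\<alpha>\<beta>)^k =
  (\<beta>\<alpha>)^k, and the two sides are conjugate by \<alpha>.\<close>

lemma artin_even_central:
  assumes m: "m = 2 * k"
  shows "artin_c m [^]\<^bsub>Artin m\<^esub> k \<otimes>\<^bsub>Artin m\<^esub> artin_alpha m =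
    artin_alpha m \<otimes>\<^bsub>Artin m\<^esub> artin_c m [^]\<^bsub>Artin m\<^esub> k"
proof -
  interpret group "Artin m" by (rule group_Artin)
  let ?f = "case_gen (artin_alpha m) (artin_beta m)"
  have "(artin_alpha m \<otimes>\<^bsub>Artin m\<^esub> artin_beta m) [^]\<^bsub>Artin m\<^esub> k = (artin_beta m \<otimes>\<^bsub>Artin m\<^esub> artin_alpha m) [^]\<^bsub>Artin m\<^esub> k"
    using artin_relation[of m] eval_alt_word_even[of ?f Alpha Beta k] eval_alt_word_even[of ?f Beta Alpha k]
    by (simp flip: m)
  then show ?thesis using pow_swap[of "artin_alpha m" "artin_beta m" k] by (simp add: artin_c_def)
qed

text \<open>One factor is written as w(\<alpha>,\<beta>:m), the other by the defining relation as
  w(\<beta>,\<alpha>:m); for odd \<open>m\<close> their product alternates throughout and has length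
  \<open>2 * m\<close>.\<close>

lemma artin_Delta_square:
  assumes m: "odd m"
  shows "artin_Delta m \<otimes>\<^bsub>Artin m\<^esub> artin_Delta m = artin_c m [^]\<^bsub>Artin m\<^esub> m"
proof -
  interpret group "Artin m" by (rule group_Artin)
  let ?f = "case_gen (artin_alpha m) (artin_beta m)"
  define a b k where d: "a = artin_alpha m" "b = artin_beta m" "k = m div 2"
  have ab: "a \<in> carrier (Artin m)" "b \<in> carrier (Artin m)" by (simp_all add: d)
  have mk: "m = Suc (2 * k)" using m by (simp add: d odd_two_times_div_two_succ)
  have f: "range ?f \<subseteq> carrier (Artin m)" by (auto split: gen.splits)
  have rel: "(a \<otimes>\<^bsub>Artin m\<^esub> b) [^]\<^bsub>Artin m\<^esub> k \<otimes>\<^bsub>Artin m\<^esub> a = (b \<otimes>\<^bsub>Artin m\<^esub> a) [^]\<^bsub>Artin m\<^esub> k \<otimes>\<^bsub>Artin m\<^esub> b"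
    using artin_relation[of m] eval_alt_word_odd[OF f, of Alpha Beta k, folded mk]
      eval_alt_word_odd[OF f, of Beta Alpha k, folded mk] by (simp add: d)
  let ?D = "artin_Delta m"
  have D: "?D = (a \<otimes>\<^bsub>Artin m\<^esub> b) [^]\<^bsub>Artin m\<^esub> k \<otimes>\<^bsub>Artin m\<^esub> a" by (simp add: artin_Delta_def artin_c_def d)
  have "?D \<otimes>\<^bsub>Artin m\<^esub> ?D = (a \<otimes>\<^bsub>Artin m\<^esub> b) [^]\<^bsub>Artin m\<^esub> k \<otimes>\<^bsub>Artin m\<^esub> (a \<otimes>\<^bsub>Artin m\<^esub> (b \<otimes>\<^bsub>Artin m\<^esub> a) [^]\<^bsub>Artin m\<^esub> k \<otimes>\<^bsub>Artin m\<^esub> b)"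
    by (subst (2) D, subst rel, subst D) (simp add: m_assoc ab)
  also have "\<dots> = (a \<otimes>\<^bsub>Artin m\<^esub> b) [^]\<^bsub>Artin m\<^esub> k \<otimes>\<^bsub>Artin m\<^esub> (a \<otimes>\<^bsub>Artin m\<^esub> b) [^]\<^bsub>Artin m\<^esub> Suc k"
    by (subst pow_swap) (simp_all add: ab m_assoc)
  also have "\<dots> = (a \<otimes>\<^bsub>Artin m\<^esub> b) [^]\<^bsub>Artin m\<^esub> (k + Suc k)" by (rule nat_pow_mult) (simp add: ab)
  also have "k + Suc k = m" by (simp add: mk)
  finally show ?thesis by (simp add: artin_c_def d(1,2))
qed

lemma artin_lift_even:
  assumes H: "group H" and m: "m = 2 * k" and x: "x \<in> carrier H" "y \<in> carrier H"
    and comm: "(x \<otimes>\<^bsub>H\<^esub> y) [^]\<^bsub>H\<^esub> k = (y \<otimes>\<^bsub>H\<^esub> x) [^]\<^bsub>H\<^esub> k"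
  obtains h where "h \<in> hom (Artin m) H" "h (artin_alpha m) = x" "h (artin_beta m) = y"
proof -
  interpret group H by fact
  show thesis
    by (rule artin_lift[OF H x, of m])
       (use that x comm eval_alt_word_even[of "case_gen x y" Alpha Beta k]
          eval_alt_word_even[of "case_gen x y" Beta Alpha k] in \<open>simp_all add: m\<close>)
qed

text \<open>Universal property for the generators \<alpha> and \<open>artin_c m\<close>; with
  \<open>artin_even_central\<close> it replaces the defining relation by a single
  commutation.\<close>

lemma artin_lift_even_c:
  assumes H: "group H" and m: "m = 2 * k" and x: "x \<in> carrier H" "y \<in> carrier H"
    and comm: "y [^]\<^bsub>H\<^esub> k \<otimes>\<^bsub>H\<^esub> x = x \<otimes>\<^bsub>H\<^esub> y [^]\<^bsub>H\<^esub> k"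
  obtains h where "h \<in> hom (Artin m) H" "h (artin_alpha m) = x" "h (artin_c m) = y"
proof -
  interpret group H by fact
  let ?b = "inv\<^bsub>H\<^esub> x \<otimes>\<^bsub>H\<^esub> y"
  have ab: "x \<otimes>\<^bsub>H\<^esub> ?b = y" using x by simp
  have "x \<otimes>\<^bsub>H\<^esub> (?b \<otimes>\<^bsub>H\<^esub> x) [^]\<^bsub>H\<^esub> k = x \<otimes>\<^bsub>H\<^esub> y [^]\<^bsub>H\<^esub> k"
    using x comm by (simp only: pow_swap m_closed inv_closed ab)
  then have "(x \<otimes>\<^bsub>H\<^esub> ?b) [^]\<^bsub>H\<^esub> k = (?b \<otimes>\<^bsub>H\<^esub> x) [^]\<^bsub>H\<^esub> k"
    unfolding ab using x by simp
  moreover have "?b \<in> carrier H" using x by simp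
  ultimately obtain h where h: "h \<in> hom (Artin m) H" "h (artin_alpha m) = x" "h (artin_beta m) = ?b"
    using artin_lift_even[OF H m x(1), of ?b] by metis
  then have "h (artin_c m) = y" using ab by (simp add: artin_c_def hom_mult)
  with h that show thesis by blast
qed

text \<open>The counterpart for odd \<open>m\<close>. The images of \<alpha> and \<beta> come from
  solving \<Delta> = c^k \<alpha> and c = \<alpha>\<beta>.\<close>

lemma artin_lift_odd_c:
  assumes H: "group H" and m: "odd m" and x: "x \<in> carrier H" "y \<in> carrier H"
    and sq: "x \<otimes>\<^bsub>H\<^esub> x = y [^]\<^bsub>H\<^esub> m"
  obtains h where "h \<in> hom (Artin m) H" "h (artin_Delta m) = x" "h (artin_c m) = y"
proof -
  interpret group H by fact
  interpret A: group "Artin m" by (rule group_Artin)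
  define k where "k = m div 2"
  have mk: "m = Suc (2 * k)" using m by (simp add: k_def odd_two_times_div_two_succ)
  define a where "a = inv\<^bsub>H\<^esub> (y [^]\<^bsub>H\<^esub> k) \<otimes>\<^bsub>H\<^esub> x"
  define b where "b = inv\<^bsub>H\<^esub> a \<otimes>\<^bsub>H\<^esub> y"
  have c: "a \<in> carrier H" "b \<in> carrier H" using x by (simp_all add: a_def b_def)
  have ab: "a \<otimes>\<^bsub>H\<^esub> b = y" using c x by (simp add: b_def)
  have xa: "y [^]\<^bsub>H\<^esub> k \<otimes>\<^bsub>H\<^esub> a = x" using x by (simp add: a_def)
  \<comment> \<open>The value of w(\<beta>,\<alpha>:m) multiplied by \<open>x\<close> is
    \<open>y\<close> to the power \<open>m\<close>, that is, \<open>x\<close> squared; cancelling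
    \<open>x\<close> yields the relation.\<close>
  have "x \<otimes>\<^bsub>H\<^esub> ((b \<otimes>\<^bsub>H\<^esub> a) [^]\<^bsub>H\<^esub> k \<otimes>\<^bsub>H\<^esub> b) = y [^]\<^bsub>H\<^esub> k \<otimes>\<^bsub>H\<^esub> (a \<otimes>\<^bsub>H\<^esub> (b \<otimes>\<^bsub>H\<^esub> a) [^]\<^bsub>H\<^esub> k \<otimes>\<^bsub>H\<^esub> b)"
    using c x by (simp add: xa[symmetric] m_assoc)
  also have "\<dots> = y [^]\<^bsub>H\<^esub> k \<otimes>\<^bsub>H\<^esub> y [^]\<^bsub>H\<^esub> Suc k"
    using c x by (simp add: pow_swap ab) (simp add: m_assoc ab)
  also have "\<dots> = y [^]\<^bsub>H\<^esub> (k + Suc k)" by (rule nat_pow_mult[OF x(2)])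
  also have "k + Suc k = m" by (simp add: mk)
  finally have "x \<otimes>\<^bsub>H\<^esub> ((b \<otimes>\<^bsub>H\<^esub> a) [^]\<^bsub>H\<^esub> k \<otimes>\<^bsub>H\<^esub> b) = x \<otimes>\<^bsub>H\<^esub> x" using sq by simp
  then have ba: "(b \<otimes>\<^bsub>H\<^esub> a) [^]\<^bsub>H\<^esub> k \<otimes>\<^bsub>H\<^esub> b = x" using c x by simp
  have r: "range (case_gen a b) \<subseteq> carrier H" using c by (auto split: gen.splits)
  have "eval_word H (case_gen a b) (alt_word Alpha Beta m) = eval_word H (case_gen a b) (alt_word Beta Alpha m)"
    unfolding mk eval_alt_word_odd[OF r] by (simp add: ab xa ba)
  with H c obtain h where h: "h \<in> hom (Artin m) H" "h (artin_alpha m) = a" "h (artin_beta m) = b"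
    by (rule artin_lift)
  interpret h: group_hom "Artin m" H h by unfold_locales (rule h)
  have hc: "h (artin_c m) = y" using h ab by (simp add: artin_c_def)
  moreover have "h (artin_Delta m) = x"
    using h hc xa by (simp add: artin_Delta_def h.hom_nat_pow k_def)
  ultimately show thesis using that h by blast
qed

section \<open>Normal forms in the Artin group\<close>

text \<open>\<open>attach bar e\<close> is invertible only on reduced words, so these maps are extended by the identity.\<close>

definition perm_c :: "int \<Rightarrow> ('e \<Rightarrow> 'e) \<Rightarrow> 'e nf \<Rightarrow> 'e nf" where
  "perm_c n bar = (\<lambda>\<omega>. if \<omega> \<in> nf_set n bar then shift n 1 \<omega> else \<omega>)"

definition perm_t :: "int \<Rightarrow> ('e \<Rightarrow> 'e) \<Rightarrow> 'e \<Rightarrow> 'e nf \<Rightarrow> 'e nf" where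
  "perm_t n bar e = (\<lambda>\<omega>. if \<omega> \<in> nf_set n bar then attach bar e \<omega> else \<omega>)"

text \<open>Over the whole type the extensionality in \<open>BijGroup\<close> is void, so products
  are plain compositions.\<close>

lemma BijGroup_UNIV:
  "carrier (BijGroup UNIV) = {f. bij f}" "\<one>\<^bsub>BijGroup UNIV\<^esub> = id"
  "bij f \<Longrightarrow> bij g \<Longrightarrow> f \<otimes>\<^bsub>BijGroup UNIV\<^esub> g = f \<circ> g"
  by (auto simp: BijGroup_def Bij_def extensional_def compose_def fun_eq_iff)

lemma BijGroup_UNIV_pow: "bij f \<Longrightarrow> f [^]\<^bsub>BijGroup UNIV\<^esub> (k::nat) = f ^^ k"
proof (induction k)
  case (Suc k)
  interpret group "BijGroup UNIV" by (rule group_BijGroup)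
  show ?case using Suc bij_fn[of f k] by (simp add: BijGroup_UNIV funpow_Suc_right del: funpow.simps)
qed (simp add: BijGroup_UNIV)

lemma perm_t_perm_t:
  assumes "n > 0" "\<And>e. bar (bar e) = e"
  shows "perm_t n bar e (perm_t n bar (bar e) \<omega>) = \<omega>"
  using assms attach_bar[of \<omega> n bar e] by (auto simp: perm_t_def attach_nf_set)

lemma bij_perm_t:
  assumes "n > 0" "\<And>e. bar (bar e) = e"
  shows "bij (perm_t n bar e)"
  using perm_t_perm_t[OF assms, of e] perm_t_perm_t[OF assms, of "bar e"] assms(2)
  by (intro o_bij[of "perm_t n bar (bar e)"]) (auto simp: fun_eq_iff)

lemma perm_c_funpow:
  assumes "n > 0"
  shows "(perm_c n bar ^^ k) \<omega> = (if \<omega> \<in> nf_set n bar then shift n (int k) \<omega> else \<omega>)"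
proof (induction k)
  case 0
  show ?case using shift_multiple[of \<omega> n bar 0] by simp
next
  case (Suc k)
  then show ?case using assms by (simp add: perm_c_def shift_nf_set shift_shift)
qed

lemma perm_c_funpow_n: "n > 0 \<Longrightarrow> perm_c n bar ^^ nat n = id"
proof (rule ext)
  fix \<omega> assume "n > 0"
  then show "(perm_c n bar ^^ nat n) \<omega> = id \<omega>"
    using shift_multiple[of \<omega> n bar 1] by (simp add: perm_c_funpow)
qed

lemma bij_perm_c:
  assumes "n > 0"
  shows "bij (perm_c n bar)"
proof (rule o_bij[of "perm_c n bar ^^ (nat n - 1)"])
  have "Suc (nat n - 1) = nat n" using assms by simp
  then show "perm_c n bar \<circ> perm_c n bar ^^ (nat n - 1) = id" "perm_c n bar ^^ (nat n - 1) \<circ> perm_c n bar = id"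
    using perm_c_funpow_n[OF assms, of bar] funpow.simps(2)[of "nat n - 1" "perm_c n bar"]
      funpow_Suc_right[of "nat n - 1" "perm_c n bar"] by simp_all
qed

lemma normal_form_hom:
  assumes "group G" "n \<ge> 2" "\<And>e. bar (bar e) = e" and h: "h \<in> hom G (BijGroup UNIV)"
    and "c \<in> carrier G" "\<And>e. t e \<in> carrier G" "h c = perm_c n bar" "\<And>e. h (t e) = perm_t n bar e"
    and "\<And>e. c [^]\<^bsub>G\<^esub> n \<otimes>\<^bsub>G\<^esub> t e = t e \<otimes>\<^bsub>G\<^esub> c [^]\<^bsub>G\<^esub> n"
    and "\<And>e. \<exists>j::int. t e \<otimes>\<^bsub>G\<^esub> t (bar e) = c [^]\<^bsub>G\<^esub> (n * j)"
    and "carrier G = generate G (insert c (range t))"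
  shows "normal_form G c n t bar h"
proof -
  interpret group G by fact
  interpret h: group_hom G "BijGroup UNIV" h
    using h group_BijGroup[of UNIV] by (simp add: group_hom_def group_hom_axioms_def is_group)
  have bij: "bij (h g)" if "g \<in> carrier G" for g using h.hom_closed[OF that] by (simp add: BijGroup_UNIV)
  show ?thesis
  proof
    fix g k \<omega> assume "g \<in> carrier G" "k \<in> carrier G"
    then show "h (g \<otimes>\<^bsub>G\<^esub> k) \<omega> = h g (h k \<omega>)" by (simp add: BijGroup_UNIV bij)
  next
    show "h \<one>\<^bsub>G\<^esub> \<omega> = \<omega>" for \<omega> by (simp add: BijGroup_UNIV)
  qed (use assms in \<open>simp_all add: perm_c_def perm_t_def\<close>)
qed


lemma generate_superset:
  assumes "group G" "S \<subseteq> carrier G" "U \<subseteq> generate G S"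
  shows "generate G U \<subseteq> generate G S"
  using assms group.generate_subgroup_incl group.generate_is_subgroup by metis

lemma artin_even_generated: "carrier (Artin m) = generate (Artin m) {artin_c m, artin_alpha m}"
proof -
  interpret group "Artin m" by (rule group_Artin)
  have sg: "subgroup (generate (Artin m) {artin_c m, artin_alpha m}) (Artin m)"
    by (rule generate_is_subgroup) simp
  have a: "artin_c m \<in> generate (Artin m) {artin_c m, artin_alpha m}"
    "artin_alpha m \<in> generate (Artin m) {artin_c m, artin_alpha m}" by (auto intro: generate.incl)
  have "artin_beta m = inv\<^bsub>Artin m\<^esub> artin_alpha m \<otimes>\<^bsub>Artin m\<^esub> artin_c m"
    by (simp add: artin_c_def)
  then have "artin_beta m \<in> generate (Artin m) {artin_c m, artin_alpha m}"
    using subgroup.m_closed[OF sg subgroup.m_inv_closed[OF sg a(2)] a(1)] by simp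
  with a have "generate (Artin m) {artin_alpha m, artin_beta m} \<subseteq> generate (Artin m) {artin_c m, artin_alpha m}"
    by (intro generate_superset[OF group_Artin]) simp_all
  moreover have "generate (Artin m) {artin_c m, artin_alpha m} \<subseteq> carrier (Artin m)"
    by (rule generate_incl) simp
  ultimately show ?thesis unfolding artin_carrier[symmetric] by blast
qed

lemma artin_odd_generated: "carrier (Artin m) = generate (Artin m) {artin_c m, artin_Delta m}"
proof -
  interpret group "Artin m" by (rule group_Artin)
  have sg: "subgroup (generate (Artin m) {artin_c m, artin_Delta m}) (Artin m)"
    by (rule generate_is_subgroup) simp
  have a: "artin_c m \<in> generate (Artin m) {artin_c m, artin_Delta m}"
    "artin_Delta m \<in> generate (Artin m) {artin_c m, artin_Delta m}" by (auto intro: generate.incl)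
  have "artin_alpha m = artin_c m [^]\<^bsub>Artin m\<^esub> (- int (m div 2)) \<otimes>\<^bsub>Artin m\<^esub> artin_Delta m"
    by (simp add: artin_Delta_def int_pow_neg_int)
  then have "artin_alpha m \<in> generate (Artin m) {artin_c m, artin_Delta m}"
    using subgroup.m_closed[OF sg subgroup_int_pow_closed[OF sg a(1)] a(2)] by simp
  with a have "generate (Artin m) {artin_c m, artin_alpha m} \<subseteq> generate (Artin m) {artin_c m, artin_Delta m}"
    by (intro generate_superset[OF group_Artin]) simp_all
  moreover have "generate (Artin m) {artin_c m, artin_Delta m} \<subseteq> carrier (Artin m)"
    by (rule generate_incl) simp
  ultimately show ?thesis unfolding artin_even_generated[symmetric] by blast
qed

text \<open>Letters are indexed by their sign, so that \<open>bar = Not\<close> is exact inversion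
  and no letter index is fixed by it.\<close>

definition even_t :: "nat \<Rightarrow> bool \<Rightarrow> gen word set" where
  "even_t m e = (if e then artin_alpha m else inv\<^bsub>Artin m\<^esub> artin_alpha m)"

lemma normal_form_even:
  assumes m: "m = 2 * k" and k: "k \<ge> 2"
  obtains act where "normal_form (Artin m) (artin_c m) (int k) (even_t m) Not act"
proof -
  interpret A: group "Artin m" by (rule group_Artin)
  interpret B: group "BijGroup (UNIV :: bool nf set)" by (rule group_BijGroup)
  let ?n = "int k"
  have n: "?n > 0" using k by simp
  let ?C = "perm_c ?n Not" and ?T = "perm_t ?n Not"
  have bij: "bij ?C" "bij (?T e)" for e using n by (auto intro: bij_perm_c bij_perm_t)
  \<comment> \<open>The commutation to be checked is trivial, since the \<open>k\<close>-th power of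
    \<open>?C\<close> is already the identity.\<close>
  have "?C [^]\<^bsub>BijGroup UNIV\<^esub> k = \<one>\<^bsub>BijGroup UNIV\<^esub>"
    using perm_c_funpow_n[OF n, of Not] by (simp add: BijGroup_UNIV_pow[OF bij(1)] BijGroup_UNIV)
  then have "?C [^]\<^bsub>BijGroup UNIV\<^esub> k \<otimes>\<^bsub>BijGroup UNIV\<^esub> ?T True = ?T True \<otimes>\<^bsub>BijGroup UNIV\<^esub> ?C [^]\<^bsub>BijGroup UNIV\<^esub> k"
    using bij by (simp add: BijGroup_UNIV(1))
  then obtain h where h: "h \<in> hom (Artin m) (BijGroup (UNIV :: bool nf set))"
    "h (artin_alpha m) = ?T True" "h (artin_c m) = ?C"
    using artin_lift_even_c[OF group_BijGroup m, of "?T True" UNIV ?C] bij by (auto simp: BijGroup_UNIV(1))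
  interpret h: group_hom "Artin m" "BijGroup (UNIV :: bool nf set)" h by unfold_locales (rule h)
  have "?T False \<otimes>\<^bsub>BijGroup UNIV\<^esub> ?T True = \<one>\<^bsub>BijGroup UNIV\<^esub>"
    using perm_t_perm_t[OF n, of Not False] by (simp add: BijGroup_UNIV bij fun_eq_iff)
  then have "inv\<^bsub>BijGroup UNIV\<^esub> ?T True = ?T False"
    by (rule B.inv_equality) (simp_all add: BijGroup_UNIV bij)
  then have ht: "h (even_t m e) = ?T e" for e using h by (cases e) (simp_all add: even_t_def)
  have z: "artin_c m [^]\<^bsub>Artin m\<^esub> ?n \<otimes>\<^bsub>Artin m\<^esub> artin_alpha m = artin_alpha m \<otimes>\<^bsub>Artin m\<^esub> artin_c m [^]\<^bsub>Artin m\<^esub> ?n"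
    using artin_even_central[OF m] by (simp add: int_pow_int)
  then have z': "artin_c m [^]\<^bsub>Artin m\<^esub> ?n \<otimes>\<^bsub>Artin m\<^esub> inv\<^bsub>Artin m\<^esub> artin_alpha m = inv\<^bsub>Artin m\<^esub> artin_alpha m \<otimes>\<^bsub>Artin m\<^esub> artin_c m [^]\<^bsub>Artin m\<^esub> ?n"
  proof -
    let ?z = "artin_c m [^]\<^bsub>Artin m\<^esub> ?n" and ?a = "artin_alpha m"
    have "inv\<^bsub>Artin m\<^esub> ?a \<otimes>\<^bsub>Artin m\<^esub> (?z \<otimes>\<^bsub>Artin m\<^esub> ?a) \<otimes>\<^bsub>Artin m\<^esub> inv\<^bsub>Artin m\<^esub> ?a = inv\<^bsub>Artin m\<^esub> ?a \<otimes>\<^bsub>Artin m\<^esub> ?z"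
      by (simp add: A.m_assoc)
    then show ?thesis unfolding z by simp
  qed
  have "normal_form (Artin m) (artin_c m) ?n (even_t m) Not h"
  proof (rule normal_form_hom[OF group_Artin _ _ h(1)])
    show "carrier (Artin m) = generate (Artin m) (insert (artin_c m) (range (even_t m)))"
    proof
      have "artin_alpha m \<in> range (even_t m)" by (auto simp: even_t_def intro: range_eqI[of _ _ True])
      then show "carrier (Artin m) \<subseteq> generate (Artin m) (insert (artin_c m) (range (even_t m)))"
        unfolding artin_even_generated by (intro A.mono_generate) auto
      show "generate (Artin m) (insert (artin_c m) (range (even_t m))) \<subseteq> carrier (Artin m)"
        by (rule A.generate_incl) (auto simp: even_t_def)
    qed
    show "\<exists>j::int. even_t m e \<otimes>\<^bsub>Artin m\<^esub> even_t m (\<not> e) = artin_c m [^]\<^bsub>Artin m\<^esub> (int k * j)" for e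
      by (rule exI[of _ 0]) (simp add: even_t_def)
  qed (use k h ht z z' in \<open>simp_all add: even_t_def\<close>)
  with that show thesis .
qed

lemma normal_form_odd:
  assumes m: "odd m" and "m \<ge> 3"
  obtains act where "normal_form (Artin m) (artin_c m) (int m) (\<lambda>_::unit. artin_Delta m) (\<lambda>e. e) act"
proof -
  interpret A: group "Artin m" by (rule group_Artin)
  interpret B: group "BijGroup (UNIV :: unit nf set)" by (rule group_BijGroup)
  let ?n = "int m" and ?b = "\<lambda>e :: unit. e"
  have n: "?n > 0" using assms by simp
  let ?C = "perm_c ?n ?b" and ?T = "perm_t ?n ?b ()"
  have bij: "bij ?C" "bij ?T" using n by (auto intro: bij_perm_c bij_perm_t)
  \<comment> \<open>Both sides of \<Delta>^2 = c^m become the identity permutation.\<close>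
  have "?C [^]\<^bsub>BijGroup UNIV\<^esub> m = \<one>\<^bsub>BijGroup UNIV\<^esub>"
    using perm_c_funpow_n[OF n, of ?b] by (simp only: BijGroup_UNIV_pow[OF bij(1)] BijGroup_UNIV(2) nat_int)
  moreover have "?T \<otimes>\<^bsub>BijGroup UNIV\<^esub> ?T = \<one>\<^bsub>BijGroup UNIV\<^esub>"
    unfolding BijGroup_UNIV(2) BijGroup_UNIV(3)[OF bij(2,2)]
    using perm_t_perm_t[OF n, of ?b "()"] by (simp only: fun_eq_iff o_apply id_apply simp_thms)
  ultimately obtain h where h: "h \<in> hom (Artin m) (BijGroup (UNIV :: unit nf set))"
    "h (artin_Delta m) = ?T" "h (artin_c m) = ?C"
    using artin_lift_odd_c[OF group_BijGroup m, of ?T UNIV ?C] bij by (auto simp: BijGroup_UNIV(1))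
  have sq: "artin_Delta m \<otimes>\<^bsub>Artin m\<^esub> artin_Delta m = artin_c m [^]\<^bsub>Artin m\<^esub> ?n"
    using artin_Delta_square[OF m] by (simp add: int_pow_int)
  have "normal_form (Artin m) (artin_c m) ?n (\<lambda>_. artin_Delta m) ?b h"
  proof (rule normal_form_hom[OF group_Artin _ _ h(1)])
    show "carrier (Artin m) = generate (Artin m) (insert (artin_c m) (range (\<lambda>_::unit. artin_Delta m)))"
      using artin_odd_generated[of m] by simp
    show "\<exists>j::int. artin_Delta m \<otimes>\<^bsub>Artin m\<^esub> artin_Delta m = artin_c m [^]\<^bsub>Artin m\<^esub> (?n * j)"
      using sq by (intro exI[of _ 1]) simp
    show "artin_c m [^]\<^bsub>Artin m\<^esub> ?n \<otimes>\<^bsub>Artin m\<^esub> artin_Delta m = artin_Delta m \<otimes>\<^bsub>Artin m\<^esub> artin_c m [^]\<^bsub>Artin m\<^esub> ?n"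
      by (simp add: A.m_assoc flip: sq)
  qed (use assms h in \<open>simp_all\<close>)
  with that show thesis .
qed

section \<open>Homomorphisms to the integers\<close>

lemma artin_degree:
  obtains h where "h \<in> hom (Artin m) integer_group" "h (artin_alpha m) = 1" "h (artin_beta m) = 1"
proof (rule artin_lift[of integer_group "1::int" "1::int" m])
  show "eval_word integer_group (case_gen 1 1) (alt_word Alpha Beta m) =
    eval_word integer_group (case_gen 1 1) (alt_word Beta Alpha m)"
    by (rule eval_alt_word_cong) simp_all
qed (use that in simp_all)

text \<open>For even \<open>m\<close> the abelianization is free of rank 2, so both degrees may be
  prescribed; for odd \<open>m\<close> the generators are conjugate and share their degree.\<close>

lemma artin_even_degree:
  assumes "m = 2 * k"
  obtains h where "h \<in> hom (Artin m) integer_group" "h (artin_alpha m) = p" "h (artin_beta m) = q"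
  by (rule artin_lift_even[OF _ assms, of integer_group p q]) (use that in \<open>auto simp: add.commute\<close>)

lemma artin_c_infinite_order:
  assumes "artin_c m [^]\<^bsub>Artin m\<^esub> (i::int) = \<one>\<^bsub>Artin m\<^esub>"
  shows "i = 0"
proof -
  obtain h where h: "h \<in> hom (Artin m) integer_group" "h (artin_alpha m) = 1" "h (artin_beta m) = 1"
    by (rule artin_degree)
  interpret A: group "Artin m" by (rule group_Artin)
  interpret h: group_hom "Artin m" integer_group h
    using h by (simp add: group_hom_def group_hom_axioms_def A.is_group)
  have "h (artin_c m [^]\<^bsub>Artin m\<^esub> i) = 2 * i" using h by (simp add: h.hom_int_pow artin_c_def)
  with assms h.hom_one show ?thesis by simp
qed

section \<open>Maps out of \<open>C2\<close> and
  \<open>Z_semi_C2 \<times>\<times> C2\<close>\<close>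

lemma carrier_C2: "carrier C2 = {0, 1}"
  by (auto simp: carrier_integer_mod_group)

lemma (in group) int_pow_commute:
  assumes "x \<in> carrier G" "y \<in> carrier G" "x \<otimes> y = y' \<otimes> x" "y' \<in> carrier G"
  shows "x \<otimes> y [^] (i::int) = y' [^] i \<otimes> x"
proof -
  interpret f: group_hom G G "conj_auto G x"
    by (rule auto_group_hom[OF conj_auto_auto[OF assms(1)]])
  have "conj_auto G x y = y'" using assms by (simp add: conj_auto_apply inv_solve_right')
  then have "conj_auto G x (y [^] i) = y' [^] i" using assms by (simp add: f.hom_int_pow)
  then show ?thesis using assms by (simp add: conj_auto_apply inv_solve_right')
qed

lemma (in group) hom_C2:
  assumes "s \<in> carrier G" "s \<otimes> s = \<one>"
  shows "(\<lambda>a::int. s [^] a) \<in> hom C2 G"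
  by (rule homI) (use assms in \<open>auto simp: carrier_C2 mult_integer_mod_group\<close>)

lemma (in group) hom_C2_image:
  assumes "s \<in> carrier G" "s \<otimes> s = \<one>"
  shows "generate G {s} = (\<lambda>a::int. s [^] a) ` carrier C2"
proof
  interpret f: group_hom C2 G "\<lambda>a::int. s [^] a"
    using hom_C2[OF assms] by (simp add: group_hom_def group_hom_axioms_def is_group)
  show "generate G {s} \<subseteq> (\<lambda>a::int. s [^] a) ` carrier C2"
    by (rule generate_subgroup_incl[OF _ f.img_is_subgroup]) (use assms in \<open>auto simp: carrier_C2\<close>)
  show "(\<lambda>a::int. s [^] a) ` carrier C2 \<subseteq> generate G {s}"
    using assms by (auto simp: carrier_C2 intro: generate.incl generate.one)
qed

text \<open>The hypotheses are the relations of an infinite dihedral group on \<open>r\<close> and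
  \<open>s\<close> and of an involution \<open>e\<close> commuting with it.\<close>

lemma (in group) hom_Z_semi_C2_C2:
  assumes c: "r \<in> carrier G" "s \<in> carrier G" "e \<in> carrier G"
    and sq: "s \<otimes> s = \<one>" "e \<otimes> e = \<one>"
    and comm: "e \<otimes> r = r \<otimes> e" "e \<otimes> s = s \<otimes> e" "s \<otimes> r = inv r \<otimes> s"
  shows "(\<lambda>((n::int, a::int), c::int). r [^] n \<otimes> s [^] a \<otimes> e [^] c) \<in> hom (Z_semi_C2 \<times>\<times> C2) G"
    (is "?F \<in> _")
    and "generate G {e, s, r} = (\<lambda>((n::int, a::int), c::int). r [^] n \<otimes> s [^] a \<otimes> e [^] c) ` carrier (Z_semi_C2 \<times>\<times> C2)"
proof -
  have car: "carrier (Z_semi_C2 \<times>\<times> C2) = (UNIV \<times> {0, 1}) \<times> {0, 1}"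
    by (simp add: Z_semi_C2_def semidirect_def carrier_C2)
  have er: "e \<otimes> r [^] n = r [^] n \<otimes> e" for n :: int
    by (rule int_pow_commute) (use c comm in simp_all)
  have sr: "s \<otimes> r [^] n = r [^] (- n) \<otimes> s" for n :: int
    using int_pow_commute[of s r "inv r" n] c comm by (simp add: int_pow_inv int_pow_neg)
  \<comment> \<open>Copies of the relations with a trailing factor: products are kept bracketed to
    the right, where the bare relations do not match.\<close>
  have srx: "s \<otimes> (r [^] n \<otimes> x) = r [^] (- n) \<otimes> (s \<otimes> x)" if "x \<in> carrier G" for n :: int and x
    using sr[of n] c that by (simp only: m_assoc[symmetric] int_pow_closed)
  have erx: "e \<otimes> (r [^] n \<otimes> x) = r [^] n \<otimes> (e \<otimes> x)" if "x \<in> carrier G" for n :: int and x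
    using er[of n] c that by (simp only: m_assoc[symmetric] int_pow_closed)
  have esx: "e \<otimes> (s \<otimes> x) = s \<otimes> (e \<otimes> x)" if "x \<in> carrier G" for x
    using comm(2) c that by (simp only: m_assoc[symmetric])
  have rrx: "r [^] n \<otimes> (r [^] n' \<otimes> x) = r [^] (n + n') \<otimes> x" if "x \<in> carrier G" for n n' :: int and x
    using c that by (simp add: m_assoc[symmetric] int_pow_mult)
  have ssx: "s \<otimes> (s \<otimes> x) = x" "e \<otimes> (e \<otimes> x) = x" if "x \<in> carrier G" for x
    using c that sq by (simp_all add: m_assoc[symmetric])
  show hom: "?F \<in> hom (Z_semi_C2 \<times>\<times> C2) G"
  proof (rule homI)
    fix x y assume *: "x \<in> carrier (Z_semi_C2 \<times>\<times> C2)" "y \<in> carrier (Z_semi_C2 \<times>\<times> C2)"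
    obtain n a c' n' a' c'' where xy: "x = ((n, a), c')" "y = ((n', a'), c'')" by (metis surj_pair)
    have "a = 0 \<or> a = 1" "c' = 0 \<or> c' = 1" "a' = 0 \<or> a' = 1" "c'' = 0 \<or> c'' = 1"
      using * unfolding xy car by auto
    then show "?F (x \<otimes>\<^bsub>Z_semi_C2 \<times>\<times> C2\<^esub> y) = ?F x \<otimes> ?F y"
      unfolding xy using c sq comm(2)
      by (elim disjE)
         (simp_all add: Z_semi_C2_def semidirect_def mult_integer_mod_group m_assoc
            er sr erx srx esx rrx ssx int_pow_mult[symmetric])
  next
    fix x assume "x \<in> carrier (Z_semi_C2 \<times>\<times> C2)"
    then show "?F x \<in> carrier G" using c by (auto simp: car)
  qed
  interpret f: group_hom "Z_semi_C2 \<times>\<times> C2" G ?F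
    using hom group_Z_semi_C2 by (simp add: group_hom_def group_hom_axioms_def is_group DirProd_group)
  show "generate G {e, s, r} = ?F ` carrier (Z_semi_C2 \<times>\<times> C2)"
  proof
    have "r = ?F ((1, 0), 0)" "s = ?F ((0, 1), 0)" "e = ?F ((0, 0), 1)" using c by simp_all
    then have "{e, s, r} \<subseteq> ?F ` carrier (Z_semi_C2 \<times>\<times> C2)" unfolding car by blast
    then show "generate G {e, s, r} \<subseteq> ?F ` carrier (Z_semi_C2 \<times>\<times> C2)"
      by (rule generate_subgroup_incl[OF _ f.img_is_subgroup])
    have sg: "subgroup (generate G {e, s, r}) G" by (rule generate_is_subgroup) (use c in simp)
    have "r \<in> generate G {e, s, r}" "s \<in> generate G {e, s, r}" "e \<in> generate G {e, s, r}"
      by (auto intro: generate.incl)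
    then show "?F ` carrier (Z_semi_C2 \<times>\<times> C2) \<subseteq> generate G {e, s, r}"
      by (auto intro!: subgroup.m_closed[OF sg] subgroup_int_pow_closed[OF sg])
  qed
qed

section \<open>The automorphisms of the Artin group\<close>

lemma artin_extensional:
  "artin_eps m \<in> extensional (carrier (Artin m))"
  "artin_tau m \<in> extensional (carrier (Artin m))"
  "artin_eta m \<in> extensional (carrier (Artin m))"
  by (simp_all add: artin_eps_def artin_tau_def artin_eta_def artin_endo_def pres_lift_def Artin_def)

lemma artin_auto_eqI:
  assumes "f \<in> auto (Artin m)" "g \<in> auto (Artin m)"
    and "f (artin_alpha m) = g (artin_alpha m)" "f (artin_beta m) = g (artin_beta m)"
  shows "f = g"
  by (rule auto_eqI[OF assms(1,2)])
     (rule artin_hom_unique[OF group_Artin auto_hom[OF assms(1)] auto_hom[OF assms(2)] assms(3,4)])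

lemma artin_hom_id:
  assumes "h \<in> hom (Artin m) (Artin m)" "h (artin_alpha m) = artin_alpha m" "h (artin_beta m) = artin_beta m"
    and "x \<in> carrier (Artin m)"
  shows "h x = x"
  using artin_hom_unique[OF group_Artin assms(1), of "\<lambda>x. x" x] assms by (simp add: hom_def)

lemma artin_involution_auto:
  assumes "h \<in> hom (Artin m) (Artin m)" "h \<in> extensional (carrier (Artin m))"
    and "h (h (artin_alpha m)) = artin_alpha m" "h (h (artin_beta m)) = artin_beta m"
  shows "h \<in> auto (Artin m)"
proof -
  interpret group "Artin m" by (rule group_Artin)
  have "h (h x) = x" if "x \<in> carrier (Artin m)" for x
    using artin_hom_id[OF Group.hom_compose[OF assms(1,1)]] assms that by simp
  then show ?thesis using autoI[OF assms(1,2,1)] by simp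
qed

lemma artin_eps_auto: "artin_eps m \<in> auto (Artin m)"
proof (rule artin_involution_auto)
  interpret e: group_hom "Artin m" "Artin m" "artin_eps m"
    by (simp add: group_hom_def group_hom_axioms_def group_Artin artin_eps)
  show "artin_eps m (artin_eps m (artin_alpha m)) = artin_alpha m"
    "artin_eps m (artin_eps m (artin_beta m)) = artin_beta m" by (simp_all add: artin_eps)
qed (simp_all add: artin_eps artin_extensional)

lemma artin_tau_auto: "artin_tau m \<in> auto (Artin m)"
  by (rule artin_involution_auto) (simp_all add: artin_tau artin_extensional)

text \<open>As \<tau> is an involution, this makes \<tau>\<eta>\<tau> a two-sided inverse of \<eta>,
  which yields both the bijectivity of \<eta> and its dihedral relation with \<tau>.\<close>

lemma artin_eta_tau:
  assumes "even m"
  shows "artin_eta m (artin_tau m (artin_eta m (artin_alpha m))) = artin_beta m"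
    and "artin_eta m (artin_tau m (artin_eta m (artin_beta m))) = artin_alpha m"
proof -
  interpret n: group_hom "Artin m" "Artin m" "artin_eta m"
    by (simp add: group_hom_def group_hom_axioms_def group_Artin artin_eta assms)
  interpret t: group_hom "Artin m" "Artin m" "artin_tau m"
    by (simp add: group_hom_def group_hom_axioms_def group_Artin artin_tau)
  show "artin_eta m (artin_tau m (artin_eta m (artin_alpha m))) = artin_beta m"
    "artin_eta m (artin_tau m (artin_eta m (artin_beta m))) = artin_alpha m"
    by (simp_all add: artin_eta[OF assms] artin_tau n.G.m_assoc)
qed

lemma artin_eta_auto:
  assumes "even m"
  shows "artin_eta m \<in> auto (Artin m)"
proof -
  interpret group "Artin m" by (rule group_Artin)
  let ?n = "artin_eta m" and ?t = "artin_tau m"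
  note hom = artin_eta(1)[OF assms] artin_tau(1)[of m]
  let ?g = "\<lambda>x. ?t (?n (?t x))"
  have g: "?g \<in> hom (Artin m) (Artin m)"
    using Group.hom_compose[OF hom(2) Group.hom_compose[OF hom]] by (simp add: comp_def)
  have "?g (?n x) = x" if "x \<in> carrier (Artin m)" for x
    using artin_hom_id[OF Group.hom_compose[OF hom(1) g]] that artin_eta_tau[OF assms] by (simp add: artin_tau)
  moreover have "?n (?g x) = x" if "x \<in> carrier (Artin m)" for x
    using artin_hom_id[OF Group.hom_compose[OF g hom(1)]] that artin_eta_tau[OF assms] by (simp add: artin_tau)
  ultimately show ?thesis
    by (intro autoI[OF hom(1) _ g]) (simp_all add: artin_extensional)
qed

lemma artin_AutoGroup_eqI:
  assumes "f \<in> carrier (AutoGroup (Artin m))" "g \<in> carrier (AutoGroup (Artin m))"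
    and "f (artin_alpha m) = g (artin_alpha m)" "f (artin_beta m) = g (artin_beta m)"
  shows "f = g"
  using artin_auto_eqI[of f m g] assms by simp

lemma artin_eps_square: "artin_eps m \<otimes>\<^bsub>AutoGroup (Artin m)\<^esub> artin_eps m = \<one>\<^bsub>AutoGroup (Artin m)\<^esub>"
proof -
  interpret A: group "Artin m" by (rule group_Artin)
  interpret AG: group "AutoGroup (Artin m)" by (rule A.AutoGroup)
  interpret e: group_hom "Artin m" "Artin m" "artin_eps m"
    by (simp add: group_hom_def group_hom_axioms_def group_Artin artin_eps)
  show ?thesis
    by (rule artin_AutoGroup_eqI[OF AG.m_closed AG.one_closed])
       (simp_all add: artin_eps_auto mult_AutoGroup_apply one_AutoGroup artin_eps)
qed

lemma artin_tau_square: "artin_tau m \<otimes>\<^bsub>AutoGroup (Artin m)\<^esub> artin_tau m = \<one>\<^bsub>AutoGroup (Artin m)\<^esub>"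
proof -
  interpret A: group "Artin m" by (rule group_Artin)
  interpret AG: group "AutoGroup (Artin m)" by (rule A.AutoGroup)
  show ?thesis
    by (rule artin_AutoGroup_eqI[OF AG.m_closed AG.one_closed])
       (simp_all add: artin_tau_auto mult_AutoGroup_apply one_AutoGroup artin_tau)
qed

lemma artin_eps_tau:
  "artin_eps m \<otimes>\<^bsub>AutoGroup (Artin m)\<^esub> artin_tau m = artin_tau m \<otimes>\<^bsub>AutoGroup (Artin m)\<^esub> artin_eps m"
proof -
  interpret A: group "Artin m" by (rule group_Artin)
  interpret AG: group "AutoGroup (Artin m)" by (rule A.AutoGroup)
  interpret t: group_hom "Artin m" "Artin m" "artin_tau m"
    by (simp add: group_hom_def group_hom_axioms_def group_Artin artin_tau)
  show ?thesis
    by (rule artin_AutoGroup_eqI[OF AG.m_closed AG.m_closed])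
       (simp_all add: artin_tau_auto artin_eps_auto mult_AutoGroup_apply artin_tau artin_eps)
qed

lemma artin_eps_eta:
  assumes "even m"
  shows "artin_eps m \<otimes>\<^bsub>AutoGroup (Artin m)\<^esub> artin_eta m = artin_eta m \<otimes>\<^bsub>AutoGroup (Artin m)\<^esub> artin_eps m"
proof -
  interpret A: group "Artin m" by (rule group_Artin)
  interpret AG: group "AutoGroup (Artin m)" by (rule A.AutoGroup)
  interpret e: group_hom "Artin m" "Artin m" "artin_eps m"
    by (simp add: group_hom_def group_hom_axioms_def group_Artin artin_eps)
  interpret n: group_hom "Artin m" "Artin m" "artin_eta m"
    by (simp add: group_hom_def group_hom_axioms_def group_Artin artin_eta assms)
  show ?thesis
    by (rule artin_AutoGroup_eqI[OF AG.m_closed AG.m_closed])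
       (simp_all add: artin_eta_auto artin_eps_auto mult_AutoGroup_apply artin_eta artin_eps assms
          A.inv_mult_group A.m_assoc)
qed

lemma artin_tau_eta:
  assumes "even m"
  shows "artin_tau m \<otimes>\<^bsub>AutoGroup (Artin m)\<^esub> artin_eta m =
    inv\<^bsub>AutoGroup (Artin m)\<^esub> artin_eta m \<otimes>\<^bsub>AutoGroup (Artin m)\<^esub> artin_tau m"
proof -
  interpret A: group "Artin m" by (rule group_Artin)
  interpret AG: group "AutoGroup (Artin m)" by (rule A.AutoGroup)
  have c: "artin_tau m \<in> carrier (AutoGroup (Artin m))" "artin_eta m \<in> carrier (AutoGroup (Artin m))"
    by (simp_all add: artin_tau_auto artin_eta_auto assms)
  note tn = AG.m_closed[OF c]
  have "artin_eta m \<otimes>\<^bsub>AutoGroup (Artin m)\<^esub> (artin_tau m \<otimes>\<^bsub>AutoGroup (Artin m)\<^esub> artin_eta m) = artin_tau m"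
    by (rule artin_AutoGroup_eqI[OF AG.m_closed[OF c(2) tn] c(1)])
       (use c tn in \<open>simp_all add: mult_AutoGroup_apply artin_eta_tau assms artin_tau\<close>)
  then show ?thesis using c tn by (metis AG.inv_solve_left)
qed

text \<open>A letter with \<open>bar e = e\<close> has a central square, so
  \<open>c \<otimes> c\<close> would be mapped into the centre and hence be central itself, against
  \<open>n \<ge> 3\<close>.\<close>

lemma (in normal_form) aut_c_not_involution:
  assumes n3: "n \<ge> 3" and f: "f \<in> auto G" and h: "h \<in> carrier G" and e: "bar e = e"
  shows "f c \<noteq> h \<otimes> (t e \<otimes> c [^] (n * k)) \<otimes> inv h"
proof
  assume fc: "f c = h \<otimes> (t e \<otimes> c [^] (n * k)) \<otimes> inv h"
  interpret f: group_hom G G f by (rule auto_group_hom[OF f])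
  let ?u = "t e \<otimes> c [^] (n * k)"
  obtain j :: int where j: "t e \<otimes> t e = c [^] (n * j)" using t_bar[of e] e by auto
  have z: "c [^] (n * i) \<in> Zs" for i :: int by (simp add: Zs_def)
  have "?u \<otimes> ?u = t e \<otimes> (c [^] (n * k) \<otimes> t e) \<otimes> c [^] (n * k)" by (simp add: m_assoc)
  also have "\<dots> = t e \<otimes> t e \<otimes> (c [^] (n * k) \<otimes> c [^] (n * k))"
    using Zs_central[OF z[of k], of "t e"] by (simp add: m_assoc)
  also have "\<dots> = c [^] (n * (j + k + k))" by (simp add: j cpow_mult algebra_simps)
  finally have u: "?u \<otimes> ?u \<in> Zs" using z by simp
  have "f (c \<otimes> c) = h \<otimes> ?u \<otimes> inv h \<otimes> (h \<otimes> ?u \<otimes> inv h)" by (simp add: fc)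
  also have "\<dots> = h \<otimes> (?u \<otimes> ?u) \<otimes> inv h" using h by (simp add: m_assoc)
  also have "\<dots> = ?u \<otimes> ?u \<otimes> h \<otimes> inv h" using Zs_central[OF u h] by simp
  also have "\<dots> = ?u \<otimes> ?u" using h by (simp add: m_assoc)
  finally have "f (c \<otimes> c) \<in> f ` center G" using u by (simp add: auto_center_image[OF f, unfolded center_eq] center_eq del: f.hom_mult)
  then obtain y where y: "f (c \<otimes> c) = f y" "y \<in> Zs" by (auto simp: center_eq)
  then have "c \<otimes> c = y" using inj_onD[OF auto_inj[OF f] y(1)] Zs_closed by simp
  then obtain i :: int where i: "c \<otimes> c = c [^] (n * i)" using y(2) by (auto simp: Zs_def)
  have "c \<otimes> c = c [^] (2::int)" using cpow_mult[of 1 1] by simp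
  then have "2 mod n = (n * i) mod n" using i lead_cpow[of 2] lead_cpow[of "n * i"] by simp
  then show False using n3 by simp
qed

lemma group_hom_eq_on_generate:
  assumes "group_hom G H f" "group_hom G H g" "S \<subseteq> carrier G" "\<And>s. s \<in> S \<Longrightarrow> f s = g s"
    and "x \<in> generate G S"
  shows "f x = g x"
proof -
  interpret f: group_hom G H f by fact
  interpret g: group_hom G H g by fact
  show ?thesis
    using assms(5)
  proof induction
    case (inv h)
    then have "h \<in> carrier G" using assms(3) by blast
    with inv assms(4) show ?case by simp
  next
    case (eng h1 h2)
    then have "h1 \<in> carrier G" "h2 \<in> carrier G" using f.G.generate_in_carrier[OF assms(3)] by auto
    with eng show ?case by simp
  qed (use assms(4) in simp_all)
qed

section \<open>Reduction to automorphisms that fix \<open>artin_c m\<close>\<close>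

lemma (in group) auto_eq_on_generators:
  assumes f: "f \<in> auto G" and g: "g \<in> auto G" and S: "carrier G = generate G {x, y}" "x \<in> carrier G" "y \<in> carrier G"
    and eq: "f x = g x" "f y = g y"
  shows "f = g"
proof (rule auto_eqI[OF f g])
  fix z assume "z \<in> carrier G"
  then have z: "z \<in> generate G {x, y}" by (simp only: S(1)[symmetric])
  show "f z = g z"
    by (rule group_hom_eq_on_generate[OF auto_group_hom[OF f] auto_group_hom[OF g] _ _ z]) (use S(2,3) eq in auto)
qed

text \<open>\<epsilon> sends \<alpha>\<beta> to the inverse of \<beta>\<alpha>, which is only
  conjugate to the inverse of \<open>artin_c m\<close>; \<alpha> is the conjugating element.\<close>

lemma artin_conj_eps_c:
  "(conj_auto (Artin m) (artin_alpha m) \<otimes>\<^bsub>AutoGroup (Artin m)\<^esub> artin_eps m) (artin_c m) = inv\<^bsub>Artin m\<^esub> artin_c m"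
proof -
  interpret A: group "Artin m" by (rule group_Artin)
  interpret e: group_hom "Artin m" "Artin m" "artin_eps m"
    by (simp add: group_hom_def group_hom_axioms_def group_Artin artin_eps)
  have "(conj_auto (Artin m) (artin_alpha m) \<otimes>\<^bsub>AutoGroup (Artin m)\<^esub> artin_eps m) (artin_c m) =
    conj_auto (Artin m) (artin_alpha m) (artin_eps m (artin_c m))"
    by (rule mult_AutoGroup_apply) (simp_all add: A.conj_auto_auto artin_eps_auto)
  then show ?thesis
    by (simp add: A.conj_auto_apply artin_c_def artin_eps A.m_assoc A.inv_mult_group)
qed

text \<open>The image of \<open>artin_c m\<close> is conjugate to \<open>artin_c m\<close> or to its inverse, and composing \<open>\<epsilon>\<close> with the
  conjugation by \<open>\<alpha>\<close> inverts \<open>artin_c m\<close>.\<close>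

lemma artin_aut_reduce:
  assumes nf: "normal_form (Artin m) (artin_c m) n t bar act" and invol: "n \<ge> 3 \<or> (\<forall>e. bar e \<noteq> e)"
    and K: "subgroup K (AutoGroup (Artin m))" "Inn (Artin m) \<subseteq> K" "artin_eps m \<in> K"
    and fix_c: "\<And>g. g \<in> auto (Artin m) \<Longrightarrow> g (artin_c m) = artin_c m \<Longrightarrow> g \<in> K"
  shows "auto (Artin m) \<subseteq> K"
proof
  fix f assume f: "f \<in> auto (Artin m)"
  interpret A: group "Artin m" by (rule group_Artin)
  interpret AG: group "AutoGroup (Artin m)" by (rule A.AutoGroup)
  interpret K: subgroup K "AutoGroup (Artin m)" by (rule K(1))
  interpret nf: normal_form "Artin m" "artin_c m" n t bar act by (rule nf)
  let ?A = "Artin m" and ?c = "artin_c m"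
  have "\<exists>h v. h \<in> carrier ?A \<and> (v = 1 \<or> v = - 1) \<and> f ?c = h \<otimes>\<^bsub>?A\<^esub> ?c [^]\<^bsub>?A\<^esub> (v::int) \<otimes>\<^bsub>?A\<^esub> inv\<^bsub>?A\<^esub> h"
  proof (rule nf.aut_c[OF f])
    fix j :: int assume "?c [^]\<^bsub>?A\<^esub> (n * j) = \<one>\<^bsub>?A\<^esub>"
    then show "j = 0" using artin_c_infinite_order nf.n_pos by fastforce
  next
    \<comment> \<open>Either \<open>c\<close> has order at least 3 modulo the centre, or no letter
      is its own \<open>bar\<close> and the case is empty.\<close>
    fix h k e assume "h \<in> carrier ?A" "bar e = e"
    then show "f ?c \<noteq> h \<otimes>\<^bsub>?A\<^esub> (t e \<otimes>\<^bsub>?A\<^esub> ?c [^]\<^bsub>?A\<^esub> (n * k)) \<otimes>\<^bsub>?A\<^esub> inv\<^bsub>?A\<^esub> h"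
      using invol nf.aut_c_not_involution[OF _ f] by blast
  qed blast
  then obtain h v where h: "h \<in> carrier ?A" "v = 1 \<or> v = - 1"
    "f ?c = h \<otimes>\<^bsub>?A\<^esub> ?c [^]\<^bsub>?A\<^esub> (v::int) \<otimes>\<^bsub>?A\<^esub> inv\<^bsub>?A\<^esub> h" by blast
  define i where "i = conj_auto ?A (inv\<^bsub>?A\<^esub> h)"
  have "i \<in> Inn ?A" using h by (auto simp: Inn_eq i_def)
  then have iK: "i \<in> K" using K by blast
  have i: "i \<in> auto ?A" using h by (simp add: i_def A.conj_auto_auto)
  define g where "g = i \<otimes>\<^bsub>AutoGroup ?A\<^esub> f"
  have g: "g \<in> auto ?A" using AG.m_closed[of i f] i f by (simp add: g_def)
  have "g ?c = i (f ?c)" using i f by (simp add: g_def mult_AutoGroup_apply)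
  also have "\<dots> = ?c [^]\<^bsub>?A\<^esub> v" unfolding h(3) i_def using h(1) by (simp add: A.conj_auto_apply A.m_assoc)
  finally have gc: "g ?c = ?c [^]\<^bsub>?A\<^esub> v" .
  have "g \<in> K"
  proof (cases "v = 1")
    case True
    with gc g show ?thesis by (intro fix_c) simp_all
  next
    case False
    let ?d = "conj_auto ?A (artin_alpha m)"
    define e where "e = ?d \<otimes>\<^bsub>AutoGroup ?A\<^esub> artin_eps m"
    have "?d \<in> Inn ?A" by (simp add: Inn_eq)
    then have eK: "e \<in> K" unfolding e_def using K by (intro K.m_closed) auto
    have e: "e \<in> auto ?A" using K.mem_carrier[OF eK] by simp
    interpret g: group_hom ?A ?A g by (rule A.auto_group_hom[OF g])
    have "(g \<otimes>\<^bsub>AutoGroup ?A\<^esub> e) ?c = g (inv\<^bsub>?A\<^esub> ?c)"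
      using g e artin_conj_eps_c[of m] by (simp add: mult_AutoGroup_apply e_def[symmetric])
    also have "\<dots> = ?c" using gc False h(2) by (simp add: A.int_pow_neg)
    finally have "(g \<otimes>\<^bsub>AutoGroup ?A\<^esub> e) ?c = ?c" .
    moreover have "g \<otimes>\<^bsub>AutoGroup ?A\<^esub> e \<in> auto ?A" using AG.m_closed[of g e] g e by simp
    ultimately have geK: "g \<otimes>\<^bsub>AutoGroup ?A\<^esub> e \<in> K" by (rule fix_c[rotated])
    have "g = g \<otimes>\<^bsub>AutoGroup ?A\<^esub> e \<otimes>\<^bsub>AutoGroup ?A\<^esub> inv\<^bsub>AutoGroup ?A\<^esub> e"
      using g e AG.inv_solve_right[of g "g \<otimes>\<^bsub>AutoGroup ?A\<^esub> e" e] AG.m_closed[of g e] by simp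
    then show ?thesis using K.m_closed[OF geK K.m_inv_closed[OF eK]] by simp
  qed
  have "f = inv\<^bsub>AutoGroup ?A\<^esub> i \<otimes>\<^bsub>AutoGroup ?A\<^esub> g"
    using i f g AG.inv_solve_left[of f i g] by (simp add: g_def)
  then show "f \<in> K" using K.m_closed[OF K.m_inv_closed[OF iK] \<open>g \<in> K\<close>] by simp
qed

text \<open>Write f(\<Delta>) as c^a y c^-a. As \<Delta>^2 is a power of \<open>c\<close>, it is
  fixed by \<open>f\<close>, and y^2 = \<Delta>^2 follows. Since \<Delta> is a power of
  \<open>y\<close> modulo the centre, only y = \<Delta> remains, so \<open>f\<close> is conjugation
  by c^a.\<close>

lemma artin_odd_fix_c_inner:
  assumes m: "odd m" "m \<ge> 3" and f: "f \<in> auto (Artin m)" and fc: "f (artin_c m) = artin_c m"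
  shows "f \<in> Inn (Artin m)"
proof -
  let ?n = "int m"
  from m obtain act where nf: "normal_form (Artin m) (artin_c m) ?n (\<lambda>_::unit. artin_Delta m) (\<lambda>e. e) act"
    by (rule normal_form_odd)
  interpret A: group "Artin m" by (rule group_Artin)
  interpret nf: normal_form "Artin m" "artin_c m" ?n "\<lambda>_::unit. artin_Delta m" "\<lambda>e. e" act by (rule nf)
  interpret f: group_hom "Artin m" "Artin m" f by (rule A.auto_group_hom[OF f])
  let ?A = "Artin m" and ?c = "artin_c m" and ?D = "artin_Delta m"
  have DD: "?D \<otimes>\<^bsub>?A\<^esub> ?D = ?c [^]\<^bsub>?A\<^esub> ?n" using artin_Delta_square[OF m(1)] by (simp add: int_pow_int)
  have z: "?c [^]\<^bsub>?A\<^esub> (?n * i) \<in> nf.Zs" for i :: int by (simp add: nf.Zs_def)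
  obtain a b p j :: int and x where ax: "f ?D = ?c [^]\<^bsub>?A\<^esub> a \<otimes>\<^bsub>?A\<^esub> x \<otimes>\<^bsub>?A\<^esub> ?c [^]\<^bsub>?A\<^esub> b" and x: "x \<in> carrier ?A"
    "nf.len x > 0" "nf.lead x = 0" "nf.lead (inv\<^bsub>?A\<^esub> x) = 0" and xp: "?D = x [^]\<^bsub>?A\<^esub> p \<otimes>\<^bsub>?A\<^esub> ?c [^]\<^bsub>?A\<^esub> (?n * j)"
    by (rule nf.aut_letter[OF f fc artin_odd_generated])
  define y where "y = x \<otimes>\<^bsub>?A\<^esub> ?c [^]\<^bsub>?A\<^esub> (a + b)"
  have y: "y \<in> carrier ?A" using x by (simp add: y_def)
  have fD: "f ?D = ?c [^]\<^bsub>?A\<^esub> a \<otimes>\<^bsub>?A\<^esub> y \<otimes>\<^bsub>?A\<^esub> inv\<^bsub>?A\<^esub> (?c [^]\<^bsub>?A\<^esub> a)"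
    unfolding ax y_def using x(1) by (simp add: A.m_assoc nf.cpow_mult flip: A.int_pow_neg)
  have "?c [^]\<^bsub>?A\<^esub> a \<otimes>\<^bsub>?A\<^esub> (y \<otimes>\<^bsub>?A\<^esub> y) \<otimes>\<^bsub>?A\<^esub> inv\<^bsub>?A\<^esub> (?c [^]\<^bsub>?A\<^esub> a) = f ?D \<otimes>\<^bsub>?A\<^esub> f ?D"
    unfolding fD using y by (simp add: A.m_assoc)
  also have "\<dots> = f (?D \<otimes>\<^bsub>?A\<^esub> ?D)" by simp
  also have "\<dots> = ?c [^]\<^bsub>?A\<^esub> ?n" unfolding DD using fc by (simp add: f.hom_int_pow)
  finally have conj_yy: "?c [^]\<^bsub>?A\<^esub> a \<otimes>\<^bsub>?A\<^esub> (y \<otimes>\<^bsub>?A\<^esub> y) \<otimes>\<^bsub>?A\<^esub> inv\<^bsub>?A\<^esub> (?c [^]\<^bsub>?A\<^esub> a) = ?c [^]\<^bsub>?A\<^esub> ?n" .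
  have "y \<otimes>\<^bsub>?A\<^esub> y = inv\<^bsub>?A\<^esub> (?c [^]\<^bsub>?A\<^esub> a) \<otimes>\<^bsub>?A\<^esub>
    (?c [^]\<^bsub>?A\<^esub> a \<otimes>\<^bsub>?A\<^esub> (y \<otimes>\<^bsub>?A\<^esub> y) \<otimes>\<^bsub>?A\<^esub> inv\<^bsub>?A\<^esub> (?c [^]\<^bsub>?A\<^esub> a) \<otimes>\<^bsub>?A\<^esub> ?c [^]\<^bsub>?A\<^esub> a)"
    using y by (simp add: A.m_assoc)
  then have yy: "y \<otimes>\<^bsub>?A\<^esub> y = ?c [^]\<^bsub>?A\<^esub> ?n"
    unfolding conj_yy by (simp add: nf.cpow_mult flip: A.int_pow_neg)
  \<comment> \<open>The square of \<open>y\<close> is central, so the power of \<open>c\<close>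
    contained in \<open>y\<close> must be central too.\<close>
  then have "(a + b) mod ?n = 0"
    using nf.square_Zs[OF x, of "a + b"] z[of 1] by (simp add: y_def)
  then obtain s where s: "a + b = ?n * s" by (metis mod_0_imp_dvd dvdE)
  have yp: "y [^]\<^bsub>?A\<^esub> p = x [^]\<^bsub>?A\<^esub> p \<otimes>\<^bsub>?A\<^esub> ?c [^]\<^bsub>?A\<^esub> (?n * (s * p))"
    unfolding y_def s using x(1) nf.Zs_central[OF z x(1)]
    by (subst A.int_pow_mult_distrib) (simp_all add: A.int_pow_pow mult.assoc)
  have D: "?D = y [^]\<^bsub>?A\<^esub> p \<otimes>\<^bsub>?A\<^esub> ?c [^]\<^bsub>?A\<^esub> (?n * (j - s * p))"
    unfolding yp xp using x(1) by (simp add: A.m_assoc nf.cpow_mult right_diff_distrib)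
  have y2: "y [^]\<^bsub>?A\<^esub> (2 * q) = ?c [^]\<^bsub>?A\<^esub> (?n * q)" for q :: int
  proof -
    have "y [^]\<^bsub>?A\<^esub> (2::int) = ?c [^]\<^bsub>?A\<^esub> ?n" using A.int_pow_mult[OF y, of 1 1] y by (simp add: yy)
    then show ?thesis using y by (simp add: A.int_pow_pow[symmetric])
  qed
  \<comment> \<open>Even powers of \<open>y\<close> are powers of \<open>c\<close>, but \<Delta> has
    a letter.\<close>
  have "odd p"
  proof
    assume "even p"
    then obtain q where "p = 2 * q" by blast
    then have "?D = ?c [^]\<^bsub>?A\<^esub> (?n * (q + (j - s * p)))"
      using D by (simp add: y2 nf.cpow_mult distrib_left)
    then have "nf.len ?D = 0" by (metis nf.len_cpow)
    then show False using nf.len_t by simp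
  qed
  then obtain q where q: "p = 2 * q + 1" by (rule oddE)
  define r where "r = q + (j - s * p)"
  have "?D = ?c [^]\<^bsub>?A\<^esub> (?n * q) \<otimes>\<^bsub>?A\<^esub> y \<otimes>\<^bsub>?A\<^esub> ?c [^]\<^bsub>?A\<^esub> (?n * (j - s * p))"
    using D y unfolding q by (simp add: A.int_pow_mult y2)
  then have Dy: "?D = y \<otimes>\<^bsub>?A\<^esub> ?c [^]\<^bsub>?A\<^esub> (?n * r)"
    using y nf.Zs_central[OF z y, of q] by (simp add: A.m_assoc nf.cpow_mult r_def distrib_left)
  \<comment> \<open>\<Delta> and \<open>y\<close> have the same square, so the central factor
    between them squares to 1 and is trivial, as \<open>c\<close> has infinite order.\<close>
  have "?D \<otimes>\<^bsub>?A\<^esub> ?D = y \<otimes>\<^bsub>?A\<^esub> (?c [^]\<^bsub>?A\<^esub> (?n * r) \<otimes>\<^bsub>?A\<^esub> y) \<otimes>\<^bsub>?A\<^esub> ?c [^]\<^bsub>?A\<^esub> (?n * r)"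
    unfolding Dy using y by (simp add: A.m_assoc)
  also have "\<dots> = y \<otimes>\<^bsub>?A\<^esub> y \<otimes>\<^bsub>?A\<^esub> (?c [^]\<^bsub>?A\<^esub> (?n * r) \<otimes>\<^bsub>?A\<^esub> ?c [^]\<^bsub>?A\<^esub> (?n * r))"
    using y nf.Zs_central[OF z y, of r] by (simp add: A.m_assoc)
  also have "\<dots> = ?c [^]\<^bsub>?A\<^esub> ?n \<otimes>\<^bsub>?A\<^esub> ?c [^]\<^bsub>?A\<^esub> (2 * ?n * r)"
    unfolding yy by (simp add: nf.cpow_mult algebra_simps)
  finally have "?c [^]\<^bsub>?A\<^esub> ?n = ?c [^]\<^bsub>?A\<^esub> ?n \<otimes>\<^bsub>?A\<^esub> ?c [^]\<^bsub>?A\<^esub> (2 * ?n * r)"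
    unfolding DD .
  then have "?c [^]\<^bsub>?A\<^esub> (2 * ?n * r) = \<one>\<^bsub>?A\<^esub>"
    by (rule A.l_cancel_one'[THEN iffD1, rotated -1]) simp_all
  then have "r = 0" using artin_c_infinite_order[of m "2 * ?n * r"] m by simp
  then have "y = ?D" using Dy y by simp
  with fD have "f ?D = conj_auto ?A (?c [^]\<^bsub>?A\<^esub> a) ?D" by (simp add: A.conj_auto_apply)
  moreover have "f ?c = conj_auto ?A (?c [^]\<^bsub>?A\<^esub> a) ?c"
    using nf.cpow_mult[of a 1] nf.cpow_mult[of "a + 1" "- a"]
    by (simp add: A.conj_auto_apply fc flip: A.int_pow_neg)
  ultimately have "f = conj_auto ?A (?c [^]\<^bsub>?A\<^esub> a)"
    by (intro A.auto_eq_on_generators[OF f A.conj_auto_auto artin_odd_generated]) simp_all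
  then show ?thesis by (auto simp: Inn_eq)
qed

lemma artin_eta_c: "even m \<Longrightarrow> artin_eta m (artin_c m) = artin_c m"
proof -
  assume m: "even m"
  interpret n: group_hom "Artin m" "Artin m" "artin_eta m"
    by (simp add: group_hom_def group_hom_axioms_def group_Artin artin_eta m)
  show ?thesis by (simp add: artin_c_def artin_eta m n.G.m_assoc)
qed

text \<open>The inverse of \<beta> is c^-1 \<alpha>. So \<eta> fixes \<open>c\<close> and multiplies
  \<alpha> by c^-1 on the left, which makes its powers explicit on these two generators.\<close>

lemma artin_eta_pow:
  assumes m: "even m"
  shows "(artin_eta m [^]\<^bsub>AutoGroup (Artin m)\<^esub> (i::int)) (artin_c m) = artin_c m"
    and "(artin_eta m [^]\<^bsub>AutoGroup (Artin m)\<^esub> (i::int)) (artin_alpha m) =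
      artin_c m [^]\<^bsub>Artin m\<^esub> (- i) \<otimes>\<^bsub>Artin m\<^esub> artin_alpha m"
proof -
  interpret A: group "Artin m" by (rule group_Artin)
  interpret AG: group "AutoGroup (Artin m)" by (rule A.AutoGroup)
  let ?A = "Artin m" and ?c = "artin_c m" and ?a = "artin_alpha m"
  have eta: "artin_eta m \<in> carrier (AutoGroup ?A)" by (simp add: artin_eta_auto m)
  have eta_a: "artin_eta m ?a = inv\<^bsub>?A\<^esub> ?c \<otimes>\<^bsub>?A\<^esub> ?a"
    by (simp add: artin_eta m artin_c_def A.inv_mult_group A.m_assoc)
  have nat: "(artin_eta m [^]\<^bsub>AutoGroup ?A\<^esub> (k::nat)) ?c = ?c \<and>
    (artin_eta m [^]\<^bsub>AutoGroup ?A\<^esub> k) ?a = ?c [^]\<^bsub>?A\<^esub> (- int k) \<otimes>\<^bsub>?A\<^esub> ?a" for k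
  proof (induction k)
    case 0
    show ?case by (simp add: one_AutoGroup)
  next
    case (Suc k)
    have k: "artin_eta m [^]\<^bsub>AutoGroup ?A\<^esub> k \<in> auto ?A" using AG.nat_pow_closed[OF eta, of k] by simp
    interpret k: group_hom ?A ?A "artin_eta m [^]\<^bsub>AutoGroup ?A\<^esub> k" by (rule A.auto_group_hom[OF k])
    have "inv\<^bsub>?A\<^esub> ?c \<otimes>\<^bsub>?A\<^esub> ?c [^]\<^bsub>?A\<^esub> (- int k) = ?c [^]\<^bsub>?A\<^esub> (- 1 + - int k)"
      by (subst A.int_pow_mult) (simp_all add: A.int_pow_neg)
    with Suc show ?case
      using k eta by (simp add: mult_AutoGroup_apply artin_eta_c m eta_a A.m_assoc[symmetric])
  qed
  have "(artin_eta m [^]\<^bsub>AutoGroup ?A\<^esub> i) ?c = ?c \<and>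
    (artin_eta m [^]\<^bsub>AutoGroup ?A\<^esub> i) ?a = ?c [^]\<^bsub>?A\<^esub> (- i) \<otimes>\<^bsub>?A\<^esub> ?a"
  proof (cases "i \<ge> 0")
    case True
    then show ?thesis using nat[of "nat i"] int_pow_int[of "AutoGroup ?A" "artin_eta m" "nat i"] by simp
  next
    case False
    \<comment> \<open>The negative power \<open>g\<close> is found by solving
      \<open>g (f x) = x\<close> on the generators, with \<open>f\<close> the opposite positive
      power.\<close>
    define f where "f = artin_eta m [^]\<^bsub>AutoGroup ?A\<^esub> nat (- i)"
    define g where "g = artin_eta m [^]\<^bsub>AutoGroup ?A\<^esub> i"
    have fg: "f \<in> auto ?A" "g \<in> auto ?A"
      using AG.nat_pow_closed[OF eta] AG.int_pow_closed[OF eta] by (simp_all add: f_def g_def)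
    interpret g: group_hom ?A ?A g by (rule A.auto_group_hom[OF fg(2)])
    have "f = artin_eta m [^]\<^bsub>AutoGroup ?A\<^esub> (- i)" using False by (simp add: f_def flip: int_pow_int)
    then have "g \<otimes>\<^bsub>AutoGroup ?A\<^esub> f = \<one>\<^bsub>AutoGroup ?A\<^esub>"
      unfolding g_def by (simp only: AG.int_pow_mult[OF eta, symmetric] add.right_inverse int_pow_0)
    then have gf: "g (f x) = x" if "x \<in> carrier ?A" for x
      using mult_AutoGroup_apply[OF fg(2,1) that] that by (simp add: one_AutoGroup)
    have "f ?c = ?c" "f ?a = ?c [^]\<^bsub>?A\<^esub> i \<otimes>\<^bsub>?A\<^esub> ?a" using nat[of "nat (- i)"] False by (simp_all add: f_def)
    with gf[of ?c] gf[of ?a] have gc: "g ?c = ?c" and "g ?c [^]\<^bsub>?A\<^esub> i \<otimes>\<^bsub>?A\<^esub> g ?a = ?a" by (simp_all add: g.hom_int_pow)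
    then have "g ?a = ?c [^]\<^bsub>?A\<^esub> (- i) \<otimes>\<^bsub>?A\<^esub> ?a" by (simp add: A.int_pow_neg A.inv_solve_left)
    with gc show ?thesis by (simp add: g_def)
  qed
  then show "(artin_eta m [^]\<^bsub>AutoGroup ?A\<^esub> i) ?c = ?c"
    "(artin_eta m [^]\<^bsub>AutoGroup ?A\<^esub> i) ?a = ?c [^]\<^bsub>?A\<^esub> (- i) \<otimes>\<^bsub>?A\<^esub> ?a" by simp_all
qed

text \<open>Modulo the centre \<alpha> is a power of \<open>x\<close>, and a degree that kills
  \<open>c\<close> leaves only the exponents 1 and -1. So \<open>f\<close> sends \<alpha> to c^i
  \<alpha> c^j or to c^i \<alpha>^-1 c^j, which are the cases \<open>pos\<close> and
  \<open>neg\<close>.\<close>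

lemma artin_even_fix_c:
  assumes m: "even m" "m \<ge> 3" and f: "f \<in> auto (Artin m)" and fc: "f (artin_c m) = artin_c m"
    and K: "subgroup K (AutoGroup (Artin m))" "Inn (Artin m) \<subseteq> K" "artin_tau m \<in> K" "artin_eta m \<in> K"
  shows "f \<in> K"
proof -
  obtain k where k: "m = 2 * k" using m by blast
  then obtain act where nf: "normal_form (Artin m) (artin_c m) (int k) (even_t m) Not act"
    using normal_form_even[of m k] m(2) by auto
  interpret A: group "Artin m" by (rule group_Artin)
  interpret AG: group "AutoGroup (Artin m)" by (rule A.AutoGroup)
  interpret nf: normal_form "Artin m" "artin_c m" "int k" "even_t m" Not act by (rule nf)
  interpret K: subgroup K "AutoGroup (Artin m)" by (rule K(1))
  let ?A = "Artin m" and ?c = "artin_c m" and ?a = "artin_alpha m"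
  have inn: "conj_auto ?A g \<in> K" if "g \<in> carrier ?A" for g
    using that K by (auto simp: Inn_eq)
  have pos: "g \<in> K" if g: "g \<in> auto ?A" "g ?c = ?c" "g ?a = ?c [^]\<^bsub>?A\<^esub> i \<otimes>\<^bsub>?A\<^esub> ?a \<otimes>\<^bsub>?A\<^esub> ?c [^]\<^bsub>?A\<^esub> j" for g and i j :: int
  proof -
    \<comment> \<open>This power of \<eta> sends \<alpha> to c^(i+j) \<alpha>; conjugation by c^-j
      then moves c^j to the right end.\<close>
    define e where "e = artin_eta m [^]\<^bsub>AutoGroup ?A\<^esub> (- (i + j))"
    define d where "d = conj_auto ?A (?c [^]\<^bsub>?A\<^esub> (- j))"
    have eK: "e \<in> K" unfolding e_def by (rule AG.subgroup_int_pow_closed[OF K(1) K(4)])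
    have dK: "d \<in> K" unfolding d_def by (rule inn) simp
    have deK: "d \<otimes>\<^bsub>AutoGroup ?A\<^esub> e \<in> K" by (rule K.m_closed[OF dK eK])
    have de: "d \<in> auto ?A" "e \<in> auto ?A" "d \<otimes>\<^bsub>AutoGroup ?A\<^esub> e \<in> auto ?A"
      using K.mem_carrier[OF dK] K.mem_carrier[OF eK] K.mem_carrier[OF deK] by simp_all
    have "g = d \<otimes>\<^bsub>AutoGroup ?A\<^esub> e"
    proof (rule A.auto_eq_on_generators[OF g(1) de(3) artin_even_generated])
      show "g ?c = (d \<otimes>\<^bsub>AutoGroup ?A\<^esub> e) ?c"
        using nf.cpow_mult[of "- j" 1] nf.cpow_mult[of "- j + 1" j] g(2)
        by (simp add: mult_AutoGroup_apply de(1,2)) (simp add: e_def artin_eta_pow m d_def A.conj_auto_apply flip: A.int_pow_neg)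
      have "(d \<otimes>\<^bsub>AutoGroup ?A\<^esub> e) ?a = ?c [^]\<^bsub>?A\<^esub> (- j) \<otimes>\<^bsub>?A\<^esub> (?c [^]\<^bsub>?A\<^esub> (i + j) \<otimes>\<^bsub>?A\<^esub> ?a) \<otimes>\<^bsub>?A\<^esub> ?c [^]\<^bsub>?A\<^esub> j"
        by (simp add: mult_AutoGroup_apply de(1,2))
           (simp add: e_def artin_eta_pow m d_def A.conj_auto_apply add.commute flip: A.int_pow_neg)
      also have "\<dots> = g ?a" unfolding g(3) by (simp add: A.m_assoc nf.cpow_mult_assoc add.commute)
      finally show "g ?a = (d \<otimes>\<^bsub>AutoGroup ?A\<^esub> e) ?a" by simp
    qed simp_all
    with deK show ?thesis by simp
  qed
  have neg: "g \<in> K" if g: "g \<in> auto ?A" "g ?c = ?c"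
    "g ?a = ?c [^]\<^bsub>?A\<^esub> i \<otimes>\<^bsub>?A\<^esub> inv\<^bsub>?A\<^esub> ?a \<otimes>\<^bsub>?A\<^esub> ?c [^]\<^bsub>?A\<^esub> j" for g and i j :: int
  proof -
    \<comment> \<open>\<tau> followed by conjugation with \<alpha> fixes \<open>c\<close> and sends
      \<alpha> to c \<alpha>^-1. Composing \<open>g\<close> with it leads back to
      \<open>pos\<close>.\<close>
    let ?d = "conj_auto ?A ?a"
    define e where "e = ?d \<otimes>\<^bsub>AutoGroup ?A\<^esub> artin_tau m"
    have eK: "e \<in> K" unfolding e_def using K(3) by (intro K.m_closed inn) simp_all
    have e: "e \<in> auto ?A" using K.mem_carrier[OF eK] by simp
    have ge: "g \<otimes>\<^bsub>AutoGroup ?A\<^esub> e \<in> auto ?A" using AG.m_closed[of g e] g e by simp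
    interpret g: group_hom ?A ?A g by (rule A.auto_group_hom[OF g(1)])
    interpret t: group_hom ?A ?A "artin_tau m"
      by (simp add: group_hom_def group_hom_axioms_def group_Artin artin_tau)
    have e_apply: "e x = ?a \<otimes>\<^bsub>?A\<^esub> artin_tau m x \<otimes>\<^bsub>?A\<^esub> inv\<^bsub>?A\<^esub> ?a" if "x \<in> carrier ?A" for x
      using that by (simp add: e_def mult_AutoGroup_apply A.conj_auto_auto artin_tau_auto A.conj_auto_apply)
    have "e ?c = ?c" by (simp add: e_apply) (simp add: artin_c_def artin_tau A.m_assoc)
    then have "(g \<otimes>\<^bsub>AutoGroup ?A\<^esub> e) ?c = ?c" using g e by (simp add: mult_AutoGroup_apply)
    moreover have "e ?a = ?c \<otimes>\<^bsub>?A\<^esub> inv\<^bsub>?A\<^esub> ?a" by (simp add: e_apply artin_tau artin_c_def)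
    then have "(g \<otimes>\<^bsub>AutoGroup ?A\<^esub> e) ?a = ?c \<otimes>\<^bsub>?A\<^esub> inv\<^bsub>?A\<^esub> (?c [^]\<^bsub>?A\<^esub> i \<otimes>\<^bsub>?A\<^esub> inv\<^bsub>?A\<^esub> ?a \<otimes>\<^bsub>?A\<^esub> ?c [^]\<^bsub>?A\<^esub> j)"
      using g e by (simp add: mult_AutoGroup_apply)
    then have "(g \<otimes>\<^bsub>AutoGroup ?A\<^esub> e) ?a = ?c [^]\<^bsub>?A\<^esub> (1 - j) \<otimes>\<^bsub>?A\<^esub> ?a \<otimes>\<^bsub>?A\<^esub> ?c [^]\<^bsub>?A\<^esub> (- i)"
      using nf.cpow_mult_assoc[of _ 1 "- j"]
      by (simp add: A.inv_mult_group A.m_assoc flip: A.int_pow_neg)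
    ultimately have geK: "g \<otimes>\<^bsub>AutoGroup ?A\<^esub> e \<in> K" by (rule pos[OF ge])
    have "g = g \<otimes>\<^bsub>AutoGroup ?A\<^esub> e \<otimes>\<^bsub>AutoGroup ?A\<^esub> inv\<^bsub>AutoGroup ?A\<^esub> e"
      using g e ge AG.inv_solve_right[of g "g \<otimes>\<^bsub>AutoGroup ?A\<^esub> e" e] by simp
    then show ?thesis using K.m_closed[OF geK K.m_inv_closed[OF eK]] by simp
  qed
  have t: "even_t m True = ?a" by (simp add: even_t_def)
  then have "carrier ?A = generate ?A {?c, even_t m True}" by (simp add: artin_even_generated)
  note letter = nf.aut_letter[OF f fc this, unfolded t]
  obtain i j p l :: int and x where fa: "f ?a = ?c [^]\<^bsub>?A\<^esub> i \<otimes>\<^bsub>?A\<^esub> x \<otimes>\<^bsub>?A\<^esub> ?c [^]\<^bsub>?A\<^esub> j" and x: "x \<in> carrier ?A"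
    and "nf.len x > 0" "nf.lead x = 0" "nf.lead (inv\<^bsub>?A\<^esub> x) = 0"
    and xp: "?a = x [^]\<^bsub>?A\<^esub> p \<otimes>\<^bsub>?A\<^esub> ?c [^]\<^bsub>?A\<^esub> (int k * l)"
    by (rule letter)
  \<comment> \<open>Opposite degrees for \<alpha> and \<beta> give \<open>c\<close> degree
    0.\<close>
  obtain h where h: "h \<in> hom ?A integer_group" "h ?a = 1" "h (artin_beta m) = - 1"
    by (rule artin_even_degree[OF k])
  interpret h: group_hom ?A integer_group h
    using h by (simp add: group_hom_def group_hom_axioms_def A.is_group)
  have "h ?c = 0" using h by (simp add: artin_c_def)
  then have "h (x [^]\<^bsub>?A\<^esub> p \<otimes>\<^bsub>?A\<^esub> ?c [^]\<^bsub>?A\<^esub> (int k * l)) = p * h x" using x by (simp add: h.hom_int_pow)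
  then have "p * h x = 1" using h xp by simp
  then have p: "p = 1 \<or> p = - 1" by (simp add: zmult_eq_1_iff) blast
  show ?thesis
  proof (cases "p = 1")
    case True
    then have "?a = x \<otimes>\<^bsub>?A\<^esub> ?c [^]\<^bsub>?A\<^esub> (int k * l)" using xp x by simp
    then have x_eq: "x = ?a \<otimes>\<^bsub>?A\<^esub> ?c [^]\<^bsub>?A\<^esub> (- (int k * l))"
      using x by (simp add: A.inv_solve_right A.int_pow_neg)
    have "f ?a = ?c [^]\<^bsub>?A\<^esub> i \<otimes>\<^bsub>?A\<^esub> ?a \<otimes>\<^bsub>?A\<^esub> ?c [^]\<^bsub>?A\<^esub> (- (int k * l) + j)"
      unfolding fa by (subst x_eq) (simp add: A.m_assoc nf.cpow_mult)
    then show ?thesis by (rule pos[OF f fc])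
  next
    case False
    with p have "p = - 1" by simp
    then have "?a = inv\<^bsub>?A\<^esub> x \<otimes>\<^bsub>?A\<^esub> ?c [^]\<^bsub>?A\<^esub> (int k * l)" using xp x by (simp add: A.int_pow_neg)
    then have "x \<otimes>\<^bsub>?A\<^esub> ?a = ?c [^]\<^bsub>?A\<^esub> (int k * l)" using x by simp
    then have "x = ?c [^]\<^bsub>?A\<^esub> (int k * l) \<otimes>\<^bsub>?A\<^esub> inv\<^bsub>?A\<^esub> ?a" using x by (simp add: A.inv_solve_right)
    then have "f ?a = ?c [^]\<^bsub>?A\<^esub> (i + int k * l) \<otimes>\<^bsub>?A\<^esub> inv\<^bsub>?A\<^esub> ?a \<otimes>\<^bsub>?A\<^esub> ?c [^]\<^bsub>?A\<^esub> j"
      unfolding fa by (simp add: A.m_assoc nf.cpow_mult_assoc)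
    then show ?thesis by (rule neg[OF f fc])
  qed
qed

section \<open>Outer automorphisms detected on the abelianization\<close>

lemma Inn_hom_integer:
  assumes "group G" "f \<in> Inn G" "h \<in> hom G integer_group" "x \<in> carrier G"
  shows "h (f x) = h x"
proof -
  interpret group G by fact
  interpret h: group_hom G integer_group h
    using assms by (simp add: group_hom_def group_hom_axioms_def)
  show ?thesis using assms(2,4) by (auto simp: Inn_def)
qed

lemma artin_eps_not_inner: "artin_eps m \<notin> Inn (Artin m)"
proof
  assume *: "artin_eps m \<in> Inn (Artin m)"
  obtain h where h: "h \<in> hom (Artin m) integer_group" "h (artin_alpha m) = 1" "h (artin_beta m) = 1"
    by (rule artin_degree)
  interpret h: group_hom "Artin m" integer_group h
    using h by (simp add: group_hom_def group_hom_axioms_def group_Artin)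
  show False using Inn_hom_integer[OF group_Artin * h(1), of "artin_alpha m"] h by (simp add: artin_eps)
qed

text \<open>Inner automorphisms preserve every homomorphism to the integers. Testing all choices of
  degrees \<open>p\<close>, \<open>q\<close> for \<alpha>, \<beta> compares the action on the
  abelianization with the identity.\<close>

lemma artin_even_map_inner:
  assumes m: "even m" and x: "x \<in> carrier (Z_semi_C2 \<times>\<times> C2)" and inner: "artin_even_map m x \<in> Inn (Artin m)"
  shows "x = \<one>\<^bsub>Z_semi_C2 \<times>\<times> C2\<^esub>"
proof -
  interpret A: group "Artin m" by (rule group_Artin)
  interpret AG: group "AutoGroup (Artin m)" by (rule A.AutoGroup)
  let ?A = "Artin m" and ?c = "artin_c m" and ?a = "artin_alpha m" and ?b = "artin_beta m"
  obtain n u e where xe: "x = ((n, u), e)" by (metis surj_pair)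
  have ue: "u = 0 \<or> u = 1" "e = 0 \<or> e = 1"
    using x by (auto simp: xe Z_semi_C2_def semidirect_def carrier_C2)
  let ?N = "artin_eta m [^]\<^bsub>AutoGroup ?A\<^esub> n"
  have N: "?N \<in> auto ?A" using AG.int_pow_closed[of "artin_eta m" n] artin_eta_auto[OF m] by simp
  interpret N: group_hom ?A ?A ?N by (rule A.auto_group_hom[OF N])
  interpret t: group_hom ?A ?A "artin_tau m"
    by (simp add: group_hom_def group_hom_axioms_def group_Artin artin_tau)
  have T: "artin_tau m [^]\<^bsub>AutoGroup ?A\<^esub> u \<in> auto ?A" "artin_eps m [^]\<^bsub>AutoGroup ?A\<^esub> e \<in> auto ?A"
    using AG.int_pow_closed[of "artin_tau m" u] artin_tau_auto AG.int_pow_closed[of "artin_eps m" e] artin_eps_auto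
    by simp_all
  have NT: "?N \<otimes>\<^bsub>AutoGroup ?A\<^esub> artin_tau m [^]\<^bsub>AutoGroup ?A\<^esub> u \<in> auto ?A"
    using AG.m_closed[of ?N "artin_tau m [^]\<^bsub>AutoGroup ?A\<^esub> u"] N T by simp
  have map: "artin_even_map m x y = ?N ((artin_tau m [^]\<^bsub>AutoGroup ?A\<^esub> u) ((artin_eps m [^]\<^bsub>AutoGroup ?A\<^esub> e) y))"
    if "y \<in> carrier ?A" for y
    using that N T NT by (simp add: xe artin_even_map_def mult_AutoGroup_apply auto_closed)
  have b: "?b = inv\<^bsub>?A\<^esub> ?a \<otimes>\<^bsub>?A\<^esub> ?c" by (simp add: artin_c_def)
  have Nab: "?N ?a = ?c [^]\<^bsub>?A\<^esub> (- n) \<otimes>\<^bsub>?A\<^esub> ?a"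
    "?N ?b = inv\<^bsub>?A\<^esub> (?c [^]\<^bsub>?A\<^esub> (- n) \<otimes>\<^bsub>?A\<^esub> ?a) \<otimes>\<^bsub>?A\<^esub> ?c"
    by (simp only: artin_eta_pow[OF m]) (subst b, simp add: artin_eta_pow[OF m])
  \<comment> \<open>The sign by which the power of \<epsilon> acts on degrees.\<close>
  define v :: int where "v = (if e = 0 then 1 else - 1)"
  have deg: "v * (if u = 0 then p - n * (p + q) else n * (p + q) + q) = p"
    "v * (if u = 0 then n * (p + q) + q else p - n * (p + q)) = q" for p q
  proof -
    obtain k where "m = 2 * k" using m by blast
    then obtain h where h: "h \<in> hom ?A integer_group" "h ?a = p" "h ?b = q"
      by (rule artin_even_degree)
    interpret h: group_hom ?A integer_group h
      using h by (simp add: group_hom_def group_hom_axioms_def A.is_group)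
    have hc: "h ?c = p + q" using h by (simp add: artin_c_def)
    have hN: "h (?N ?a) = p - n * (p + q)" "h (?N ?b) = n * (p + q) + q"
      unfolding Nab by (simp_all add: h.hom_int_pow hc h algebra_simps)
    have "h (artin_even_map m x ?a) = v * (if u = 0 then h (?N ?a) else h (?N ?b))"
      "h (artin_even_map m x ?b) = v * (if u = 0 then h (?N ?b) else h (?N ?a))"
      unfolding map[OF artin_gen_closed(1)] map[OF artin_gen_closed(2)]
      using ue artin_tau_auto artin_eps_auto
      by (elim disjE; simp add: v_def one_AutoGroup artin_tau artin_eps)+
    moreover have "h (artin_even_map m x ?a) = p" "h (artin_even_map m x ?b) = q"
      using Inn_hom_integer[OF group_Artin inner h(1)] h by simp_all
    ultimately show "v * (if u = 0 then p - n * (p + q) else n * (p + q) + q) = p"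
      "v * (if u = 0 then n * (p + q) + q else p - n * (p + q)) = q"
      unfolding hN by simp_all
  qed
  \<comment> \<open>For \<open>u = 1\<close> the degree pairs (0, 1) and (1, 0) would give n = -1
    and n = 1.\<close>
  have "u = 0" using ue deg(1)[of 0 1] deg(2)[of 1 0] by (auto simp: v_def split: if_splits)
  moreover have "n = 0" using \<open>u = 0\<close> deg(1)[of 0 1] by (auto simp: v_def split: if_splits)
  moreover have "e = 0" using ue \<open>u = 0\<close> \<open>n = 0\<close> deg(1)[of 1 0] by (auto simp: v_def)
  ultimately show ?thesis by (simp add: xe Z_semi_C2_def semidirect_def)
qed

lemma artin_odd_splitting:
  assumes m: "odd m" "m \<ge> 3"
  defines "S \<equiv> {artin_eps m}"
  shows "S \<subseteq> auto (Artin m)"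
    and "artin_odd_map m \<in> hom C2 (AutoGroup (Artin m))"
    and "\<And>a. a \<in> carrier C2 \<Longrightarrow> artin_odd_map m a \<in> Inn (Artin m) \<Longrightarrow> a = \<one>\<^bsub>C2\<^esub>"
    and "generate (AutoGroup (Artin m)) S = artin_odd_map m ` carrier C2"
    and "auto (Artin m) \<subseteq> generate (AutoGroup (Artin m)) (Inn (Artin m) \<union> S)"
proof -
  interpret A: group "Artin m" by (rule group_Artin)
  interpret AG: group "AutoGroup (Artin m)" by (rule A.AutoGroup)
  show S: "S \<subseteq> auto (Artin m)" by (simp add: S_def artin_eps_auto)
  have map: "artin_odd_map m = (\<lambda>a. artin_eps m [^]\<^bsub>AutoGroup (Artin m)\<^esub> a)"
    by (simp add: artin_odd_map_def fun_eq_iff)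
  have e: "artin_eps m \<in> carrier (AutoGroup (Artin m))" by (simp add: artin_eps_auto)
  show "artin_odd_map m \<in> hom C2 (AutoGroup (Artin m))"
    unfolding map by (rule AG.hom_C2[OF e artin_eps_square])
  show "generate (AutoGroup (Artin m)) S = artin_odd_map m ` carrier C2"
    unfolding map S_def by (rule AG.hom_C2_image[OF e artin_eps_square])
  show "a = \<one>\<^bsub>C2\<^esub>" if "a \<in> carrier C2" "artin_odd_map m a \<in> Inn (Artin m)" for a
    using that e artin_eps_not_inner[of m] by (auto simp: map carrier_C2)
  have sub: "Inn (Artin m) \<union> S \<subseteq> carrier (AutoGroup (Artin m))"
    using S by (auto simp: Inn_eq A.conj_auto_auto)
  have K: "Inn (Artin m) \<union> S \<subseteq> generate (AutoGroup (Artin m)) (Inn (Artin m) \<union> S)"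
    by (auto intro: generate.incl)
  obtain act where nf: "normal_form (Artin m) (artin_c m) (int m) (\<lambda>_::unit. artin_Delta m) (\<lambda>e. e) act"
    using m by (rule normal_form_odd)
  show "auto (Artin m) \<subseteq> generate (AutoGroup (Artin m)) (Inn (Artin m) \<union> S)"
  proof (rule artin_aut_reduce[OF nf _ AG.generate_is_subgroup[OF sub]])
    show "g \<in> generate (AutoGroup (Artin m)) (Inn (Artin m) \<union> S)"
      if "g \<in> auto (Artin m)" "g (artin_c m) = artin_c m" for g
      using artin_odd_fix_c_inner[OF m that] K by blast
  \<comment> \<open>Here \<open>m \<ge> 3\<close> supplies the first alternative of
    \<open>invol\<close> in \<open>artin_aut_reduce\<close>.\<close>
  qed (use K m in \<open>auto simp: S_def\<close>)
qed

lemma artin_even_splitting: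
  assumes m: "even m" "m \<ge> 3"
  defines "S \<equiv> {artin_eps m, artin_tau m, artin_eta m}"
  shows "S \<subseteq> auto (Artin m)"
    and "artin_even_map m \<in> hom (Z_semi_C2 \<times>\<times> C2) (AutoGroup (Artin m))"
    and "generate (AutoGroup (Artin m)) S = artin_even_map m ` carrier (Z_semi_C2 \<times>\<times> C2)"
    and "auto (Artin m) \<subseteq> generate (AutoGroup (Artin m)) (Inn (Artin m) \<union> S)"
proof -
  interpret A: group "Artin m" by (rule group_Artin)
  interpret AG: group "AutoGroup (Artin m)" by (rule A.AutoGroup)
  show S: "S \<subseteq> auto (Artin m)" using m by (simp add: S_def artin_eps_auto artin_tau_auto artin_eta_auto)
  have c: "artin_eta m \<in> carrier (AutoGroup (Artin m))" "artin_tau m \<in> carrier (AutoGroup (Artin m))"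
    "artin_eps m \<in> carrier (AutoGroup (Artin m))"
    using S by (simp_all add: S_def)
  note F = AG.hom_Z_semi_C2_C2[OF c artin_tau_square artin_eps_square artin_eps_eta[OF m(1)] artin_eps_tau
      artin_tau_eta[OF m(1)]]
  show "artin_even_map m \<in> hom (Z_semi_C2 \<times>\<times> C2) (AutoGroup (Artin m))"
    unfolding artin_even_map_def by (rule F(1))
  show "generate (AutoGroup (Artin m)) S = artin_even_map m ` carrier (Z_semi_C2 \<times>\<times> C2)"
    unfolding artin_even_map_def S_def by (rule F(2))
  have sub: "Inn (Artin m) \<union> S \<subseteq> carrier (AutoGroup (Artin m))"
    using S by (auto simp: Inn_eq A.conj_auto_auto)
  have K: "Inn (Artin m) \<union> S \<subseteq> generate (AutoGroup (Artin m)) (Inn (Artin m) \<union> S)"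
    by (auto intro: generate.incl)
  obtain k where k: "m = 2 * k" using m by blast
  then obtain act where nf: "normal_form (Artin m) (artin_c m) (int k) (even_t m) Not act"
    using normal_form_even[of m k] m(2) by auto
  show "auto (Artin m) \<subseteq> generate (AutoGroup (Artin m)) (Inn (Artin m) \<union> S)"
  proof (rule artin_aut_reduce[OF nf _ AG.generate_is_subgroup[OF sub]])
    show "g \<in> generate (AutoGroup (Artin m)) (Inn (Artin m) \<union> S)"
      if "g \<in> auto (Artin m)" "g (artin_c m) = artin_c m" for g
      by (rule artin_even_fix_c[OF m that AG.generate_is_subgroup[OF sub]]) (use K in \<open>auto simp: S_def\<close>)
  \<comment> \<open>No truth value equals its negation, so the second alternative of
    \<open>invol\<close> holds, even for \<open>m = 4\<close>, where \<open>k = 2\<close>.\<close>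
  qed (use K in \<open>auto simp: S_def\<close>)
qed

theorem theorem5p1:
  fixes m :: nat
  assumes "m \<ge> 3"
  shows
    "(odd m \<longrightarrow>
        artin_eps m \<in> auto (Artin m)
      \<and> generate (AutoGroup (Artin m)) (Inn (Artin m) \<union> {artin_eps m})
          = carrier (AutoGroup (Artin m))
      \<and> internal_semidirect (AutoGroup (Artin m)) (Inn (Artin m))
          (generate (AutoGroup (Artin m)) {artin_eps m})
      \<and> artin_odd_map m \<in>
          iso C2 (subgroup_generated (AutoGroup (Artin m)) {artin_eps m})
      \<and> (\<lambda>c. induced_auto (Artin m) (center (Artin m)) (artin_odd_map m c))
          \<in> hom C2 (AutoGroup (Artin m Mod center (Artin m)))
      \<and> AutoGroup (Artin m) \<cong>
          semidirect (Artin m Mod center (Artin m)) C2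
            (\<lambda>c. induced_auto (Artin m) (center (Artin m)) (artin_odd_map m c))
      \<and> Out (Artin m) \<cong> C2)
   \<and> (even m \<longrightarrow>
        {artin_eps m, artin_tau m, artin_eta m} \<subseteq> auto (Artin m)
      \<and> generate (AutoGroup (Artin m))
            (Inn (Artin m) \<union> {artin_eps m, artin_tau m, artin_eta m})
          = carrier (AutoGroup (Artin m))
      \<and> internal_semidirect (AutoGroup (Artin m)) (Inn (Artin m))
          (generate (AutoGroup (Artin m)) {artin_eps m, artin_tau m, artin_eta m})
      \<and> artin_even_map m \<in>
          iso (Z_semi_C2 \<times>\<times> C2)
            (subgroup_generated (AutoGroup (Artin m)) {artin_eps m, artin_tau m, artin_eta m})
      \<and> (\<lambda>h. induced_auto (Artin m) (center (Artin m)) (artin_even_map m h))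
          \<in> hom (Z_semi_C2 \<times>\<times> C2) (AutoGroup (Artin m Mod center (Artin m)))
      \<and> AutoGroup (Artin m) \<cong>
          semidirect (Artin m Mod center (Artin m)) (Z_semi_C2 \<times>\<times> C2)
            (\<lambda>h. induced_auto (Artin m) (center (Artin m)) (artin_even_map m h))
      \<and> Out (Artin m) \<cong> Z_semi_C2 \<times>\<times> C2)"
proof -
  interpret A: group "Artin m" by (rule group_Artin)
  let "(_ \<longrightarrow> ?odd) \<and> (_ \<longrightarrow> ?even)" = ?thesis
  have ?odd if "odd m"
  proof -
    note S = artin_odd_splitting[OF that assms]
    have "group C2" by simp
    note A.aut_splitting[OF this S(2,3,1,4,5)]
    then show ?thesis by (intro conjI artin_eps_auto)
  qed
  moreover have ?even if "even m"
  proof -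
    note S = artin_even_splitting[OF that assms]
    have "group (Z_semi_C2 \<times>\<times> C2)" by (intro DirProd_group group_Z_semi_C2) simp
    note A.aut_splitting[OF this S(2) artin_even_map_inner[OF that] S(1,3,4)]
    with S(1) show ?thesis by (intro conjI)
  qed
  ultimately show ?thesis by blast
qed

end
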